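(* Let $m\ge2$. The function $p\mapsto\mathfrak{F}_p$ on $[1,\infty)$ is differentiable at $p=2$, with derivative $\mathfrak{F}_2'=0$.
   Context: For a non-empty open $\Omega\subset\mathbb{R}^m$ with $|\Omega|<\infty$, $\lambda_1(\Omega)=\inf_{\varphi\in H_0^1(\Omega)\setminus\{0\}}\int_\Omega|D\varphi|^2/\int_\Omega\varphi^2$, $v_\Omega$ is the unique solution of $-\Delta v=1$, $v\in H_0^1(\Omega)$, $F_p(\Omega)=\|v_\Omega\|_{L^p(\Omega)}\lambda_1(\Omega)/|\Omega|^{1/p}$, and $\mathfrak{F}_p=\sup\{F_p(\Omega):\Omega\text{ open in }\mathbb{R}^m,\ 0<|\Omega|<\infty\}$. *)

theory Defs
  imports "HOL-Analysis.Analysis"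
begin

fun iter_deriv :: "'a::euclidean_space list \<Rightarrow> ('a \<Rightarrow> real) \<Rightarrow> 'a \<Rightarrow> real" where
  "iter_deriv [] f = f"
| "iter_deriv (v # vs) f = (\<lambda>x. frechet_derivative (iter_deriv vs f) (at x) v)"

definition smooth_fun :: "('a::euclidean_space \<Rightarrow> real) \<Rightarrow> bool" where
  "smooth_fun f \<longleftrightarrow> (\<forall>vs. set vs \<subseteq> Basis \<longrightarrow>
      (\<forall>x. iter_deriv vs f differentiable (at x)) \<and> continuous_on UNIV (iter_deriv vs f))"

definition test_fun :: "'a::euclidean_space set \<Rightarrow> ('a \<Rightarrow> real) \<Rightarrow> bool" where
  "test_fun \<Omega> \<phi> \<longleftrightarrow> smooth_fun \<phi> \<and> compact (closure {x. \<phi> x \<noteq> 0})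
      \<and> closure {x. \<phi> x \<noteq> 0} \<subseteq> \<Omega>"

definition grad :: "('a::euclidean_space \<Rightarrow> real) \<Rightarrow> 'a \<Rightarrow> 'a" where
  "grad f x = (\<Sum>i\<in>Basis. frechet_derivative f (at x) i *\<^sub>R i)"

text \<open>H_0^1(Omega): closure of C_c^infinity(Omega) in the H^1 norm. \<open>H01 \<Omega> u G\<close> means
  u belongs to H_0^1(Omega) (extended by zero) with weak gradient G.\<close>
definition H01 :: "'a::euclidean_space set \<Rightarrow> ('a \<Rightarrow> real) \<Rightarrow> ('a \<Rightarrow> 'a) \<Rightarrow> bool" where
  "H01 \<Omega> u G \<longleftrightarrow>
     u \<in> borel_measurable lborel \<and> G \<in> borel_measurable lborel \<and>
     (\<integral>\<^sup>+x. ennreal ((u x)\<^sup>2) \<partial>lborel) < \<infinity> \<and>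
     (\<integral>\<^sup>+x. ennreal ((norm (G x))\<^sup>2) \<partial>lborel) < \<infinity> \<and>
     (\<exists>\<phi>::nat \<Rightarrow> 'a \<Rightarrow> real. (\<forall>k. test_fun \<Omega> (\<phi> k)) \<and>
        (\<lambda>k. \<integral>\<^sup>+x. ennreal ((\<phi> k x - u x)\<^sup>2) \<partial>lborel) \<longlonglongrightarrow> 0 \<and>
        (\<lambda>k. \<integral>\<^sup>+x. ennreal ((norm (grad (\<phi> k) x - G x))\<^sup>2) \<partial>lborel) \<longlonglongrightarrow> 0)"

definition lambda1 :: "'a::euclidean_space set \<Rightarrow> real" where
  "lambda1 \<Omega> = Inf {(\<integral>x. (norm (G x))\<^sup>2 \<partial>lborel) / (\<integral>x. (u x)\<^sup>2 \<partial>lborel) | u G.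
                        H01 \<Omega> u G \<and> (\<integral>x. (u x)\<^sup>2 \<partial>lborel) \<noteq> 0}"

definition torsion_sol :: "'a::euclidean_space set \<Rightarrow> ('a \<Rightarrow> real) \<Rightarrow> bool" where
  "torsion_sol \<Omega> v \<longleftrightarrow> (\<exists>G. H01 \<Omega> v G \<and>
     (\<forall>\<phi>. test_fun \<Omega> \<phi> \<longrightarrow> (\<integral>x. G x \<bullet> grad \<phi> x \<partial>lborel) = (\<integral>x. \<phi> x \<partial>lborel)))"

definition Lp_norm :: "real \<Rightarrow> ('a::euclidean_space \<Rightarrow> real) \<Rightarrow> real" where
  "Lp_norm p v = enn2real (\<integral>\<^sup>+x. ennreal (\<bar>v x\<bar> powr p) \<partial>lborel) powr (1 / p)"

text \<open>\<open>\<parallel>v_\<Omega>\<parallel>_p\<close>; the torsion function is unique up to null sets, so the norm is well defined.\<close>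
definition torsion_Lp :: "real \<Rightarrow> 'a::euclidean_space set \<Rightarrow> real" where
  "torsion_Lp p \<Omega> = (THE r. \<exists>v. torsion_sol \<Omega> v \<and> r = Lp_norm p v)"

definition F_fun :: "real \<Rightarrow> 'a::euclidean_space set \<Rightarrow> real" where
  "F_fun p \<Omega> = torsion_Lp p \<Omega> * lambda1 \<Omega> / (measure lborel \<Omega>) powr (1 / p)"

definition F_sup :: "'a::euclidean_space itself \<Rightarrow> real \<Rightarrow> real" where
  "F_sup _ p = Sup {F_fun p \<Omega> | \<Omega>::'a set.
      open \<Omega> \<and> 0 < emeasure lborel \<Omega> \<and> emeasure lborel \<Omega> < \<infinity>}"

end

theory Submission
  imports Defs
begin

text \<open>
  Write $\langle f\rangle$ for the mean over $\Omega$ and $w = \lambda_1 v_\Omega$. Testing the torsion equation with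
  $v^{p-1}$ gives $\langle w^p\rangle \le c_p \langle w^{p-1}\rangle \le c_p \langle w^p\rangle^{1-1/p}$ with
  $c_p = p^2/(4(p-1))$, hence $F_p(\Omega) \le c_p = 1 + (p-2)^2/(4(p-1))$ for $p \ge 2$, and
  $F_p \le F_2 \le 1$ for $p \le 2$ because $F_p$ is nondecreasing in $p$. By the same monotonicity it remains to
  see that $F_1$ comes arbitrarily close to 1.

  Let $E$ be space minus small holes around the points of the integer lattice, and let $\mu$ be the bottom of its
  Dirichlet spectrum. The holes make $\mu$ positive; since points have zero capacity in dimension at least two,
  small holes make $\mu$ small. Take a near-minimiser $\varphi$ of norm 1 for $\mu$ and put
  $\Psi^2 = \sum_k \varphi(\cdot - k)^2$, the sum running over $N^m$ lattice points. Then
  $\int |D\Psi|^2 \le N^m \int |D\varphi|^2$ and the mean of $\Psi$ over every unit cube is at most 1, so averaging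
  $\int |\Psi(x+h)-\Psi(x)|^2\,dx \le |h|^2 \int |D\Psi|^2$ over $h$ in the unit cube yields
  $\int \Psi \ge N^m (1 - m \mu / 2)$ up to small errors. On the part $\Omega$ of $E$ in a cube of side about $N$ we get
  $\int v_\Omega \ge (\int\Psi)^2 / \int |D\Psi|^2$ and $\lambda_1(\Omega) \ge \mu$, which gives $F_1(\Omega) \to 1$.
\<close>

section \<open>Smooth functions\<close>

text \<open>The upper bound touches 1 at p = 2 to second order and the lower bound is constant, so
  \<open>F_sup\<close> is squeezed between 1 and 1 + O((p-2)^2); no maximising domain is involved.
  Since \<open>v\<close> is not known to be bounded, or in L^p for large p, its powers are not
  admissible test functions. Smooth bounded truncations replace them, and Fatou's lemma removes the
  truncation. For the lower bound the eigenvalue of the bounded piece is never computed: \<mu> of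
  the whole perforated space bounds it from below by inclusion, and a compactly supported
  near-minimiser replaces an eigenfunction. The square root of a sum of squares of translates
  periodises this function without raising its Rayleigh quotient. Expanding the squared increment
  bounds the correlation of Psi with its translates below by |Psi|^2 - (m/2) int |D Psi|^2: the 1/2
  comes from the expansion, and m bounds |h|^2 on the unit cube. A small \<mu> thus means that Psi
  is nearly constant, as a value of F_1 close to 1 demands. The volume added at the sides of the
  cube is negligible for large N.\<close>

definition pdir :: "'a::euclidean_space \<Rightarrow> ('a \<Rightarrow> real) \<Rightarrow> 'a \<Rightarrow> real" where
  "pdir b f = (\<lambda>x. frechet_derivative f (at x) b)"

lemma pdir_eq: "(f has_derivative f') (at x) \<Longrightarrow> pdir b f x = f' b"
  by (simp add: pdir_def flip: frechet_derivative_at)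

lemma pdir_1_eq: "(h has_real_derivative d) (at x) \<Longrightarrow> pdir 1 h x = d"
  using pdir_eq[of h "\<lambda>v. d * v" x 1] by (simp add: has_field_derivative_def)

lemma has_derivative_pdir:
  "f differentiable (at x) \<Longrightarrow> (f has_derivative (\<lambda>h. pdir h f x)) (at x)"
  by (simp add: pdir_def frechet_derivative_works)

text \<open>\<open>iter_deriv\<close> recurses on the outermost derivative. The product and chain
  rules need the innermost one split off first, since the first derivative of a product is a sum of
  products to which an induction hypothesis applies. \<open>ndiff 0\<close> already means
  differentiable.\<close>

primrec ndiff :: "nat \<Rightarrow> ('a::euclidean_space \<Rightarrow> real) \<Rightarrow> bool" where
  "ndiff 0 f \<longleftrightarrow> (\<forall>x. f differentiable (at x))"
| "ndiff (Suc n) f \<longleftrightarrow> (\<forall>x. f differentiable (at x)) \<and> (\<forall>b\<in>Basis. ndiff n (pdir b f))"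

lemma iter_deriv_snoc: "iter_deriv (vs @ [b]) f = iter_deriv vs (pdir b f)"
  by (induction vs) (auto simp: pdir_def)

lemma ndiff_iff_iter_deriv:
  "ndiff n f \<longleftrightarrow>
    (\<forall>vs. set vs \<subseteq> Basis \<and> length vs \<le> n \<longrightarrow> (\<forall>x. iter_deriv vs f differentiable (at x)))"
proof (induction n arbitrary: f)
  case 0
  then show ?case by auto
next
  case (Suc n)
  show ?case
  proof
    assume L: "ndiff (Suc n) f"
    show "\<forall>vs. set vs \<subseteq> Basis \<and> length vs \<le> Suc n \<longrightarrow> (\<forall>x. iter_deriv vs f differentiable (at x))"
    proof (intro allI impI)
      fix vs :: "'a list" and x
      assume vs: "set vs \<subseteq> Basis \<and> length vs \<le> Suc n"
      show "iter_deriv vs f differentiable (at x)"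
      proof (cases vs rule: rev_cases)
        case Nil
        then show ?thesis using L by simp
      next
        case (snoc us b)
        then have "ndiff n (pdir b f)" using vs L by simp
        then show ?thesis using Suc.IH[of "pdir b f"] vs snoc by (simp add: iter_deriv_snoc)
      qed
    qed
  next
    assume R: "\<forall>vs. set vs \<subseteq> Basis \<and> length vs \<le> Suc n \<longrightarrow> (\<forall>x. iter_deriv vs f differentiable (at x))"
    have "ndiff n (pdir b f)" if "b \<in> Basis" for b
      unfolding Suc.IH
    proof (intro allI impI)
      fix vs :: "'a list" and x
      assume "set vs \<subseteq> Basis \<and> length vs \<le> n"
      then show "iter_deriv vs (pdir b f) differentiable (at x)"
        using R[rule_format, of "vs @ [b]" x] that by (simp add: iter_deriv_snoc)
    qed
    then show "ndiff (Suc n) f" using R[rule_format, of "[]"] by simp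
  qed
qed

text \<open>Continuity of each derivative comes from its own differentiability, so only
  differentiability of all orders has to be tracked.\<close>

lemma smooth_fun_iff_ndiff: "smooth_fun f \<longleftrightarrow> (\<forall>n. ndiff n f)"
proof
  show "smooth_fun f \<Longrightarrow> \<forall>n. ndiff n f"
    by (auto simp: smooth_fun_def ndiff_iff_iter_deriv)
  assume R: "\<forall>n. ndiff n f"
  show "smooth_fun f"
    unfolding smooth_fun_def
  proof (intro allI impI conjI)
    fix vs :: "'a list"
    assume "set vs \<subseteq> Basis"
    then have *: "iter_deriv vs f differentiable (at x)" for x
      using R[rule_format, of "length vs"] by (auto simp: ndiff_iff_iter_deriv)
    show "iter_deriv vs f differentiable (at x)" for x by (rule *)
    show "continuous_on UNIV (iter_deriv vs f)"
      using * by (simp add: continuous_on_eq_continuous_at differentiable_imp_continuous_within)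
  qed
qed

section \<open>Higher derivatives of sums, products, compositions and powers\<close>

lemma ndiff_differentiable: "ndiff n f \<Longrightarrow> f differentiable (at x)"
  by (cases n) auto

lemma ndiff_SucD: "ndiff (Suc n) f \<Longrightarrow> ndiff n f"
  by (induction n arbitrary: f) auto

lemma pdir_add:
  "f differentiable (at x) \<Longrightarrow> g differentiable (at x) \<Longrightarrow>
    pdir b (\<lambda>x. f x + g x) x = pdir b f x + pdir b g x"
  by (intro pdir_eq[where f' = "\<lambda>h. pdir h f x + pdir h g x"] has_derivative_add has_derivative_pdir)

lemma pdir_mult:
  "f differentiable (at x) \<Longrightarrow> g differentiable (at x) \<Longrightarrow>
    pdir b (\<lambda>x. f x * g x) x = f x * pdir b g x + pdir b f x * g x"
  by (intro pdir_eq[where f' = "\<lambda>h. f x * pdir h g x + pdir h f x * g x"]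
      has_derivative_mult has_derivative_pdir)

lemma has_derivative_compose_pdir:
  fixes h :: "real \<Rightarrow> real"
  assumes "f differentiable (at x)" "h differentiable (at (f x))"
  shows "((\<lambda>x. h (f x)) has_derivative (\<lambda>v. pdir 1 h (f x) * pdir v f x)) (at x)"
proof -
  interpret bounded_linear "\<lambda>v. pdir v h (f x)"
    using has_derivative_pdir[OF assms(2)] by (rule has_derivative_bounded_linear)
  have "pdir v h (f x) = v * pdir 1 h (f x)" for v
    using scaleR[of v 1] by simp
  then have "(\<lambda>v. pdir v h (f x)) = (\<lambda>v. v * pdir 1 h (f x))"
    by (rule ext)
  then have "(h has_derivative (\<lambda>v. v * pdir 1 h (f x))) (at (f x))"
    using has_derivative_pdir[OF assms(2)] by simp
  from has_derivative_compose[OF has_derivative_pdir[OF assms(1)] this]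
  show ?thesis by (simp add: mult.commute)
qed

lemma ndiff_const [simp]: "ndiff n (\<lambda>_. c)"
proof (induction n arbitrary: c)
  case (Suc n)
  have "pdir b (\<lambda>_::'a. c) = (\<lambda>_. 0)" for b
    by (rule ext, rule pdir_eq[of _ "\<lambda>_. 0"]) (rule has_derivative_const)
  then show ?case using Suc by simp
qed simp

lemma ndiff_add: "ndiff n f \<Longrightarrow> ndiff n g \<Longrightarrow> ndiff n (\<lambda>x. f x + g x)"
proof (induction n arbitrary: f g)
  case (Suc n)
  have "pdir b (\<lambda>x. f x + g x) = (\<lambda>x. pdir b f x + pdir b g x)" for b
    using Suc.prems by (intro ext pdir_add) auto
  then show ?case using Suc by simp
qed simp

lemma ndiff_mult: "ndiff n f \<Longrightarrow> ndiff n g \<Longrightarrow> ndiff n (\<lambda>x. f x * g x)"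
proof (induction n arbitrary: f g)
  case (Suc n)
  have "pdir b (\<lambda>x. f x * g x) = (\<lambda>x. f x * pdir b g x + pdir b f x * g x)" for b
    using Suc.prems by (intro ext pdir_mult) auto
  moreover have "ndiff n (\<lambda>x. f x * pdir b g x + pdir b f x * g x)" if "b \<in> Basis" for b
    using Suc that ndiff_SucD by (intro ndiff_add Suc.IH) auto
  ultimately show ?case using Suc.prems by simp
qed simp

text \<open>The first derivative is a product whose factor \<open>pdir 1 h (f x)\<close> is again a
  composition, now of lower order; hence \<open>h\<close> varies in the induction.\<close>

lemma ndiff_compose:
  fixes h :: "real \<Rightarrow> real"
  shows "ndiff n h \<Longrightarrow> ndiff n f \<Longrightarrow> ndiff n (\<lambda>x. h (f x))"
proof (induction n arbitrary: h f)
  case 0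
  then show ?case
    unfolding ndiff.simps using has_derivative_compose_pdir differentiableI by blast
next
  case (Suc n)
  have "((\<lambda>x. h (f x)) has_derivative (\<lambda>v. pdir 1 h (f x) * pdir v f x)) (at x)" for x
    using Suc.prems by (intro has_derivative_compose_pdir) auto
  then have "(\<lambda>x. h (f x)) differentiable (at x)"
    "pdir b (\<lambda>x. h (f x)) = (\<lambda>x. pdir 1 h (f x) * pdir b f x)" for b x
    by (rule differentiableI, intro ext, rule pdir_eq)
  moreover have "ndiff n (\<lambda>x. pdir 1 h (f x) * pdir b f x)" if "b \<in> Basis" for b
    using Suc.prems that by (intro ndiff_mult Suc.IH[of "pdir 1 h" f] ndiff_SucD[of n f]) auto
  ultimately show ?case using Suc.prems by simp
qed

text \<open>Differentiation lowers the exponent by one, so the induction is over all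
  \<open>a\<close>; positivity keeps \<open>f\<close> away from the singularity of the power at
  0.\<close>

lemma ndiff_powr:
  "ndiff n f \<Longrightarrow> (\<And>x. f x > 0) \<Longrightarrow> ndiff n (\<lambda>x. f x powr a)"
proof (induction n arbitrary: f a)
  case 0
  show ?case unfolding ndiff.simps
  proof
    fix x
    have "f differentiable (at x)" using 0 by auto
    then show "(\<lambda>x. f x powr a) differentiable (at x)"
      using 0(2)[of x]
      by (intro differentiableI[OF has_derivative_powr[OF has_derivative_pdir has_derivative_const]]) auto
  qed
next
  case (Suc n)
  have d: "((\<lambda>x. f x powr a) has_derivative (\<lambda>h. (a * f x powr (a - 1)) * pdir h f x)) (at x)" for x
  proof -
    have "f differentiable (at x)" using Suc by auto
    from has_derivative_powr[OF has_derivative_pdir[OF this] has_derivative_const[of a] Suc.prems(2)]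
    show ?thesis using Suc.prems(2)[of x]
      by (auto simp: powr_diff field_simps elim!: has_derivative_eq_rhs)
  qed
  then have "(\<lambda>x. f x powr a) differentiable (at x)"
    "pdir b (\<lambda>x. f x powr a) = (\<lambda>x. (a * f x powr (a - 1)) * pdir b f x)" for b x
    by (auto simp: differentiable_def intro!: ext pdir_eq)
  moreover have "ndiff n (\<lambda>x. (a * f x powr (a - 1)) * pdir b f x)" if "b \<in> Basis" for b
    using Suc.prems that ndiff_SucD[OF Suc.prems(1)] by (intro ndiff_mult Suc.IH) auto
  ultimately show ?case using Suc.prems by simp
qed

lemma ndiff_affine: "ndiff n f \<Longrightarrow> ndiff n (\<lambda>x. f (a + c *\<^sub>R x))"
proof (induction n arbitrary: f)
  case 0
  have "((\<lambda>x. a + c *\<^sub>R x) has_derivative (\<lambda>h. c *\<^sub>R h)) (at x)" for x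
    by (auto intro!: derivative_eq_intros)
  from has_derivative_compose[OF this has_derivative_pdir]
  show ?case using 0 unfolding ndiff.simps using differentiableI by blast
next
  case (Suc n)
  have d: "((\<lambda>x. f (a + c *\<^sub>R x)) has_derivative (\<lambda>h. c * pdir h f (a + c *\<^sub>R x))) (at x)" for x
  proof -
    have f: "(f has_derivative (\<lambda>h. pdir h f (a + c *\<^sub>R x))) (at (a + c *\<^sub>R x))"
      using Suc by (intro has_derivative_pdir) auto
    interpret bounded_linear "\<lambda>h. pdir h f (a + c *\<^sub>R x)"
      using f by (rule has_derivative_bounded_linear)
    have "((\<lambda>x. a + c *\<^sub>R x) has_derivative (\<lambda>h. c *\<^sub>R h)) (at x)"
      by (auto intro!: derivative_eq_intros)
    from has_derivative_compose[OF this f] show ?thesis by (simp add: scaleR)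
  qed
  then have "(\<lambda>x. f (a + c *\<^sub>R x)) differentiable (at x)"
    "pdir b (\<lambda>x. f (a + c *\<^sub>R x)) = (\<lambda>x. c * pdir b f (a + c *\<^sub>R x))" for b x
    by (auto simp: differentiable_def intro!: ext pdir_eq)
  then show ?case using Suc by (auto intro!: ndiff_mult)
qed

lemma ndiff_inner_left: "ndiff n (\<lambda>x. x \<bullet> v)"
proof (cases n)
  case 0
  then show ?thesis by (auto intro!: derivative_intros)
next
  case (Suc m)
  have "((\<lambda>x. x \<bullet> v) has_derivative (\<lambda>h. h \<bullet> v)) (at x)" for x
    by (auto intro!: derivative_eq_intros)
  then have "(\<lambda>x. x \<bullet> v) differentiable (at x)" "pdir b (\<lambda>x. x \<bullet> v) = (\<lambda>x. b \<bullet> v)" for b x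
    by (auto simp: differentiable_def intro!: ext pdir_eq)
  then show ?thesis using Suc by auto
qed

section \<open>Closure properties of smooth functions\<close>

lemma smooth_const: "smooth_fun (\<lambda>_. c)"
  by (simp add: smooth_fun_iff_ndiff)

lemma smooth_add: "smooth_fun f \<Longrightarrow> smooth_fun g \<Longrightarrow> smooth_fun (\<lambda>x. f x + g x)"
  by (simp add: smooth_fun_iff_ndiff ndiff_add)

lemma smooth_mult: "smooth_fun f \<Longrightarrow> smooth_fun g \<Longrightarrow> smooth_fun (\<lambda>x. f x * g x)"
  by (simp add: smooth_fun_iff_ndiff ndiff_mult)

lemma smooth_diff: "smooth_fun f \<Longrightarrow> smooth_fun g \<Longrightarrow> smooth_fun (\<lambda>x. f x - g x)"
  using smooth_add[OF _ smooth_mult[OF smooth_const[of "-1"]], of f g] by simp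

lemma smooth_power: "smooth_fun f \<Longrightarrow> smooth_fun (\<lambda>x. f x ^ n)"
  by (induction n) (simp_all add: smooth_const smooth_mult)

lemma smooth_sum: "(\<And>i. i \<in> I \<Longrightarrow> smooth_fun (f i)) \<Longrightarrow> smooth_fun (\<lambda>x. \<Sum>i\<in>I. f i x)"
  by (induction I rule: infinite_finite_induct) (simp_all add: smooth_const smooth_add)

lemma smooth_compose:
  fixes h :: "real \<Rightarrow> real"
  shows "smooth_fun h \<Longrightarrow> smooth_fun f \<Longrightarrow> smooth_fun (\<lambda>x. h (f x))"
  by (simp add: smooth_fun_iff_ndiff ndiff_compose)

lemma smooth_powr: "smooth_fun f \<Longrightarrow> (\<And>x. f x > 0) \<Longrightarrow> smooth_fun (\<lambda>x. f x powr a)"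
  by (simp add: smooth_fun_iff_ndiff ndiff_powr)

lemma smooth_affine: "smooth_fun f \<Longrightarrow> smooth_fun (\<lambda>x. f (a + c *\<^sub>R x))"
  by (simp add: smooth_fun_iff_ndiff ndiff_affine)

lemma smooth_inner_left: "smooth_fun (\<lambda>x. x \<bullet> v)"
  by (simp add: smooth_fun_iff_ndiff ndiff_inner_left)

lemma smooth_ident: "smooth_fun (\<lambda>x::real. x)"
  using smooth_inner_left[of "1::real"] by simp

lemma smooth_norm_sq: "smooth_fun (\<lambda>x::'a::euclidean_space. (norm x)\<^sup>2)"
proof -
  have "smooth_fun (\<lambda>x::'a. \<Sum>b\<in>Basis. (x \<bullet> b)\<^sup>2)"
    by (intro smooth_sum smooth_power smooth_inner_left)
  moreover have "(norm x)\<^sup>2 = (\<Sum>b\<in>Basis. (x \<bullet> b)\<^sup>2)" for x :: 'a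
    unfolding power2_norm_eq_inner by (subst euclidean_inner) (simp add: power2_eq_square)
  ultimately show ?thesis by presburger
qed

lemma smooth_differentiable: "smooth_fun f \<Longrightarrow> f differentiable (at x)"
  by (auto simp: smooth_fun_iff_ndiff ndiff_differentiable)

lemma smooth_continuous: "smooth_fun f \<Longrightarrow> continuous_on S f"
  by (simp add: smooth_differentiable continuous_at_imp_continuous_on differentiable_imp_continuous_within)

lemma smooth_pdir: "smooth_fun f \<Longrightarrow> b \<in> Basis \<Longrightarrow> smooth_fun (pdir b f)"
  by (meson ndiff.simps(2) smooth_fun_iff_ndiff)

lemma smooth_real_deriv:
  fixes h :: "real \<Rightarrow> real"
  assumes "smooth_fun h"
  shows "(h has_real_derivative deriv h x) (at x)"
  using smooth_differentiable[OF assms] DERIV_deriv_iff_real_differentiable by blast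

lemma smooth_deriv:
  fixes h :: "real \<Rightarrow> real"
  assumes "smooth_fun h"
  shows "smooth_fun (deriv h)"
proof -
  have "pdir 1 h = deriv h"
    using smooth_real_deriv[OF assms] by (intro ext pdir_1_eq)
  then show ?thesis using smooth_pdir[OF assms, of 1] by simp
qed

subsection \<open>Gradients\<close>

lemma has_derivative_grad:
  assumes "f differentiable (at x)"
  shows "(f has_derivative (\<lambda>h. grad f x \<bullet> h)) (at x)"
proof -
  have d: "(f has_derivative frechet_derivative f (at x)) (at x)"
    using assms by (simp add: frechet_derivative_works)
  interpret bounded_linear "frechet_derivative f (at x)"
    using d by (rule has_derivative_bounded_linear)
  have "frechet_derivative f (at x) h = grad f x \<bullet> h" for h
  proof -
    have "frechet_derivative f (at x) h = frechet_derivative f (at x) (\<Sum>b\<in>Basis. (h \<bullet> b) *\<^sub>R b)"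
      by (simp add: euclidean_representation)
    also have "\<dots> = grad f x \<bullet> h"
      unfolding grad_def inner_sum_left
      by (simp add: sum scaleR inner_commute[of _ h] mult.commute)
    finally show ?thesis .
  qed
  then have "frechet_derivative f (at x) = (\<lambda>h. grad f x \<bullet> h)" by (rule ext)
  then show ?thesis using d by simp
qed

lemma grad_eq:
  assumes "(f has_derivative (\<lambda>h. g \<bullet> h)) (at x)"
  shows "grad f x = g"
proof -
  have "frechet_derivative f (at x) = (\<lambda>h. g \<bullet> h)"
    using frechet_derivative_at[OF assms] by simp
  then show ?thesis by (simp add: grad_def euclidean_representation)
qed

lemma has_derivative_grad_smooth: "smooth_fun f \<Longrightarrow> (f has_derivative (\<lambda>h. grad f x \<bullet> h)) (at x)"
  by (simp add: has_derivative_grad smooth_differentiable)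

lemma continuous_on_grad: "smooth_fun f \<Longrightarrow> continuous_on S (grad f)"
  unfolding grad_def pdir_def[symmetric, THEN fun_cong]
  by (intro continuous_on_sum continuous_on_scaleR smooth_continuous smooth_pdir continuous_on_const)

lemma grad_add: "smooth_fun f \<Longrightarrow> smooth_fun g \<Longrightarrow> grad (\<lambda>x. f x + g x) x = grad f x + grad g x"
  by (intro grad_eq) (auto intro!: derivative_eq_intros has_derivative_grad_smooth simp: inner_add_left)

lemma grad_cmult: "smooth_fun f \<Longrightarrow> grad (\<lambda>x. c * f x) x = c *\<^sub>R grad f x"
  by (intro grad_eq) (auto intro!: derivative_eq_intros has_derivative_grad_smooth)

lemma grad_diff: "smooth_fun f \<Longrightarrow> smooth_fun g \<Longrightarrow> grad (\<lambda>x. f x - g x) x = grad f x - grad g x"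
  by (intro grad_eq) (auto intro!: derivative_eq_intros has_derivative_grad_smooth simp: inner_diff_left)

lemma grad_mult:
  "smooth_fun f \<Longrightarrow> smooth_fun g \<Longrightarrow> grad (\<lambda>x. f x * g x) x = f x *\<^sub>R grad g x + g x *\<^sub>R grad f x"
  by (intro grad_eq) (auto intro!: derivative_eq_intros has_derivative_grad_smooth simp: inner_add_left)

lemma grad_sum:
  assumes "\<And>i. i \<in> I \<Longrightarrow> smooth_fun (f i)"
  shows "grad (\<lambda>x. \<Sum>i\<in>I. f i x) x = (\<Sum>i\<in>I. grad (f i) x)"
  using assms
  by (intro grad_eq) (auto intro!: derivative_eq_intros has_derivative_grad_smooth simp: inner_sum_left)

lemma grad_compose:
  assumes "(h has_real_derivative d) (at (f x))" "smooth_fun f"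
  shows "grad (\<lambda>x. h (f x)) x = d *\<^sub>R grad f x"
  using has_derivative_compose[OF has_derivative_grad_smooth[OF assms(2)], of h _ x]
    assms(1)
  by (intro grad_eq) (auto simp: has_field_derivative_def)

lemma grad_affine:
  assumes "smooth_fun f"
  shows "grad (\<lambda>x. f (a + c *\<^sub>R x)) x = c *\<^sub>R grad f (a + c *\<^sub>R x)"
proof -
  have "((\<lambda>x. a + c *\<^sub>R x) has_derivative (\<lambda>h. c *\<^sub>R h)) (at x)"
    by (auto intro!: derivative_eq_intros)
  from has_derivative_compose[OF this has_derivative_grad_smooth[OF assms]]
  show ?thesis by (intro grad_eq) simp
qed

lemma grad_eq_0_on_open:
  assumes "open U" "x \<in> U" "\<And>y. y \<in> U \<Longrightarrow> f y = c"
  shows "grad f x = 0"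
proof -
  have "((\<lambda>_. c) has_derivative (\<lambda>_. 0)) (at x)" by simp
  then have "(f has_derivative (\<lambda>_. 0)) (at x)"
    using has_derivative_transform_within_open[OF _ assms(1,2), of "\<lambda>_. c" _ UNIV f] assms(3) by auto
  then show ?thesis by (intro grad_eq) simp
qed

subsection \<open>Bump functions\<close>

text \<open>For \<open>k = 0\<close> this is the classical exp(-1/t). The extra powers of 1/t make
  the family closed under differentiation up to linear combinations, which is what the induction on
  the order needs.\<close>

definition flat :: "nat \<Rightarrow> real \<Rightarrow> real" where
  "flat k t = (if t > 0 then inverse t ^ k * exp (- inverse t) else 0)"

lemma flat_tendsto_0: "((\<lambda>t. inverse t ^ k * exp (- inverse t)) \<longlongrightarrow> (0::real)) (at_right 0)"
proof -
  have "((\<lambda>x::real. x ^ k / exp x) \<longlongrightarrow> 0) at_top"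
    by (rule tendsto_power_div_exp_0)
  from filterlim_compose[OF this filterlim_inverse_at_top_right]
  show ?thesis by (simp add: exp_minus divide_inverse)
qed

text \<open>Only t = 0 is delicate: the left difference quotient vanishes, and the right one is the
  same expression with \<open>Suc k\<close> in place of \<open>k\<close>, which tends to 0 because
  the exponential beats every power.\<close>

lemma flat_has_derivative:
  "(flat k has_real_derivative flat (k + 2) t - real k * flat (k + 1) t) (at t)"
proof -
  consider "t < 0" | "t = 0" | "t > 0" by linarith
  then show ?thesis
  proof cases
    case 1
    have "((\<lambda>_. 0) has_real_derivative 0) (at t)" by simp
    then have "(flat k has_real_derivative 0) (at t)"
      using has_field_derivative_transform_within_open[of "\<lambda>_. 0" 0 t "{..<0}" "flat k"] 1
      by (auto simp: flat_def)
    then show ?thesis using 1 by (simp add: flat_def)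
  next
    case 2
    have "((\<lambda>h. flat k h / h) \<longlongrightarrow> 0) (at_right 0)"
    proof (rule Lim_transform_eventually)
      show "((\<lambda>t. inverse t ^ Suc k * exp (- inverse t)) \<longlongrightarrow> (0::real)) (at_right 0)"
        by (rule flat_tendsto_0)
      show "\<forall>\<^sub>F x in at_right (0::real). inverse x ^ Suc k * exp (- inverse x) = flat k x / x"
        by (auto simp: eventually_at_right_field flat_def divide_inverse intro!: exI[of _ 1])
    qed
    moreover have "((\<lambda>h. flat k h / h) \<longlongrightarrow> 0) (at_left 0)"
    proof (rule Lim_transform_eventually[OF tendsto_const])
      show "\<forall>\<^sub>F x in at_left (0::real). 0 = flat k x / x"
        by (auto simp: eventually_at_left_field flat_def intro!: exI[of _ "-1"])
    qed
    ultimately have "((\<lambda>h. flat k h / h) \<longlongrightarrow> 0) (at 0)"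
      by (simp add: filterlim_split_at)
    then show ?thesis using 2 by (simp add: DERIV_def flat_def)
  next
    case 3
    have "((\<lambda>t. inverse t ^ k) has_real_derivative - real k * inverse t ^ (k + 1)) (at t)"
    proof (rule DERIV_power[OF DERIV_inverse, THEN DERIV_cong])
      show "t \<noteq> 0" using 3 by simp
      show "real k * (- (inverse t ^ Suc (Suc 0)) * inverse t ^ (k - Suc 0)) = - real k * inverse t ^ (k + 1)"
        by (cases k) (auto simp: algebra_simps)
    qed
    moreover have "((\<lambda>t. exp (- inverse t)) has_real_derivative inverse t ^ 2 * exp (- inverse t)) (at t)"
      using 3 by (auto intro!: derivative_eq_intros simp: power2_eq_square)
    ultimately have "((\<lambda>t. inverse t ^ k * exp (- inverse t)) has_real_derivative
        flat (k + 2) t - real k * flat (k + 1) t) (at t)"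
      by (rule DERIV_mult[THEN DERIV_cong]) (use 3 in \<open>simp add: flat_def algebra_simps power2_eq_square\<close>)
    then show ?thesis
      using has_field_derivative_transform_within_open[of _ _ t "{0<..}" "flat k"] 3
      by (auto simp: flat_def)
  qed
qed

lemma ndiff_flat: "ndiff n (flat k)"
proof (induction n arbitrary: k)
  case 0
  then show ?case using flat_has_derivative[of k]
    by (auto simp: differentiable_def has_field_derivative_def)
next
  case (Suc n)
  have "flat k differentiable (at x)" for x using flat_has_derivative[of k]
    by (auto simp: differentiable_def has_field_derivative_def)
  moreover have "pdir 1 (flat k) = (\<lambda>t. flat (k + 2) t + (- real k) * flat (k + 1) t)"
    using flat_has_derivative[of k]
    by (intro ext pdir_1_eq) simp
  ultimately show ?case
    using ndiff_add[OF Suc[of "k + 2"] ndiff_mult[OF ndiff_const[of n "- real k"] Suc[of "k + 1"]]] by simp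
qed

lemma smooth_flat: "smooth_fun (flat k)"
  by (simp add: smooth_fun_iff_ndiff ndiff_flat)

lemma flat_0_pos: "t > 0 \<Longrightarrow> flat 0 t > 0" and flat_0_nonneg: "flat 0 t \<ge> 0"
  and flat_0_eq_0: "t \<le> 0 \<Longrightarrow> flat 0 t = 0"
  by (auto simp: flat_def)

text \<open>Squared norms keep the argument of \<open>flat 0\<close> smooth at the centre.\<close>

definition bump :: "'a::euclidean_space \<Rightarrow> real \<Rightarrow> 'a \<Rightarrow> real" where
  "bump a r x = flat 0 (r\<^sup>2 - (norm (x - a))\<^sup>2)"

lemma smooth_bump: "smooth_fun (bump a r)"
proof -
  have "smooth_fun (\<lambda>x. (norm (- a + 1 *\<^sub>R x))\<^sup>2)"
    by (rule smooth_affine[OF smooth_norm_sq])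
  then have "smooth_fun (\<lambda>x. (norm (x - a))\<^sup>2)" by simp
  then show ?thesis unfolding bump_def
    by (intro smooth_compose[OF smooth_flat] smooth_diff smooth_const)
qed

lemma bump_pos: "r > 0 \<Longrightarrow> dist x a < r \<Longrightarrow> bump a r x > 0"
  unfolding bump_def by (intro flat_0_pos) (simp add: dist_norm power2_strict_mono)

lemma bump_eq_0: "r > 0 \<Longrightarrow> dist x a \<ge> r \<Longrightarrow> bump a r x = 0"
  unfolding bump_def by (intro flat_0_eq_0) (simp add: dist_norm power_mono)

text \<open>The quotient of \<open>flat 0 t\<close> by \<open>flat 0 t + flat 0 (1 - t)\<close>: t
  and 1 - t are never both nonpositive, so the denominator is positive. Division is written as a
  power with exponent -1 to be covered by \<open>smooth_powr\<close>.\<close>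

lemma smooth_step_exists:
  obtains \<sigma> :: "real \<Rightarrow> real" where "smooth_fun \<sigma>" "\<And>t. 0 \<le> \<sigma> t" "\<And>t. \<sigma> t \<le> 1"
    "\<And>t. t \<le> 0 \<Longrightarrow> \<sigma> t = 0" "\<And>t. t \<ge> 1 \<Longrightarrow> \<sigma> t = 1"
proof
  let ?d = "\<lambda>t. flat 0 t + flat 0 (1 - t)"
  let ?s = "\<lambda>t. flat 0 t * ?d t powr (- 1)"
  have pos: "?d t > 0" for t
    using flat_0_pos[of t] flat_0_pos[of "1 - t"] flat_0_nonneg[of t] flat_0_nonneg[of "1 - t"]
    by (cases "t > 0") (auto simp: add_pos_nonneg add_nonneg_pos)
  have e: "?s t = flat 0 t / ?d t" for t
    using pos[of t] by (simp add: powr_minus divide_inverse)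
  have "smooth_fun (\<lambda>t::real. flat 0 (1 + (-1) *\<^sub>R t))"
    by (rule smooth_affine[OF smooth_flat])
  then have "smooth_fun ?d" using smooth_add[OF smooth_flat] by simp
  then show "smooth_fun ?s"
    by (intro smooth_mult smooth_flat smooth_powr pos)
  show "0 \<le> ?s t" for t using flat_0_nonneg[of t] by simp
  show "?s t \<le> 1" for t using pos[of t] flat_0_nonneg[of "1 - t"] unfolding e by simp
  show "?s t = 0" if "t \<le> 0" for t using that by (simp add: flat_0_eq_0)
  show "?s t = 1" if "t \<ge> 1" for t
    using pos[of t] that flat_0_eq_0[of "1 - t"] unfolding e by simp
qed

section \<open>Square-integrable functions\<close>

definition L2 :: "('a::euclidean_space \<Rightarrow> 'b::euclidean_space) \<Rightarrow> bool" where
  "L2 f \<longleftrightarrow> f \<in> borel_measurable lborel \<and> integrable lborel (\<lambda>x. (norm (f x))\<^sup>2)"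

text \<open>The squared L^2 norm, for functions and gradient fields alike. It is informative only
  together with \<open>L2\<close>, because the integral of a nonintegrable function is 0 by
  convention.\<close>

definition sqn :: "('a::euclidean_space \<Rightarrow> 'b::euclidean_space) \<Rightarrow> real" where
  "sqn f = (LBINT x. (norm (f x))\<^sup>2)"

lemma sqn_nonneg [simp]: "0 \<le> sqn f"
  by (simp add: sqn_def)

lemma L2_measurable: "L2 f \<Longrightarrow> f \<in> borel_measurable borel"
  by (simp add: L2_def)

lemma L2_integrable: "L2 f \<Longrightarrow> integrable lborel (\<lambda>x. (norm (f x))\<^sup>2)"
  by (simp add: L2_def)

lemma nn_integral_sq: "L2 f \<Longrightarrow> (\<integral>\<^sup>+x. ennreal ((norm (f x))\<^sup>2) \<partial>lborel) = ennreal (sqn f)"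
  by (simp add: L2_def sqn_def nn_integral_eq_integral)

lemma L2I_nn_integral:
  assumes "f \<in> borel_measurable borel" "(\<integral>\<^sup>+x. ennreal ((norm (f x))\<^sup>2) \<partial>lborel) < \<infinity>"
  shows "L2 f"
  using assms unfolding L2_def by (auto intro!: integrableI_nonneg)

lemma norm_add_sq_le: "(norm (a + b))\<^sup>2 \<le> 2 * (norm a)\<^sup>2 + 2 * (norm (b :: 'b::real_normed_vector))\<^sup>2"
proof -
  have "(norm (a + b))\<^sup>2 \<le> (norm a + norm b)\<^sup>2"
    by (intro power_mono norm_triangle_ineq) simp
  also have "\<dots> \<le> 2 * (norm a)\<^sup>2 + 2 * (norm b)\<^sup>2"
    using sum_squares_ge_zero[of "norm a - norm b" 0] by (simp add: power2_eq_square algebra_simps)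
  finally show ?thesis .
qed

lemma L2_add:
  assumes "L2 f" "L2 g"
  shows "L2 (\<lambda>x. f x + g x)"
  unfolding L2_def
proof
  note [measurable] = L2_measurable[OF assms(1)] L2_measurable[OF assms(2)]
  show "(\<lambda>x. f x + g x) \<in> borel_measurable lborel" by simp
  have "integrable lborel (\<lambda>x. 2 * (norm (f x))\<^sup>2 + 2 * (norm (g x))\<^sup>2)"
    using assms by (auto simp: L2_def)
  then show "integrable lborel (\<lambda>x. (norm (f x + g x))\<^sup>2)"
    by (rule Bochner_Integration.integrable_bound) (auto intro!: norm_add_sq_le)
qed

lemma L2_scaleR: "L2 f \<Longrightarrow> L2 (\<lambda>x. c *\<^sub>R f x)"
  by (auto simp: L2_def power_mult_distrib)

lemma L2_cmult: "L2 f \<Longrightarrow> L2 (\<lambda>x. c * (f x :: real))"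
  using L2_scaleR[of f c] by simp

lemma L2_diff: "L2 f \<Longrightarrow> L2 g \<Longrightarrow> L2 (\<lambda>x. f x - g x)"
  using L2_add[OF _ L2_scaleR[of g "-1"]] by simp

lemma L2_bound:
  assumes "L2 g" "f \<in> borel_measurable borel" "\<And>x. norm (f x) \<le> norm (g x)"
  shows "L2 f"
  unfolding L2_def
proof
  note [measurable] = assms(2)
  show "f \<in> borel_measurable lborel" by simp
  show "integrable lborel (\<lambda>x. (norm (f x))\<^sup>2)"
    by (rule Bochner_Integration.integrable_bound[OF L2_integrable[OF assms(1)]])
      (auto intro!: power_mono assms(3))
qed

lemma sqn_scaleR: "sqn (\<lambda>x. c *\<^sub>R f x) = c\<^sup>2 * sqn f"
  by (simp add: sqn_def power_mult_distrib)

lemma sqn_cmult: "sqn (\<lambda>x. c * (f x :: real)) = c\<^sup>2 * sqn f"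
  using sqn_scaleR[of c f] by simp

lemma sqn_minus_commute: "sqn (\<lambda>x. f x - g x) = sqn (\<lambda>x. g x - f x)"
  by (simp add: sqn_def norm_minus_commute)

lemma integrable_inner_L2:
  assumes "L2 f" "L2 g"
  shows "integrable lborel (\<lambda>x. f x \<bullet> g x)"
proof -
  note [measurable] = L2_measurable[OF assms(1)] L2_measurable[OF assms(2)]
  have "integrable lborel (\<lambda>x. (norm (f x))\<^sup>2 + (norm (g x))\<^sup>2)"
    using assms by (auto simp: L2_def)
  then show ?thesis
  proof (rule Bochner_Integration.integrable_bound)
    have "\<bar>f x \<bullet> g x\<bar> \<le> (norm (f x))\<^sup>2 + (norm (g x))\<^sup>2" for x
    proof -
      have "\<bar>f x \<bullet> g x\<bar> \<le> norm (f x) * norm (g x)" by (rule Cauchy_Schwarz_ineq2)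
      also have "\<dots> \<le> (norm (f x))\<^sup>2 + (norm (g x))\<^sup>2"
        using sum_squares_bound[of "norm (f x)" "norm (g x)"]
          mult_nonneg_nonneg[OF norm_ge_zero[of "f x"] norm_ge_zero[of "g x"]] by linarith
      finally show ?thesis .
    qed
    then show "AE x in lborel. norm (f x \<bullet> g x) \<le> norm ((norm (f x))\<^sup>2 + (norm (g x))\<^sup>2)"
      by auto
  qed simp
qed

lemma sqn_add:
  assumes "L2 f" "L2 g"
  shows "sqn (\<lambda>x. f x + g x) = sqn f + 2 * (LBINT x. f x \<bullet> g x) + sqn g"
proof -
  have "(norm (f x + g x))\<^sup>2 = (norm (f x))\<^sup>2 + 2 * (f x \<bullet> g x) + (norm (g x))\<^sup>2" for x
    by (simp add: power2_norm_eq_inner inner_add_left inner_add_right inner_commute)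
  then show ?thesis
    using assms integrable_inner_L2[OF assms] by (simp add: sqn_def L2_def)
qed

lemma sqn_diff:
  assumes "L2 f" "L2 g"
  shows "sqn (\<lambda>x. f x - g x) = sqn f - 2 * (LBINT x. f x \<bullet> g x) + sqn g"
  using sqn_add[OF assms(1) L2_scaleR[OF assms(2), of "-1"]] sqn_scaleR[of "-1" g] by simp

lemma sqn_add_le: "L2 f \<Longrightarrow> L2 g \<Longrightarrow> sqn (\<lambda>x. f x + g x) \<le> 2 * sqn f + 2 * sqn g"
  using sqn_add[of f g] sqn_diff[of f g] sqn_nonneg[of "\<lambda>x. f x - g x"] by linarith

text \<open>Discriminant argument: the quadratic t -> |f + t g|^2 is nonnegative, and where it
  degenerates to an affine function its slope must vanish.\<close>

lemma Cauchy_Schwarz_L2: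
  assumes "L2 f" "L2 g"
  shows "(LBINT x. f x \<bullet> g x)\<^sup>2 \<le> sqn f * sqn g"
proof -
  let ?I = "LBINT x. f x \<bullet> g x"
  have q: "0 \<le> sqn f + 2 * t * ?I + t\<^sup>2 * sqn g" for t
    using sqn_add[OF assms(1) L2_scaleR[OF assms(2), of t]] sqn_scaleR[of t g]
      sqn_nonneg[of "\<lambda>x. f x + t *\<^sub>R g x"] by simp
  show ?thesis
  proof (cases "sqn g = 0")
    case True
    have "?I = 0"
    proof (rule ccontr)
      assume "?I \<noteq> 0"
      \<comment> \<open>This choice of \<open>t\<close> would give the affine function the value
        -1.\<close>
      then show False using q[of "- (sqn f + 1) / (2 * ?I)"] True by (simp add: field_simps)
    qed
    then show ?thesis by simp
  next
    case False
    then have "sqn g > 0" using sqn_nonneg[of g] by linarith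
    then show ?thesis using q[of "- ?I / sqn g"]
      by (simp add: power2_eq_square field_simps)
  qed
qed

lemma Cauchy_Schwarz_L2_abs:
  assumes "L2 f" "L2 g"
  shows "\<bar>LBINT x. f x \<bullet> g x\<bar> \<le> sqrt (sqn f) * sqrt (sqn g)"
  using real_sqrt_le_mono[OF Cauchy_Schwarz_L2[OF assms]] by (simp add: real_sqrt_mult)

section \<open>Limits in L^2 and completeness\<close>

lemma tendsto_inner_L2:
  assumes "\<And>k. L2 (f k)" "L2 f'" "L2 g" and lim: "(\<lambda>k. sqn (\<lambda>x. f k x - f' x)) \<longlonglongrightarrow> 0"
  shows "(\<lambda>k. LBINT x. f k x \<bullet> g x) \<longlonglongrightarrow> (LBINT x. f' x \<bullet> g x)"
proof -
  have "(\<lambda>k. sqrt (sqn (\<lambda>x. f k x - f' x)) * sqrt (sqn g)) \<longlonglongrightarrow> sqrt 0 * sqrt (sqn g)"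
    by (intro tendsto_intros lim)
  then have "(\<lambda>k. sqrt (sqn (\<lambda>x. f k x - f' x)) * sqrt (sqn g)) \<longlonglongrightarrow> 0" by simp
  then have "(\<lambda>k. (LBINT x. f k x \<bullet> g x) - (LBINT x. f' x \<bullet> g x)) \<longlonglongrightarrow> 0"
  proof (rule Lim_null_comparison[rotated], intro always_eventually allI)
    fix k
    have "(LBINT x. f k x \<bullet> g x) - (LBINT x. f' x \<bullet> g x) = (LBINT x. (f k x - f' x) \<bullet> g x)"
      using integrable_inner_L2[OF assms(1,3)] integrable_inner_L2[OF assms(2,3)]
      by (simp add: inner_diff_left)
    then show "norm ((LBINT x. f k x \<bullet> g x) - (LBINT x. f' x \<bullet> g x))
        \<le> sqrt (sqn (\<lambda>x. f k x - f' x)) * sqrt (sqn g)"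
      using Cauchy_Schwarz_L2_abs[OF L2_diff[OF assms(1,2)] assms(3)] by simp
  qed
  then show ?thesis by (simp add: LIM_zero_iff)
qed

lemma tendsto_sqn:
  assumes "\<And>k. L2 (f k)" "L2 f'" and lim: "(\<lambda>k. sqn (\<lambda>x. f k x - f' x)) \<longlonglongrightarrow> 0"
  shows "(\<lambda>k. sqn (f k)) \<longlonglongrightarrow> sqn f'"
proof -
  have "(\<lambda>k. sqn (\<lambda>x. f k x - f' x) + 2 * (LBINT x. f k x \<bullet> f' x) - sqn f') \<longlonglongrightarrow>
      0 + 2 * (LBINT x. f' x \<bullet> f' x) - sqn f'"
    by (intro tendsto_intros lim tendsto_inner_L2 assms)
  moreover have "sqn (\<lambda>x. f k x - f' x) + 2 * (LBINT x. f k x \<bullet> f' x) - sqn f' = sqn (f k)" for k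
    using sqn_diff[OF assms(1,2)] by simp
  moreover have "(LBINT x. f' x \<bullet> f' x) = sqn f'"
    by (simp add: sqn_def power2_norm_eq_inner)
  ultimately show ?thesis by simp
qed

lemma AE_subseq_L2:
  assumes "\<And>k. L2 (f k)" "L2 f'" "(\<lambda>k. sqn (\<lambda>x. f k x - f' x)) \<longlonglongrightarrow> 0"
  obtains r where "strict_mono (r :: nat \<Rightarrow> nat)" "AE x in lborel. (\<lambda>k. f (r k) x) \<longlonglongrightarrow> f' x"
proof -
  have "\<exists>r::nat\<Rightarrow>nat. strict_mono r \<and> (AE x in lborel. (\<lambda>n. (norm (f (r n) x - f' x))\<^sup>2) \<longlonglongrightarrow> 0)"
    using assms L2_integrable[OF L2_diff[OF assms(1,2)]]
    by (intro tendsto_L1_AE_subseq) (simp_all add: sqn_def)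
  then obtain r where r: "strict_mono (r :: nat \<Rightarrow> nat)"
      "AE x in lborel. (\<lambda>n. (norm (f (r n) x - f' x))\<^sup>2) \<longlonglongrightarrow> 0" by auto
  have "AE x in lborel. (\<lambda>k. f (r k) x) \<longlonglongrightarrow> f' x"
    using r(2)
  proof eventually_elim
    case (elim x)
    have "(\<lambda>n. norm (f (r n) x - f' x)) \<longlonglongrightarrow> 0"
      using tendsto_real_sqrt[OF elim] by simp
    then show ?case by (simp add: tendsto_norm_zero_iff LIM_zero_iff)
  qed
  then show ?thesis using that r(1) by blast
qed

text \<open>Riesz-Fischer: a rapidly Cauchy subsequence converges almost everywhere, and Fatou's
  lemma shows that its pointwise limit is also the limit in L^2 of the whole sequence.\<close>

lemma L2_complete:
  fixes f :: "nat \<Rightarrow> 'a::euclidean_space \<Rightarrow> 'b::euclidean_space"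
  assumes L: "\<And>k. L2 (f k)"
    and C: "\<And>e. e > 0 \<Longrightarrow> \<exists>N. \<forall>m\<ge>N. \<forall>n\<ge>N. sqn (\<lambda>x. f m x - f n x) \<le> e"
  obtains f' where "L2 f'" "(\<lambda>k. sqn (\<lambda>x. f k x - f' x)) \<longlonglongrightarrow> 0"
proof -
  note [measurable] = L2_measurable[OF L]
  \<comment> \<open>The rate 1/4 leaves a summable (1/2)^k after multiplication by the weight 2^k
    below.\<close>
  have "\<forall>k. \<exists>N. \<forall>m\<ge>N. \<forall>n\<ge>N. sqn (\<lambda>x. f m x - f n x) \<le> (1/4) ^ k"
    by (intro allI C) simp
  then obtain N where N: "\<And>k m n. m \<ge> N k \<Longrightarrow> n \<ge> N k \<Longrightarrow> sqn (\<lambda>x. f m x - f n x) \<le> (1/4) ^ k"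
    by metis
  define r where "r k = (\<Sum>i\<le>k. N i)" for k
  have rN: "N j \<le> r k" if "j \<le> k" for j k
    unfolding r_def using that by (intro member_le_sum) auto
  define d where "d k x = f (r (Suc k)) x - f (r k) x" for k x
  have dL: "L2 (d k)" for k unfolding d_def by (intro L2_diff L)
  have [measurable]: "d k \<in> borel_measurable borel" for k by (rule L2_measurable[OF dL])
  have dle: "sqn (d k) \<le> (1/4) ^ k" for k
    unfolding d_def by (intro N rN) auto
  have "(\<integral>\<^sup>+x. (\<Sum>k. ennreal (2 ^ k * (norm (d k x))\<^sup>2)) \<partial>lborel)
      = (\<Sum>k. \<integral>\<^sup>+x. ennreal (2 ^ k * (norm (d k x))\<^sup>2) \<partial>lborel)"
    by (rule nn_integral_suminf) simp
  also have "\<dots> = (\<Sum>k. ennreal (2 ^ k * sqn (d k)))"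
    using nn_integral_sq[OF dL] by (simp add: ennreal_mult nn_integral_cmult)
  also have "\<dots> \<le> (\<Sum>k. ennreal ((1/2) ^ k))"
  proof (intro suminf_le ennreal_leI)
    fix k
    have "2 ^ k * sqn (d k) \<le> 2 ^ k * (1/4) ^ k"
      by (intro mult_left_mono dle) simp
    also have "\<dots> = (1/2) ^ k" by (simp flip: power_mult_distrib)
    finally show "2 ^ k * sqn (d k) \<le> (1/2) ^ k" .
  qed auto
  also have "\<dots> = ennreal (\<Sum>k. (1/2) ^ k)"
    by (intro suminf_ennreal2) auto
  also have "\<dots> < \<infinity>" by simp
  finally have "AE x in lborel. (\<Sum>k. ennreal (2 ^ k * (norm (d k x))\<^sup>2)) \<noteq> \<infinity>"
    by (intro nn_integral_PInf_AE) auto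
  then have ae: "AE x in lborel. (\<lambda>k. f (r k) x) \<longlonglongrightarrow> lim (\<lambda>k. f (r k) x)"
  proof eventually_elim
    case (elim x)
    have s: "summable (\<lambda>k. 2 ^ k * (norm (d k x))\<^sup>2)"
      using elim by (intro summable_suminf_not_top) auto
    \<comment> \<open>The arithmetic-geometric mean inequality turns the weighted sum of squares
      into absolute summability of the increments.\<close>
    have "norm (d k x) \<le> (1/2) ^ k + 2 ^ k * (norm (d k x))\<^sup>2" for k
    proof -
      have "0 \<le> (2 ^ k * norm (d k x) - 1)\<^sup>2" by simp
      then have "2 * (2 ^ k * norm (d k x)) \<le> (2 ^ k * norm (d k x))\<^sup>2 + 1"
        by (simp add: power2_diff)
      then have "2 * norm (d k x) \<le> 2 ^ k * (norm (d k x))\<^sup>2 + (1/2) ^ k"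
        by (simp add: field_simps power2_eq_square)
      then show ?thesis using norm_ge_zero[of "d k x"] by linarith
    qed
    then have "summable (\<lambda>k. d k x)"
      by (intro summable_comparison_test'[OF summable_add[OF complete_algebra_summable_geometric s], where N = 0])
        auto
    then have "convergent (\<lambda>k. \<Sum>i<k. d i x)"
      by (simp add: summable_iff_convergent)
    then have "convergent (\<lambda>k. (\<Sum>i<k. d i x) + f (r 0) x)"
      by (intro convergent_add convergent_const)
    moreover have "(\<Sum>i<k. d i x) + f (r 0) x = f (r k) x" for k
      unfolding d_def by (subst sum_lessThan_telescope) simp
    ultimately show ?case by (simp add: convergent_LIMSEQ_iff)
  qed
  define f' where "f' x = lim (\<lambda>k. f (r k) x)" for x
  have [measurable]: "f' \<in> borel_measurable borel" unfolding f'_def by simp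
  \<comment> \<open>Fatou's lemma in the subsequence index while \<open>n\<close> stays
    fixed.\<close>
  have bound: "(\<integral>\<^sup>+x. ennreal ((norm (f n x - f' x))\<^sup>2) \<partial>lborel) \<le> ennreal ((1/4) ^ j)" if "n \<ge> N j" for n j
  proof -
    have "(\<integral>\<^sup>+x. ennreal ((norm (f n x - f' x))\<^sup>2) \<partial>lborel)
        = (\<integral>\<^sup>+x. liminf (\<lambda>k. ennreal ((norm (f n x - f (r k) x))\<^sup>2)) \<partial>lborel)"
    proof (rule nn_integral_cong_AE)
      show "AE x in lborel. ennreal ((norm (f n x - f' x))\<^sup>2)
          = liminf (\<lambda>k. ennreal ((norm (f n x - f (r k) x))\<^sup>2))"
        using ae
      proof eventually_elim
        case (elim x)
        have "(\<lambda>k. ennreal ((norm (f n x - f (r k) x))\<^sup>2)) \<longlonglongrightarrow> ennreal ((norm (f n x - f' x))\<^sup>2)"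
          using elim unfolding f'_def[symmetric] by (intro tendsto_intros)
        then show ?case using lim_imp_Liminf[OF sequentially_bot] by metis
      qed
    qed
    also have "\<dots> \<le> liminf (\<lambda>k. \<integral>\<^sup>+x. ennreal ((norm (f n x - f (r k) x))\<^sup>2) \<partial>lborel)"
      by (intro nn_integral_liminf) auto
    also have "\<dots> \<le> ennreal ((1/4) ^ j)"
    proof (rule Liminf_le)
      show "\<forall>\<^sub>F k in sequentially. (\<integral>\<^sup>+x. ennreal ((norm (f n x - f (r k) x))\<^sup>2) \<partial>lborel) \<le> ennreal ((1/4) ^ j)"
      proof (rule eventually_sequentiallyI[of j])
        fix k assume "j \<le> k"
        then show "(\<integral>\<^sup>+x. ennreal ((norm (f n x - f (r k) x))\<^sup>2) \<partial>lborel) \<le> ennreal ((1/4) ^ j)"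
          unfolding nn_integral_sq[OF L2_diff[OF L L]]
          by (intro ennreal_leI N that rN)
      qed
    qed simp
    finally show ?thesis .
  qed
  have "L2 (\<lambda>x. f (N 0) x - f' x)"
    using bound[of 0 "N 0"] by (intro L2I_nn_integral) (auto simp: order_le_less_trans)
  from L2_diff[OF L[of "N 0"] this] have L': "L2 f'" by simp
  have "(\<lambda>k. sqn (\<lambda>x. f k x - f' x)) \<longlonglongrightarrow> 0"
  proof (rule LIMSEQ_I)
    fix e :: real assume "e > 0"
    then obtain j where j: "(1/4) ^ j < e" using real_arch_pow_inv[of e "1/4"] by auto
    have "norm (sqn (\<lambda>x. f k x - f' x) - 0) < e" if "k \<ge> N j" for k
      using bound[OF that] j unfolding nn_integral_sq[OF L2_diff[OF L L']]
      by (simp add: ennreal_le_iff)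
    then show "\<exists>no. \<forall>n\<ge>no. norm (sqn (\<lambda>x. f n x - f' x) - 0) < e" by blast
  qed
  then show ?thesis using that L' by blast
qed

section \<open>Lebesgue integrals of compactly supported functions\<close>

lemma integrable_compact_support:
  fixes f :: "'a::euclidean_space \<Rightarrow> 'b::euclidean_space"
  assumes "continuous_on UNIV f" "compact K" "\<And>x. x \<notin> K \<Longrightarrow> f x = 0"
  shows "integrable lborel f"
proof -
  have "integrable lborel (\<lambda>x. indicator K x *\<^sub>R f x)"
    using assms by (intro borel_integrable_compact continuous_on_subset[OF assms(1)]) auto
  moreover have "(\<lambda>x. indicator K x *\<^sub>R f x) = f"
    using assms(3) by (auto simp: indicator_def)
  ultimately show ?thesis by simp
qed

lemma L2_compact_support:
  assumes "continuous_on UNIV f" "compact K" "\<And>x. x \<notin> K \<Longrightarrow> f x = 0"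
  shows "L2 f"
  unfolding L2_def using assms
  by (auto intro!: borel_measurable_continuous_onI integrable_compact_support[of _ K] continuous_intros)

section \<open>Integrals and norms under dilations and translations\<close>

lemma nn_integral_lborel_affine:
  fixes f :: "'a::euclidean_space \<Rightarrow> ennreal"
  assumes [measurable]: "f \<in> borel_measurable borel" and "c \<noteq> 0"
  shows "(\<integral>\<^sup>+x. f x \<partial>lborel) = \<bar>c\<bar> ^ DIM('a) * (\<integral>\<^sup>+x. f (t + c *\<^sub>R x) \<partial>lborel)"
  by (subst lborel_affine[OF assms(2), of t])
    (simp add: nn_integral_density nn_integral_distr nn_integral_cmult ennreal_power)

lemma nn_integral_lborel_translate:
  fixes f :: "'a::euclidean_space \<Rightarrow> ennreal"
  assumes [measurable]: "f \<in> borel_measurable borel"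
  shows "(\<integral>\<^sup>+x. f (x + t) \<partial>lborel) = (\<integral>\<^sup>+x. f x \<partial>lborel)"
  using nn_integral_lborel_affine[of f 1 t] by (simp add: add.commute)

lemma sqn_affine:
  fixes f :: "'a::euclidean_space \<Rightarrow> 'b::euclidean_space"
  assumes "L2 f" "c \<noteq> 0"
  shows "L2 (\<lambda>x. f (t + c *\<^sub>R x))" "sqn (\<lambda>x. f (t + c *\<^sub>R x)) = sqn f / \<bar>c\<bar> ^ DIM('a)"
proof -
  note [measurable] = L2_measurable[OF assms(1)]
  have e: "ennreal (sqn f) = ennreal (\<bar>c\<bar> ^ DIM('a)) * (\<integral>\<^sup>+x. ennreal ((norm (f (t + c *\<^sub>R x)))\<^sup>2) \<partial>lborel)"
    using nn_integral_lborel_affine[of "\<lambda>x. ennreal ((norm (f x))\<^sup>2)" c t] nn_integral_sq[OF assms(1)] assms(2)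
    by (simp add: ennreal_power)
  show L: "L2 (\<lambda>x. f (t + c *\<^sub>R x))"
  proof (rule L2I_nn_integral)
    show "(\<integral>\<^sup>+x. ennreal ((norm (f (t + c *\<^sub>R x)))\<^sup>2) \<partial>lborel) < \<infinity>"
    proof (rule ccontr)
      assume "\<not> ?thesis"
      then have "ennreal (sqn f) = \<infinity>" using e assms(2)
        by (simp add: not_less top_unique ennreal_mult_top)
      then show False by simp
    qed
  qed simp
  have "ennreal (sqn f) = ennreal (\<bar>c\<bar> ^ DIM('a) * sqn (\<lambda>x. f (t + c *\<^sub>R x)))"
    unfolding e nn_integral_sq[OF L] by (simp add: ennreal_mult)
  then have "sqn f = \<bar>c\<bar> ^ DIM('a) * sqn (\<lambda>x. f (t + c *\<^sub>R x))"
    by (subst (asm) ennreal_inj) auto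
  then show "sqn (\<lambda>x. f (t + c *\<^sub>R x)) = sqn f / \<bar>c\<bar> ^ DIM('a)"
    using assms(2) by (simp add: field_simps)
qed

lemma sqn_translate: "L2 f \<Longrightarrow> L2 (\<lambda>x. f (x + t))" "L2 f \<Longrightarrow> sqn (\<lambda>x. f (x + t)) = sqn f"
  using sqn_affine[of f 1 t] by (simp_all add: add.commute)

subsection \<open>Test functions\<close>

lemma test_funI:
  assumes "smooth_fun f" "compact K" "K \<subseteq> U" "\<And>x. x \<notin> K \<Longrightarrow> f x = 0"
  shows "test_fun U f"
proof -
  have "closure {x. f x \<noteq> 0} \<subseteq> K"
    using assms(4) compact_imp_closed[OF assms(2)] by (intro closure_minimal) auto
  moreover from this have "compact (closure {x. f x \<noteq> 0})"
    using compact_Int_closed[OF assms(2) closed_closure[of "{x. f x \<noteq> 0}"]]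
    by (simp only: Int_absorb1)
  ultimately show ?thesis
    using assms by (auto simp: test_fun_def)
qed

lemma test_funE:
  assumes "test_fun U f"
  obtains K where "compact K" "K \<subseteq> U" "\<And>x. x \<notin> K \<Longrightarrow> f x = 0" "\<And>x. x \<notin> K \<Longrightarrow> grad f x = 0"
proof -
  let ?K = "closure {x. f x \<noteq> 0}"
  have z: "f x = 0" if "x \<notin> ?K" for x
    using that closure_subset[of "{x. f x \<noteq> 0}"] by auto
  have g: "grad f x = 0" if "x \<notin> ?K" for x
    by (rule grad_eq_0_on_open[OF open_Compl[OF closed_closure] Compl_iff[THEN iffD2, OF that], where c = 0])
      (rule z, erule ComplD)
  have "compact ?K" "?K \<subseteq> U" using assms by (simp_all only: test_fun_def)
  then show ?thesis by (rule that[OF _ _ z g])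
qed

lemma test_fun_smooth: "test_fun U f \<Longrightarrow> smooth_fun f"
  by (simp add: test_fun_def)

lemma test_fun_outside: "test_fun U f \<Longrightarrow> x \<notin> U \<Longrightarrow> f x = 0"
  by (meson subsetD test_funE)

lemma test_fun_mono: "test_fun U f \<Longrightarrow> U \<subseteq> V \<Longrightarrow> test_fun V f"
  by (auto simp: test_fun_def)

lemma test_fun_mult:
  assumes "test_fun U f" "smooth_fun g"
  shows "test_fun U (\<lambda>x. g x * f x)"
proof -
  obtain K where "compact K" "K \<subseteq> U" "\<And>x. x \<notin> K \<Longrightarrow> f x = 0" using assms(1) test_funE by metis
  then show ?thesis
    using assms by (intro test_funI[of _ K] smooth_mult) (auto dest: test_fun_smooth)
qed

lemma test_fun_cmult: "test_fun U f \<Longrightarrow> test_fun U (\<lambda>x. c * f x)"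
  by (intro test_fun_mult smooth_const)

lemma test_fun_add:
  assumes "test_fun U f" "test_fun U g"
  shows "test_fun U (\<lambda>x. f x + g x)"
proof -
  obtain K where K: "compact K" "K \<subseteq> U" "\<And>x. x \<notin> K \<Longrightarrow> f x = 0" using assms(1) test_funE by metis
  obtain K' where K': "compact K'" "K' \<subseteq> U" "\<And>x. x \<notin> K' \<Longrightarrow> g x = 0" using assms(2) test_funE by metis
  show ?thesis
    by (rule test_funI[of _ "K \<union> K'"])
      (use assms K K' in \<open>auto intro: smooth_add test_fun_smooth\<close>)
qed

lemma test_fun_diff: "test_fun U f \<Longrightarrow> test_fun U g \<Longrightarrow> test_fun U (\<lambda>x. f x - g x)"
  using test_fun_add[OF _ test_fun_cmult[of U g "-1"], of f] by simp

lemma test_fun_compose: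
  assumes "test_fun U f" "smooth_fun h" "h 0 = 0"
  shows "test_fun U (\<lambda>x. h (f x))"
proof -
  obtain K where "compact K" "K \<subseteq> U" "\<And>x. x \<notin> K \<Longrightarrow> f x = 0" using assms(1) test_funE by metis
  then show ?thesis
    using test_funI[OF smooth_compose[OF assms(2) test_fun_smooth[OF assms(1)]], of K U] assms(3) by simp
qed

lemma test_fun_continuous: "test_fun U f \<Longrightarrow> continuous_on S f"
  by (simp add: smooth_continuous test_fun_smooth)

lemma test_fun_continuous_grad: "test_fun U f \<Longrightarrow> continuous_on S (grad f)"
  by (simp add: continuous_on_grad test_fun_smooth)

lemma L2_test_fun: "test_fun U f \<Longrightarrow> L2 f"
  using L2_compact_support[OF test_fun_continuous] by (metis test_funE)

lemma L2_grad_test_fun: "test_fun U f \<Longrightarrow> L2 (grad f)"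
  using L2_compact_support[OF test_fun_continuous_grad] by (metis test_funE)

lemma integrable_test_fun: "test_fun U f \<Longrightarrow> integrable lborel f"
  using integrable_compact_support[OF test_fun_continuous] by (metis test_funE)

lemma test_fun_bump: "r > 0 \<Longrightarrow> cball a r \<subseteq> U \<Longrightarrow> test_fun U (bump a r)"
  by (intro test_funI[of _ "cball a r"] smooth_bump)
    (auto intro!: bump_eq_0 simp: dist_commute)

text \<open>A positive value at one point gives a nonempty open set of positivity, and such a set is
  not negligible.\<close>

lemma continuous_integral_pos:
  fixes f :: "'a::euclidean_space \<Rightarrow> real"
  assumes "continuous_on UNIV f" "integrable lborel f" "\<And>x. f x \<ge> 0" "f a > 0"
  shows "(LBINT x. f x) > 0"
proof -
  have "open {x. f x > 0}" using assms(1) by (intro open_Collect_less) auto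
  then have "\<not> negligible {x. f x > 0}"
    using assms(4) open_not_negligible by blast
  then have "\<not> (AE x in lborel. f x = 0)"
  proof (rule contrapos_nn)
    assume "AE x in lborel. f x = 0"
    then have "AE x in lborel. x \<notin> {x. f x > 0}" by eventually_elim simp
    moreover have "{x. f x > 0} \<in> sets lborel" using \<open>open {x. f x > 0}\<close> by simp
    ultimately have "{x. f x > 0} \<in> null_sets lborel" using AE_iff_null_sets by blast
    then show "negligible {x. f x > 0}"
      by (simp add: negligible_iff_null_sets null_sets_completionI)
  qed
  then show ?thesis
    using integral_nonneg_eq_0_iff_AE[OF assms(2)] assms(3) integral_nonneg_AE[of f lborel]
    by (simp add: order_less_le)
qed

lemma sqn_test_fun_pos:
  assumes "test_fun U f" "f a \<noteq> 0"
  shows "sqn f > 0"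
  unfolding sqn_def
  using assms L2_integrable[OF L2_test_fun[OF assms(1)]]
  by (intro continuous_integral_pos[of _ a] continuous_intros test_fun_continuous[of U f]) auto

text \<open>Test functions and their gradients are square-integrable, so all norms in
  \<open>H01\<close> are finite and the limits in the extended half-line become limits of
  reals.\<close>

lemma H01_iff:
  "H01 U u G \<longleftrightarrow> L2 u \<and> L2 G \<and> (\<exists>\<phi>. (\<forall>k. test_fun U (\<phi> k)) \<and>
      (\<lambda>k. sqn (\<lambda>x. \<phi> k x - u x)) \<longlonglongrightarrow> 0 \<and> (\<lambda>k. sqn (\<lambda>x. grad (\<phi> k) x - G x)) \<longlonglongrightarrow> 0)"
  (is "?L \<longleftrightarrow> ?R")
proof -
  have lim: "((\<lambda>k. \<integral>\<^sup>+x. ennreal ((\<phi> k x - u x)\<^sup>2) \<partial>lborel) \<longlonglongrightarrow> 0) = ((\<lambda>k. sqn (\<lambda>x. \<phi> k x - u x)) \<longlonglongrightarrow> 0)"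
    "((\<lambda>k. \<integral>\<^sup>+x. ennreal ((norm (grad (\<phi> k) x - G x))\<^sup>2) \<partial>lborel) \<longlonglongrightarrow> 0)
      = ((\<lambda>k. sqn (\<lambda>x. grad (\<phi> k) x - G x)) \<longlonglongrightarrow> 0)"
    if "L2 u" "L2 G" "\<forall>k. test_fun U (\<phi> k)" for \<phi>
  proof -
    have "(\<integral>\<^sup>+x. ennreal ((\<phi> k x - u x)\<^sup>2) \<partial>lborel) = ennreal (sqn (\<lambda>x. \<phi> k x - u x))" for k
      using nn_integral_sq[OF L2_diff[OF L2_test_fun \<open>L2 u\<close>], of U "\<phi> k"] that by simp
    moreover have "(\<integral>\<^sup>+x. ennreal ((norm (grad (\<phi> k) x - G x))\<^sup>2) \<partial>lborel)
        = ennreal (sqn (\<lambda>x. grad (\<phi> k) x - G x))" for k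
      using nn_integral_sq[OF L2_diff[OF L2_grad_test_fun \<open>L2 G\<close>], of U "\<phi> k"] that by simp
    ultimately show "((\<lambda>k. \<integral>\<^sup>+x. ennreal ((\<phi> k x - u x)\<^sup>2) \<partial>lborel) \<longlonglongrightarrow> 0) = ((\<lambda>k. sqn (\<lambda>x. \<phi> k x - u x)) \<longlonglongrightarrow> 0)"
      "((\<lambda>k. \<integral>\<^sup>+x. ennreal ((norm (grad (\<phi> k) x - G x))\<^sup>2) \<partial>lborel) \<longlonglongrightarrow> 0)
        = ((\<lambda>k. sqn (\<lambda>x. grad (\<phi> k) x - G x)) \<longlonglongrightarrow> 0)"
      by (simp_all only: ennreal_tendsto_0_iff sqn_nonneg)
  qed
  have "L2 u \<longleftrightarrow> u \<in> borel_measurable lborel \<and> (\<integral>\<^sup>+x. ennreal ((u x)\<^sup>2) \<partial>lborel) < \<infinity>"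
    using nn_integral_sq[of u] L2I_nn_integral[of u] by (auto simp: L2_measurable)
  moreover have "L2 G \<longleftrightarrow> G \<in> borel_measurable lborel \<and> (\<integral>\<^sup>+x. ennreal ((norm (G x))\<^sup>2) \<partial>lborel) < \<infinity>"
    using nn_integral_sq[of G] L2I_nn_integral[of G] by (auto simp: L2_measurable)
  ultimately show ?thesis
    unfolding H01_def using lim by (smt (verit, best))
qed

section \<open>Translations and the Poincare inequality\<close>

text \<open>The fundamental theorem of calculus on the segment from \<open>x\<close> to
  \<open>x + h\<close>, then Jensen's inequality. Extended nonnegative integrals allow the order of
  integration to be exchanged later without integrability proofs.\<close>

lemma translate_pointwise:
  assumes "smooth_fun f"
  shows "ennreal ((f (x + h) - f x)\<^sup>2)
    \<le> (\<integral>\<^sup>+t. indicator {0..1} t * ennreal ((norm h)\<^sup>2 * (norm (grad f (x + t *\<^sub>R h)))\<^sup>2) \<partial>lborel)"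
proof -
  define g where "g t = grad f (x + t *\<^sub>R h) \<bullet> h" for t :: real
  define c where "c = f (x + h) - f x"
  have cont: "continuous_on {0..1} g" unfolding g_def
    by (intro continuous_intros continuous_on_compose2[OF continuous_on_grad[OF assms, of UNIV]]) auto
  have der: "((\<lambda>t. f (x + t *\<^sub>R h)) has_vector_derivative g t) (at t within {0..1})" for t
  proof -
    have "((\<lambda>t. x + t *\<^sub>R h) has_derivative (\<lambda>s. s *\<^sub>R h)) (at t)"
      by (auto intro!: derivative_eq_intros)
    from has_derivative_compose[OF this has_derivative_grad_smooth[OF assms]]
    have "((\<lambda>t. f (x + t *\<^sub>R h)) has_vector_derivative g t) (at t)"
      by (simp add: has_vector_derivative_def g_def)
    then show ?thesis by (rule has_vector_derivative_at_within)
  qed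
  have I1: "integrable lborel (\<lambda>t. indicator {0..1} t *\<^sub>R g t)"
    by (intro borel_integrable_compact cont) simp
  have I2: "integrable lborel (\<lambda>t. indicator {0..1} t *\<^sub>R (g t)\<^sup>2)"
    by (intro borel_integrable_compact continuous_intros cont) simp
  have I0: "integrable lborel (\<lambda>t. indicator {0..1::real} t *\<^sub>R (1::real))"
    by (intro borel_integrable_compact) auto
  have v1: "(LBINT t. indicator {0..1} t *\<^sub>R g t) = c"
    using integral_FTC_atLeastAtMost[of 0 1 "\<lambda>t. f (x + t *\<^sub>R h)" g] der cont by (simp add: c_def)
  have v0: "(LBINT t. indicator {0..1::real} t *\<^sub>R (1::real)) = 1" by simp
  have split: "(LBINT t. A t - a * B t + b * D t)
      = (LBINT t. A t) - a * (LBINT t. B t) + b * (LBINT t. D t)"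
    if "integrable lborel A" "integrable lborel B" "integrable lborel D"
    for A B D :: "real \<Rightarrow> real" and a b
    using that by simp
  \<comment> \<open>Jensen's inequality as nonnegativity of a variance: \<open>c\<close> is the mean
    of \<open>g\<close> over the unit interval.\<close>
  have "0 \<le> (LBINT t. indicator {0..1} t *\<^sub>R (g t - c)\<^sup>2)"
    by (intro integral_nonneg_AE) auto
  also have "(LBINT t. indicator {0..1} t *\<^sub>R (g t - c)\<^sup>2) =
      (LBINT t. indicator {0..1} t *\<^sub>R (g t)\<^sup>2 - (2 * c) * (indicator {0..1} t *\<^sub>R g t)
        + c\<^sup>2 * (indicator {0..1} t *\<^sub>R 1))"
    by (intro Bochner_Integration.integral_cong) (auto simp: power2_diff algebra_simps)
  also have "\<dots> = (LBINT t. indicator {0..1} t *\<^sub>R (g t)\<^sup>2) - (2 * c) * c + c\<^sup>2 * 1"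
    by (subst split[OF I2 I1 I0]) (simp only: v1 v0)
  finally have "c\<^sup>2 \<le> (LBINT t. indicator {0..1} t *\<^sub>R (g t)\<^sup>2)"
    by (simp add: power2_eq_square)
  then have "ennreal (c\<^sup>2) \<le> ennreal (LBINT t. indicator {0..1} t *\<^sub>R (g t)\<^sup>2)"
    by (rule ennreal_leI)
  also have "\<dots> = (\<integral>\<^sup>+t. ennreal (indicator {0..1} t *\<^sub>R (g t)\<^sup>2) \<partial>lborel)"
    using I2 by (intro nn_integral_eq_integral[symmetric]) auto
  also have "\<dots> \<le> (\<integral>\<^sup>+t. indicator {0..1} t * ennreal ((norm h)\<^sup>2 * (norm (grad f (x + t *\<^sub>R h)))\<^sup>2) \<partial>lborel)"
  proof (rule nn_integral_mono)
    fix t :: real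
    have "(g t)\<^sup>2 \<le> (norm h)\<^sup>2 * (norm (grad f (x + t *\<^sub>R h)))\<^sup>2"
      unfolding g_def using Cauchy_Schwarz_ineq[of "grad f (x + t *\<^sub>R h)" h]
      by (simp add: power2_norm_eq_inner mult.commute)
    then show "ennreal (indicator {0..1} t *\<^sub>R (g t)\<^sup>2)
        \<le> indicator {0..1} t * ennreal ((norm h)\<^sup>2 * (norm (grad f (x + t *\<^sub>R h)))\<^sup>2)"
      by (auto simp: indicator_def intro!: ennreal_leI)
  qed
  finally show ?thesis by (simp add: c_def)
qed

text \<open>After exchanging the integrals, translation invariance makes every point
  \<open>t\<close> of the segment contribute the same amount.\<close>

lemma sqn_translate_diff_le:
  assumes f: "test_fun U f"
  shows "sqn (\<lambda>x. f (x + h) - f x) \<le> (norm h)\<^sup>2 * sqn (grad f)"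
proof -
  have L: "L2 f" "L2 (grad f)" using f by (rule L2_test_fun, rule L2_grad_test_fun)
  note [measurable] = L2_measurable[OF L(1)] L2_measurable[OF L(2)]
  have "ennreal (sqn (\<lambda>x. f (x + h) - f x)) = (\<integral>\<^sup>+x. ennreal ((f (x + h) - f x)\<^sup>2) \<partial>lborel)"
    using nn_integral_sq[OF L2_diff[OF sqn_translate(1)[OF L(1)] L(1)]] by simp
  also have "\<dots> \<le> (\<integral>\<^sup>+x. (\<integral>\<^sup>+t. indicator {0..1} t *
      ennreal ((norm h)\<^sup>2 * (norm (grad f (x + t *\<^sub>R h)))\<^sup>2) \<partial>lborel) \<partial>lborel)"
    by (intro nn_integral_mono translate_pointwise test_fun_smooth[OF f])
  also have "\<dots> = (\<integral>\<^sup>+t. (\<integral>\<^sup>+x. indicator {0..1} t *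
      ennreal ((norm h)\<^sup>2 * (norm (grad f (x + t *\<^sub>R h)))\<^sup>2) \<partial>lborel) \<partial>lborel)"
    by (intro lborel_pair.Fubini') simp
  also have "\<dots> = (\<integral>\<^sup>+t. ennreal ((norm h)\<^sup>2 * sqn (grad f)) * indicator {0..1::real} t \<partial>lborel)"
  proof (intro nn_integral_cong)
    fix t :: real
    have "(\<integral>\<^sup>+x. indicator {0..1} t * ennreal ((norm h)\<^sup>2 * (norm (grad f (x + t *\<^sub>R h)))\<^sup>2) \<partial>lborel)
      = indicator {0..1} t * (ennreal ((norm h)\<^sup>2) * (\<integral>\<^sup>+x. ennreal ((norm (grad f (x + t *\<^sub>R h)))\<^sup>2) \<partial>lborel))"
      by (simp add: nn_integral_cmult ennreal_mult)
    also have "(\<integral>\<^sup>+x. ennreal ((norm (grad f (x + t *\<^sub>R h)))\<^sup>2) \<partial>lborel) = ennreal (sqn (grad f))"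
      using nn_integral_sq[OF sqn_translate(1)[OF L(2)], of "t *\<^sub>R h"] sqn_translate(2)[OF L(2), of "t *\<^sub>R h"]
      by simp
    finally show "(\<integral>\<^sup>+x. indicator {0..1} t * ennreal ((norm h)\<^sup>2 * (norm (grad f (x + t *\<^sub>R h)))\<^sup>2) \<partial>lborel)
        = ennreal ((norm h)\<^sup>2 * sqn (grad f)) * indicator {0..1} t"
      by (simp add: ennreal_mult mult_ac)
  qed
  also have "\<dots> = ennreal ((norm h)\<^sup>2 * sqn (grad f))"
    by (subst nn_integral_cmult_indicator) auto
  finally show ?thesis by (subst (asm) ennreal_le_iff) auto
qed

text \<open>If \<open>f\<close> vanishes at \<open>x + h\<close> for a set of \<open>h\<close> of measure at least \<open>c\<close>, then \<open>c (f x)\<^sup>2\<close> is bounded by the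
  integral of the squared increments.\<close>

lemma poincare_zero_set:
  fixes f :: "'a::euclidean_space \<Rightarrow> real"
  assumes f: "test_fun U f" and Z[measurable]: "Z \<in> sets borel" and z: "\<And>x. x \<in> Z \<Longrightarrow> f x = 0"
    and "c \<ge> 0" "R \<ge> 0"
    and c: "\<And>x. ennreal c \<le> emeasure lborel {h \<in> cball 0 R. x + h \<in> Z}"
  shows "c * sqn f \<le> measure lborel (cball (0::'a) R) * R\<^sup>2 * sqn (grad f)"
proof -
  have L: "L2 f" "L2 (grad f)" using f by (rule L2_test_fun, rule L2_grad_test_fun)
  note [measurable] = L2_measurable[OF L(1)] L2_measurable[OF L(2)]
  have [measurable]: "cball (0::'a) R \<in> sets borel" by simp
  have fin: "emeasure lborel (cball (0::'a) R) = ennreal (measure lborel (cball (0::'a) R))"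
    using emeasure_lborel_cball_finite[of "0::'a" R] by (simp add: emeasure_eq_ennreal_measure)
  have "ennreal (c * sqn f) = ennreal c * (\<integral>\<^sup>+x. ennreal ((f x)\<^sup>2) \<partial>lborel)"
    using nn_integral_sq[OF L(1)] assms(4) by (simp add: ennreal_mult)
  also have "\<dots> = (\<integral>\<^sup>+x. ennreal ((f x)\<^sup>2) * ennreal c \<partial>lborel)"
    by (subst nn_integral_cmult[symmetric]) (auto simp: mult.commute)
  also have "\<dots> \<le> (\<integral>\<^sup>+x. (\<integral>\<^sup>+h. indicator (cball 0 R) h * ennreal ((f (x + h) - f x)\<^sup>2) \<partial>lborel) \<partial>lborel)"
  proof (rule nn_integral_mono)
    fix x :: 'a
    have "ennreal ((f x)\<^sup>2) * ennreal c \<le> ennreal ((f x)\<^sup>2) * emeasure lborel {h \<in> cball 0 R. x + h \<in> Z}"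
      by (intro mult_left_mono c) simp
    also have "\<dots> = (\<integral>\<^sup>+h. ennreal ((f x)\<^sup>2) * indicator {h \<in> cball 0 R. x + h \<in> Z} h \<partial>lborel)"
      by (subst nn_integral_cmult_indicator) auto
    also have "\<dots> \<le> (\<integral>\<^sup>+h. indicator (cball 0 R) h * ennreal ((f (x + h) - f x)\<^sup>2) \<partial>lborel)"
      using z by (intro nn_integral_mono) (auto simp: indicator_def)
    finally show "ennreal ((f x)\<^sup>2) * ennreal c
        \<le> (\<integral>\<^sup>+h. indicator (cball 0 R) h * ennreal ((f (x + h) - f x)\<^sup>2) \<partial>lborel)" .
  qed
  also have "\<dots> = (\<integral>\<^sup>+h. (\<integral>\<^sup>+x. indicator (cball 0 R) h * ennreal ((f (x + h) - f x)\<^sup>2) \<partial>lborel) \<partial>lborel)"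
    by (intro lborel_pair.Fubini') simp
  also have "\<dots> \<le> (\<integral>\<^sup>+h. ennreal (R\<^sup>2 * sqn (grad f)) * indicator (cball (0::'a) R) h \<partial>lborel)"
  proof (rule nn_integral_mono)
    fix h :: 'a
    have "(\<integral>\<^sup>+x. indicator (cball 0 R) h * ennreal ((f (x + h) - f x)\<^sup>2) \<partial>lborel)
        = indicator (cball 0 R) h * ennreal (sqn (\<lambda>x. f (x + h) - f x))"
      using nn_integral_sq[OF L2_diff[OF sqn_translate(1)[OF L(1)] L(1)], of h] by (simp add: nn_integral_cmult)
    also have "\<dots> \<le> ennreal (R\<^sup>2 * sqn (grad f)) * indicator (cball 0 R) h"
    proof (cases "h \<in> cball 0 R")
      case True
      have "sqn (\<lambda>x. f (x + h) - f x) \<le> (norm h)\<^sup>2 * sqn (grad f)"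
        by (rule sqn_translate_diff_le[OF f])
      also have "\<dots> \<le> R\<^sup>2 * sqn (grad f)"
        using True by (intro mult_right_mono power_mono) auto
      finally show ?thesis using True by (simp add: ennreal_leI)
    qed simp
    finally show "(\<integral>\<^sup>+x. indicator (cball 0 R) h * ennreal ((f (x + h) - f x)\<^sup>2) \<partial>lborel)
        \<le> ennreal (R\<^sup>2 * sqn (grad f)) * indicator (cball 0 R) h" .
  qed
  also have "\<dots> = ennreal (measure lborel (cball (0::'a) R) * R\<^sup>2 * sqn (grad f))"
    by (subst nn_integral_cmult_indicator) (auto simp: fin ennreal_mult mult_ac)
  finally show ?thesis by (subst (asm) ennreal_le_iff) auto
qed

lemma emeasure_translate:
  fixes A :: "'a::euclidean_space set"
  assumes [measurable]: "A \<in> sets borel"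
  shows "emeasure lborel {h. x + h \<in> A} = emeasure lborel A"
proof -
  have "emeasure lborel {h. x + h \<in> A} = (\<integral>\<^sup>+h. indicator {h. x + h \<in> A} h \<partial>lborel)"
    by (rule nn_integral_indicator[symmetric]) simp
  also have "\<dots> = (\<integral>\<^sup>+h. indicator A (h + x) \<partial>lborel)"
    by (intro nn_integral_cong) (auto simp: indicator_def add.commute)
  also have "\<dots> = emeasure lborel A"
    by (subst nn_integral_lborel_translate) auto
  finally show ?thesis .
qed

text \<open>A ball of volume at least |U| + 1 around any point contains a part of measure at least 1
  outside \<open>U\<close>, where test functions vanish.\<close>

lemma poincare_finite_measure:
  fixes U :: "'a::euclidean_space set"
  assumes U[measurable]: "U \<in> sets borel" and fin: "emeasure lborel U < \<infinity>"
  obtains C where "C > 0" "\<And>f. test_fun U f \<Longrightarrow> sqn f \<le> C * sqn (grad f)"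
proof -
  define m where "m = measure lborel U"
  have em: "emeasure lborel U = ennreal m"
    using fin by (simp add: m_def emeasure_eq_ennreal_measure)
  let ?b = "unit_ball_vol (real DIM('a))"
  have b: "?b > 0" by (simp add: unit_ball_vol_pos)
  \<comment> \<open>With \<open>R\<close> at least 1, its power of order \<open>DIM('a)\<close> is
    at least \<open>R\<close>, so solving a linear inequality for the volume suffices.\<close>
  define R where "R = max 1 ((m + 1) / ?b)"
  have R: "R \<ge> 1" by (simp add: R_def)
  have "m + 1 \<le> ?b * R" using b by (simp add: R_def field_simps max_def)
  also have "\<dots> \<le> ?b * R ^ DIM('a)"
    using b R power_increasing[of 1 "DIM('a)" R] by (intro mult_left_mono) (auto simp: Suc_leI)
  also have "ennreal \<dots> = emeasure lborel (cball (0::'a) R)"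
    using R by (simp add: emeasure_cball)
  finally have big: "ennreal (m + 1) \<le> emeasure lborel (cball (0::'a) R)" using ennreal_leI by blast
  have c: "ennreal 1 \<le> emeasure lborel {h \<in> cball 0 R. x + h \<in> - U}" for x
  proof -
    have "ennreal m + ennreal 1 \<le> emeasure lborel (cball (0::'a) R)"
      using big by (simp add: m_def)
    also have "\<dots> \<le> emeasure lborel ({h. x + h \<in> U} \<union> {h \<in> cball 0 R. x + h \<in> - U})"
      by (intro emeasure_mono) auto
    also have "\<dots> \<le> emeasure lborel {h. x + h \<in> U} + emeasure lborel {h \<in> cball 0 R. x + h \<in> - U}"
      by (intro emeasure_subadditive) auto
    also have "emeasure lborel {h. x + h \<in> U} = ennreal m"
      using emeasure_translate[OF U] em by simp
    finally show ?thesis by (simp add: ennreal_add_left_cancel_le)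
  qed
  let ?C = "measure lborel (cball (0::'a) R) * R\<^sup>2"
  show ?thesis
  proof (rule that[of "?C + 1"])
    show "?C + 1 > 0" by (simp add: add_nonneg_pos)
    fix f assume f: "test_fun U f"
    have "1 * sqn f \<le> ?C * sqn (grad f)"
      using R by (intro poincare_zero_set[OF f, of "- U"] c test_fun_outside[OF f]) auto
    then show "sqn f \<le> (?C + 1) * sqn (grad f)"
      using sqn_nonneg[of "grad f"] unfolding distrib_right by linarith
  qed
qed

section \<open>The space $H_0^1$\<close>

lemma H01_L2: "H01 U u G \<Longrightarrow> L2 u" "H01 U u G \<Longrightarrow> L2 G"
  by (simp_all add: H01_iff)

lemma H01E:
  assumes "H01 U u G"
  obtains \<phi> where "\<And>k. test_fun U (\<phi> k)" "(\<lambda>k. sqn (\<lambda>x. \<phi> k x - u x)) \<longlonglongrightarrow> 0"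
    "(\<lambda>k. sqn (\<lambda>x. grad (\<phi> k) x - G x)) \<longlonglongrightarrow> 0"
  using assms by (auto simp: H01_iff)

lemma H01_test_fun: "test_fun U f \<Longrightarrow> H01 U f (grad f)"
  by (auto simp: H01_iff L2_test_fun L2_grad_test_fun sqn_def intro!: exI[of _ "\<lambda>_. f"])

lemma H01_diff:
  assumes "H01 U u G" "H01 U v H"
  shows "H01 U (\<lambda>x. u x - v x) (\<lambda>x. G x - H x)"
proof -
  note L = H01_L2[OF assms(1)] H01_L2[OF assms(2)]
  obtain \<phi> where \<phi>: "\<And>k. test_fun U (\<phi> k)" "(\<lambda>k. sqn (\<lambda>x. \<phi> k x - u x)) \<longlonglongrightarrow> 0"
    "(\<lambda>k. sqn (\<lambda>x. grad (\<phi> k) x - G x)) \<longlonglongrightarrow> 0" using assms(1) H01E by blast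
  obtain \<psi> where \<psi>: "\<And>k. test_fun U (\<psi> k)" "(\<lambda>k. sqn (\<lambda>x. \<psi> k x - v x)) \<longlonglongrightarrow> 0"
    "(\<lambda>k. sqn (\<lambda>x. grad (\<psi> k) x - H x)) \<longlonglongrightarrow> 0" using assms(2) H01E by blast
  have lim: "(\<lambda>k. sqn (\<lambda>x. (f k x - g k x) - (f' x - g' x))) \<longlonglongrightarrow> 0"
    if "\<And>k. L2 (f k)" "\<And>k. L2 (g k)" "L2 f'" "L2 g'" "(\<lambda>k. sqn (\<lambda>x. f k x - f' x)) \<longlonglongrightarrow> 0"
      "(\<lambda>k. sqn (\<lambda>x. g k x - g' x)) \<longlonglongrightarrow> 0"
    for f g :: "nat \<Rightarrow> 'a \<Rightarrow> 'b::euclidean_space" and f' g'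
  proof (rule Lim_null_comparison)
    show "(\<lambda>k. 2 * sqn (\<lambda>x. f k x - f' x) + 2 * sqn (\<lambda>x. g' x - g k x)) \<longlonglongrightarrow> 0"
      using tendsto_add[OF tendsto_mult_left[OF that(5), of 2] tendsto_mult_left[OF that(6), of 2]]
      by (simp add: sqn_minus_commute[of g'])
    show "\<forall>\<^sub>F k in sequentially. norm (sqn (\<lambda>x. (f k x - g k x) - (f' x - g' x)))
        \<le> 2 * sqn (\<lambda>x. f k x - f' x) + 2 * sqn (\<lambda>x. g' x - g k x)"
    proof (intro always_eventually allI)
      fix k
      show "norm (sqn (\<lambda>x. (f k x - g k x) - (f' x - g' x)))
        \<le> 2 * sqn (\<lambda>x. f k x - f' x) + 2 * sqn (\<lambda>x. g' x - g k x)"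
        using sqn_add_le[OF L2_diff[OF that(1,3)] L2_diff[OF that(4,2)]] by (simp add: algebra_simps)
    qed
  qed
  have "grad (\<lambda>x. \<phi> k x - \<psi> k x) = (\<lambda>x. grad (\<phi> k) x - grad (\<psi> k) x)" for k
    using \<phi>(1) \<psi>(1) by (intro ext grad_diff test_fun_smooth)
  then have "(\<lambda>k. sqn (\<lambda>x. grad (\<lambda>x. \<phi> k x - \<psi> k x) x - (G x - H x))) \<longlonglongrightarrow> 0"
    using lim[OF L2_grad_test_fun[OF \<phi>(1)] L2_grad_test_fun[OF \<psi>(1)] L(2,4) \<phi>(3) \<psi>(3)] by simp
  moreover have "(\<lambda>k. sqn (\<lambda>x. \<phi> k x - \<psi> k x - (u x - v x))) \<longlonglongrightarrow> 0"
    by (rule lim[OF L2_test_fun[OF \<phi>(1)] L2_test_fun[OF \<psi>(1)] L(1,3) \<phi>(2) \<psi>(2)])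
  moreover have "test_fun U (\<lambda>x. \<phi> k x - \<psi> k x)" for k
    by (rule test_fun_diff[OF \<phi>(1) \<psi>(1)])
  ultimately show ?thesis
    unfolding H01_iff
    by (intro conjI exI[of _ "\<lambda>k x. \<phi> k x - \<psi> k x"] allI L2_diff L)
qed

lemma H01_rayleigh:
  assumes "H01 U u G" "\<And>f. test_fun U f \<Longrightarrow> c * sqn f \<le> sqn (grad f)"
  shows "c * sqn u \<le> sqn G"
proof -
  obtain \<phi> where \<phi>: "\<And>k. test_fun U (\<phi> k)" "(\<lambda>k. sqn (\<lambda>x. \<phi> k x - u x)) \<longlonglongrightarrow> 0"
    "(\<lambda>k. sqn (\<lambda>x. grad (\<phi> k) x - G x)) \<longlonglongrightarrow> 0" using assms(1) H01E by blast
  have "(\<lambda>k. sqn (\<phi> k)) \<longlonglongrightarrow> sqn u"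
    using \<phi> H01_L2[OF assms(1)] L2_test_fun by (intro tendsto_sqn) blast+
  moreover have "(\<lambda>k. sqn (grad (\<phi> k))) \<longlonglongrightarrow> sqn G"
    using \<phi> H01_L2[OF assms(1)] by (intro tendsto_sqn L2_grad_test_fun)
  ultimately show ?thesis
    using assms(2)[OF \<phi>(1)] by (intro LIMSEQ_le[OF tendsto_mult_left]) auto
qed

text \<open>The approximating test functions vanish outside \<open>U\<close>, and a subsequence of
  them converges almost everywhere.\<close>

lemma H01_AE_zero:
  assumes "H01 U u G"
  shows "AE x in lborel. x \<notin> U \<longrightarrow> u x = 0"
proof -
  obtain \<phi> where \<phi>: "\<And>k. test_fun U (\<phi> k)" "(\<lambda>k. sqn (\<lambda>x. \<phi> k x - u x)) \<longlonglongrightarrow> 0"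
    "(\<lambda>k. sqn (\<lambda>x. grad (\<phi> k) x - G x)) \<longlonglongrightarrow> 0" using assms(1) H01E by blast
  obtain r where "AE x in lborel. (\<lambda>k. \<phi> (r k) x) \<longlonglongrightarrow> u x"
    using AE_subseq_L2[of \<phi> u] \<phi> L2_test_fun[OF \<phi>(1)] H01_L2[OF assms] by blast
  then show ?thesis
  proof eventually_elim
    case (elim x)
    show ?case
    proof
      assume "x \<notin> U"
      then have "(\<lambda>k. \<phi> (r k) x) = (\<lambda>_. 0)" using test_fun_outside[OF \<phi>(1)] by auto
      then show "u x = 0" using elim LIMSEQ_unique[OF elim] by (metis tendsto_const)
    qed
  qed
qed

lemma L2_indicator:
  assumes "U \<in> sets borel" "emeasure lborel U < \<infinity>"
  shows "L2 (indicator U :: 'a::euclidean_space \<Rightarrow> real)" "sqn (indicator U :: 'a \<Rightarrow> real) = measure lborel U"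
proof -
  have e: "(\<lambda>x. (norm (indicator U x :: real))\<^sup>2) = (indicator U :: 'a \<Rightarrow> real)"
    by (auto simp: indicator_def)
  show "L2 (indicator U :: 'a \<Rightarrow> real)" using assms unfolding L2_def e by simp
  show "sqn (indicator U :: 'a \<Rightarrow> real) = measure lborel U" unfolding sqn_def e using assms by simp
qed

lemma H01_integral:
  assumes u: "H01 U u G" and U[measurable]: "U \<in> sets borel" and fin: "emeasure lborel U < \<infinity>"
  shows "integrable lborel u" "(LBINT x. u x) = (LBINT x. u x * indicator U x)"
proof -
  note [measurable] = L2_measurable[OF H01_L2(1)[OF u]]
  have ae: "AE x in lborel. u x = u x * indicator U x"
    using H01_AE_zero[OF u] by eventually_elim (auto simp: indicator_def)
  have i: "integrable lborel (\<lambda>x. u x * indicator U x)"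
    using integrable_inner_L2[OF H01_L2(1)[OF u] L2_indicator(1)[OF U fin]] by simp
  show "integrable lborel u"
    by (subst integrable_cong_AE[OF _ _ ae]) (use i in auto)
  show "(LBINT x. u x) = (LBINT x. u x * indicator U x)"
    by (rule integral_cong_AE[OF _ _ ae]) auto
qed

text \<open>Both sides are L^2-continuous in the test function: the right one is a pairing with the
  indicator of \<open>U\<close>, which is in L^2 by finiteness of the measure. The case
  \<open>c = 1\<close> is the torsion equation, and \<open>c = 0\<close> is the equation for a
  difference of two solutions.\<close>

lemma H01_weak_equation:
  fixes U :: "'a::euclidean_space set"
  assumes U: "U \<in> sets borel" and fin: "emeasure lborel U < \<infinity>" and w: "H01 U w W" and G: "L2 G"
    and eq: "\<And>f. test_fun U f \<Longrightarrow> (LBINT x. G x \<bullet> grad f x) = c * (LBINT x. f x)"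
  shows "(LBINT x. G x \<bullet> W x) = c * (LBINT x. w x)"
proof -
  obtain \<phi> where \<phi>: "\<And>k. test_fun U (\<phi> k)" "(\<lambda>k. sqn (\<lambda>x. \<phi> k x - w x)) \<longlonglongrightarrow> 0"
    "(\<lambda>k. sqn (\<lambda>x. grad (\<phi> k) x - W x)) \<longlonglongrightarrow> 0" using w H01E by blast
  have lim: "(\<lambda>k. LBINT x. grad (\<phi> k) x \<bullet> G x) \<longlonglongrightarrow> (LBINT x. W x \<bullet> G x)"
    using \<phi> H01_L2[OF w] G by (intro tendsto_inner_L2 L2_grad_test_fun)
  have "(\<lambda>k. LBINT x. \<phi> k x \<bullet> indicator U x) \<longlonglongrightarrow> (LBINT x. w x \<bullet> indicator U x)"
    using \<phi> H01_L2[OF w] L2_indicator(1)[OF U fin] L2_test_fun by (intro tendsto_inner_L2) blast+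
  moreover have "(LBINT x. \<phi> k x \<bullet> indicator U x) = (LBINT x. \<phi> k x)" for k
    using H01_integral(2)[OF H01_test_fun[OF \<phi>(1)] U fin, of k] by simp
  moreover have "(LBINT x. w x \<bullet> indicator U x) = (LBINT x. w x)"
    using H01_integral(2)[OF w U fin] by simp
  ultimately have "(\<lambda>k. c * (LBINT x. \<phi> k x)) \<longlonglongrightarrow> c * (LBINT x. w x)"
    by (intro tendsto_mult_left) simp
  moreover have "(LBINT x. grad (\<phi> k) x \<bullet> G x) = c * (LBINT x. \<phi> k x)" for k
    using eq[OF \<phi>(1), of k] by (simp add: inner_commute)
  ultimately show ?thesis
    using LIMSEQ_unique lim by (simp add: inner_commute)
qed

text \<open>The gradient error splits into h'(phi_k) (D phi_k - G) and (h'(phi_k) - h'(u)) G. The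
  bound \<open>K\<close> controls the first part; the second tends to 0 by dominated convergence
  along a subsequence converging almost everywhere. The condition \<open>h 0 = 0\<close> preserves
  compact support.\<close>

lemma H01_compose:
  assumes u: "H01 U u G" and h: "smooth_fun h" "h 0 = 0" and K: "\<And>s. \<bar>deriv h s\<bar> \<le> K"
  shows "H01 U (\<lambda>x. h (u x)) (\<lambda>x. deriv h (u x) *\<^sub>R G x)"
proof -
  note L = H01_L2[OF u]
  note [measurable] = L2_measurable[OF L(1)] L2_measurable[OF L(2)]
  have K0: "K \<ge> 0" using K[of 0] by linarith
  have ch: "isCont h s" and cd: "isCont (deriv h) s" for s
    using smooth_continuous[OF h(1), of UNIV] smooth_continuous[OF smooth_deriv[OF h(1)], of UNIV]
    by (auto simp: continuous_on_eq_continuous_at)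
  have [measurable]: "h \<in> borel_measurable borel" "deriv h \<in> borel_measurable borel"
    by (auto intro!: borel_measurable_continuous_onI smooth_continuous smooth_deriv h)
  have lip: "\<bar>h s - h t\<bar> \<le> K * \<bar>s - t\<bar>" for s t
    using field_differentiable_bound[of UNIV h "deriv h" K s t] smooth_real_deriv[OF h(1)] K by auto
  obtain \<phi>0 where \<phi>0: "\<And>k. test_fun U (\<phi>0 k)" "(\<lambda>k. sqn (\<lambda>x. \<phi>0 k x - u x)) \<longlonglongrightarrow> 0"
    "(\<lambda>k. sqn (\<lambda>x. grad (\<phi>0 k) x - G x)) \<longlonglongrightarrow> 0" using u H01E by blast
  obtain r where r: "strict_mono r" and ae: "AE x in lborel. (\<lambda>k. \<phi>0 (r k) x) \<longlonglongrightarrow> u x"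
    using AE_subseq_L2[of \<phi>0 u] \<phi>0 L2_test_fun[OF \<phi>0(1)] L by blast
  define \<phi> where "\<phi> k = \<phi>0 (r k)" for k
  have \<phi>: "\<And>k. test_fun U (\<phi> k)" "(\<lambda>k. sqn (\<lambda>x. \<phi> k x - u x)) \<longlonglongrightarrow> 0"
    "(\<lambda>k. sqn (\<lambda>x. grad (\<phi> k) x - G x)) \<longlonglongrightarrow> 0"
    using \<phi>0(1) LIMSEQ_subseq_LIMSEQ[OF \<phi>0(2) r] LIMSEQ_subseq_LIMSEQ[OF \<phi>0(3) r]
    by (auto simp: \<phi>_def o_def)
  have [measurable]: "\<phi> k \<in> borel_measurable borel" "grad (\<phi> k) \<in> borel_measurable borel" for k
    by (auto intro!: L2_measurable L2_test_fun[OF \<phi>(1)] L2_grad_test_fun[OF \<phi>(1)])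
  have "L2 (\<lambda>x. h (u x))"
    using lip[of _ 0] h(2) K0 by (intro L2_bound[OF L2_cmult[OF L(1), of K]]) (auto simp: abs_mult)
  moreover have LG: "L2 (\<lambda>x. deriv h (u x) *\<^sub>R G x)"
    using K K0 by (intro L2_bound[OF L2_scaleR[OF L(2), of K]]) (auto intro!: mult_right_mono)
  moreover have "(\<lambda>k. sqn (\<lambda>x. h (\<phi> k x) - h (u x))) \<longlonglongrightarrow> 0"
  proof (rule Lim_null_comparison)
    show "(\<lambda>k. K\<^sup>2 * sqn (\<lambda>x. \<phi> k x - u x)) \<longlonglongrightarrow> 0"
      using tendsto_mult_left[OF \<phi>(2), of "K\<^sup>2"] by simp
    show "\<forall>\<^sub>F k in sequentially. norm (sqn (\<lambda>x. h (\<phi> k x) - h (u x))) \<le> K\<^sup>2 * sqn (\<lambda>x. \<phi> k x - u x)"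
    proof (intro always_eventually allI)
      fix k
      have i: "L2 (\<lambda>x. K * (\<phi> k x - u x))" by (intro L2_cmult L2_diff L2_test_fun[OF \<phi>(1)] L)
      have b: "norm (h (\<phi> k x) - h (u x)) \<le> norm (K * (\<phi> k x - u x))" for x
        using lip[of "\<phi> k x" "u x"] K0 by (simp add: abs_mult)
      have j: "L2 (\<lambda>x. h (\<phi> k x) - h (u x))" by (rule L2_bound[OF i _ b]) simp
      have "sqn (\<lambda>x. h (\<phi> k x) - h (u x)) \<le> sqn (\<lambda>x. K * (\<phi> k x - u x))"
        unfolding sqn_def by (intro integral_mono L2_integrable i j power_mono b) auto
      then show "norm (sqn (\<lambda>x. h (\<phi> k x) - h (u x))) \<le> K\<^sup>2 * sqn (\<lambda>x. \<phi> k x - u x)"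
        by (simp add: sqn_cmult)
    qed
  qed
  moreover have "(\<lambda>k. sqn (\<lambda>x. grad (\<lambda>x. h (\<phi> k x)) x - deriv h (u x) *\<^sub>R G x)) \<longlonglongrightarrow> 0"
  proof (rule Lim_null_comparison)
    define D where "D k x = (deriv h (\<phi> k x) - deriv h (u x)) *\<^sub>R G x" for k x
    have [measurable]: "D k \<in> borel_measurable borel" for k unfolding D_def by simp
    have Db: "norm (D k x) \<le> norm ((2 * K) *\<^sub>R G x)" for k x
      using K[of "\<phi> k x"] K[of "u x"] K0 unfolding D_def
      by (auto intro!: mult_right_mono)
    have DL: "L2 (D k)" for k
      by (rule L2_bound[OF L2_scaleR[OF L(2)] _ Db]) simp
    have "(\<lambda>k. sqn (D k)) \<longlonglongrightarrow> (\<integral>x. 0 \<partial>(lborel :: 'a measure))"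
      unfolding sqn_def
    proof (rule integral_dominated_convergence[where w = "\<lambda>x. (norm ((2 * K) *\<^sub>R G x))\<^sup>2"])
      show "integrable lborel (\<lambda>x. (norm ((2 * K) *\<^sub>R G x))\<^sup>2)"
        by (rule L2_integrable[OF L2_scaleR[OF L(2)]])
      show "AE x in lborel. (\<lambda>k. (norm (D k x))\<^sup>2) \<longlonglongrightarrow> 0"
        using ae
      proof eventually_elim
        case (elim x)
        have "(\<lambda>k. deriv h (\<phi> k x)) \<longlonglongrightarrow> deriv h (u x)"
          using isCont_tendsto_compose[OF cd elim] by (simp add: \<phi>_def)
        then have "(\<lambda>k. (norm (D k x))\<^sup>2) \<longlonglongrightarrow> (norm ((deriv h (u x) - deriv h (u x)) *\<^sub>R G x))\<^sup>2"
          unfolding D_def by (intro tendsto_intros)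
        then show ?case by simp
      qed
      show "AE x in lborel. norm ((norm (D k x))\<^sup>2) \<le> (norm ((2 * K) *\<^sub>R G x))\<^sup>2" for k
        using Db by (intro always_eventually allI) (simp add: power_mono del: norm_scaleR)
    qed auto
    then have "(\<lambda>k. 2 * (K\<^sup>2 * sqn (\<lambda>x. grad (\<phi> k) x - G x)) + 2 * sqn (D k)) \<longlonglongrightarrow> 2 * (K\<^sup>2 * 0) + 2 * 0"
      by (intro tendsto_intros \<phi>(3)) simp
    then show "(\<lambda>k. 2 * (K\<^sup>2 * sqn (\<lambda>x. grad (\<phi> k) x - G x)) + 2 * sqn (D k)) \<longlonglongrightarrow> 0" by simp
    show "\<forall>\<^sub>F k in sequentially. norm (sqn (\<lambda>x. grad (\<lambda>x. h (\<phi> k x)) x - deriv h (u x) *\<^sub>R G x))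
        \<le> 2 * (K\<^sup>2 * sqn (\<lambda>x. grad (\<phi> k) x - G x)) + 2 * sqn (D k)"
    proof (intro always_eventually allI)
      fix k
      define A where "A x = deriv h (\<phi> k x) *\<^sub>R (grad (\<phi> k) x - G x)" for x
      have [measurable]: "A \<in> borel_measurable borel" unfolding A_def by simp
      have i: "L2 (\<lambda>x. K *\<^sub>R (grad (\<phi> k) x - G x))"
        by (intro L2_scaleR L2_diff L2_grad_test_fun[OF \<phi>(1)] L)
      have b: "norm (A x) \<le> norm (K *\<^sub>R (grad (\<phi> k) x - G x))" for x
        using K[of "\<phi> k x"] K0 unfolding A_def by (auto intro!: mult_right_mono)
      have j: "L2 A" by (rule L2_bound[OF i _ b]) simp
      have "sqn A \<le> sqn (\<lambda>x. K *\<^sub>R (grad (\<phi> k) x - G x))"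
        unfolding sqn_def by (intro integral_mono L2_integrable i j power_mono b) auto
      then have "sqn A \<le> K\<^sup>2 * sqn (\<lambda>x. grad (\<phi> k) x - G x)"
        by (simp add: sqn_scaleR)
      moreover have "(\<lambda>x. grad (\<lambda>x. h (\<phi> k x)) x - deriv h (u x) *\<^sub>R G x) = (\<lambda>x. A x + D k x)"
        using grad_compose[OF smooth_real_deriv[OF h(1)] test_fun_smooth[OF \<phi>(1)]]
        by (auto simp: A_def D_def algebra_simps)
      ultimately show "norm (sqn (\<lambda>x. grad (\<lambda>x. h (\<phi> k x)) x - deriv h (u x) *\<^sub>R G x))
        \<le> 2 * (K\<^sup>2 * sqn (\<lambda>x. grad (\<phi> k) x - G x)) + 2 * sqn (D k)"
        using sqn_add_le[OF j DL[of k]] by simp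
    qed
  qed
  moreover have "test_fun U (\<lambda>x. h (\<phi> k x))" for k
    by (rule test_fun_compose[OF \<phi>(1) h])
  ultimately show ?thesis
    unfolding H01_iff by (intro conjI exI[of _ "\<lambda>k x. h (\<phi> k x)"]) auto
qed

section \<open>The torsion function and the first eigenvalue\<close>

lemma sqn_parallelogram:
  "L2 f \<Longrightarrow> L2 g \<Longrightarrow> sqn (\<lambda>x. f x - g x) = 2 * sqn f + 2 * sqn g - sqn (\<lambda>x. f x + g x)"
  using sqn_add[of f g] sqn_diff[of f g] by linarith

lemma test_fun_zero: "test_fun U (\<lambda>_. 0)"
  by (rule test_funI[of _ "{}"]) (auto simp: smooth_const)

lemma integral_test_fun_sq_le:
  assumes U: "U \<in> sets borel" "emeasure lborel U < \<infinity>" and f: "test_fun U f"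
  shows "(LBINT x. f x)\<^sup>2 \<le> measure lborel U * sqn f"
  using Cauchy_Schwarz_L2[OF L2_test_fun[OF f] L2_indicator(1)[OF U]] L2_indicator(2)[OF U]
    H01_integral(2)[OF H01_test_fun[OF f] U]
  by (simp add: mult.commute)

text \<open>By the parallelogram law a minimising sequence of the torsion energy \<open>J\<close> is Cauchy.\<close>

lemma torsion_exists:
  fixes U :: "'a::euclidean_space set"
  assumes U: "U \<in> sets borel" "emeasure lborel U < \<infinity>"
  shows "\<exists>v. torsion_sol U v"
proof -
  obtain C where C: "C > 0" "\<And>f. test_fun U f \<Longrightarrow> sqn f \<le> C * sqn (grad f)"
    using poincare_finite_measure[OF U] by blast
  define m where "m = measure lborel U"
  define l where "l f = (LBINT x. f x)" for f :: "'a \<Rightarrow> real"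
  define J where "J f = sqn (grad f) / 2 - l f" for f :: "'a \<Rightarrow> real"
  define j where "j = Inf (J ` Collect (test_fun U))"
  \<comment> \<open>Cauchy-Schwarz and Poincare bound the linear term by the geometric mean of
    \<open>m * C\<close> and the Dirichlet energy, hence by their arithmetic mean; the energy part
    is absorbed by \<open>J\<close>.\<close>
  have "- (m * C / 2) \<le> J f" if f: "test_fun U f" for f
  proof -
    have "(l f)\<^sup>2 \<le> m * (C * sqn (grad f))"
      using integral_test_fun_sq_le[OF U f] mult_left_mono[OF C(2)[OF f], of m]
      by (simp add: l_def m_def)
    also have "\<dots> \<le> ((m * C + sqn (grad f)) / 2)\<^sup>2"
      using zero_le_power2[of "m * C - sqn (grad f)"] by (simp add: power2_eq_square field_simps)
    finally have "l f \<le> (m * C + sqn (grad f)) / 2"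
    proof (rule power2_le_imp_le)
      have "m \<ge> 0" by (simp add: m_def)
      then show "0 \<le> (m * C + sqn (grad f)) / 2" using C(1) by simp
    qed
    then show ?thesis by (simp add: J_def field_simps)
  qed
  then have bdd: "bdd_below (J ` Collect (test_fun U))"
    by (intro bdd_belowI2[of _ "- (m * C / 2)"]) simp
  then have jle: "j \<le> J f" if "test_fun U f" for f
    unfolding j_def using that by (intro cInf_lower) auto
  have "\<exists>f. test_fun U f \<and> J f < j + 1 / real (Suc k)" for k
    using cInf_lessD[of "J ` Collect (test_fun U)" "j + 1 / real (Suc k)"] test_fun_zero
    unfolding j_def by auto
  then obtain \<phi> where \<phi>: "\<And>k. test_fun U (\<phi> k)" and J\<phi>: "\<And>k. J (\<phi> k) < j + 1 / real (Suc k)" by metis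
  have gd: "grad (\<lambda>x. f x - g x) = (\<lambda>x. grad f x - grad g x)" if "test_fun U f" "test_fun U g" for f g
    using that by (intro ext grad_diff test_fun_smooth)
  \<comment> \<open>The midpoint of \<open>f\<close> and \<open>g\<close> is admissible, so its
    energy is at least \<open>j\<close>.\<close>
  have close: "sqn (\<lambda>x. grad f x - grad g x) \<le> 4 * (J f - j) + 4 * (J g - j)"
    if f: "test_fun U f" and g: "test_fun U g" for f g
  proof -
    have t: "test_fun U (\<lambda>x. 1/2 * (f x + g x))" by (intro test_fun_cmult test_fun_add f g)
    have "grad (\<lambda>x. 1/2 * (f x + g x)) = (\<lambda>x. (1/2) *\<^sub>R (grad f x + grad g x))"
      using grad_cmult[OF smooth_add[OF f[THEN test_fun_smooth] g[THEN test_fun_smooth]]]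
        grad_add[OF f[THEN test_fun_smooth] g[THEN test_fun_smooth]] by (intro ext) (simp only:)
    then have "sqn (grad (\<lambda>x. 1/2 * (f x + g x))) = sqn (\<lambda>x. grad f x + grad g x) / 4"
      by (simp add: sqn_scaleR power2_eq_square)
    moreover have "l (\<lambda>x. 1/2 * (f x + g x)) = (l f + l g) / 2"
      using integrable_test_fun[OF f] integrable_test_fun[OF g] by (simp add: l_def)
    ultimately have "j \<le> sqn (\<lambda>x. grad f x + grad g x) / 8 - (l f + l g) / 2"
      using jle[OF t] unfolding J_def by linarith
    then show ?thesis
      using sqn_parallelogram[OF L2_grad_test_fun[OF f] L2_grad_test_fun[OF g]]
      unfolding J_def right_diff_distrib add_divide_distrib by linarith
  qed
  have cauchy: "sqn (\<lambda>x. grad (\<phi> a) x - grad (\<phi> b) x) \<le> 8 / real (Suc N)" if "a \<ge> N" "b \<ge> N" for a b N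
  proof -
    have "1 / real (Suc a) \<le> 1 / real (Suc N)" "1 / real (Suc b) \<le> 1 / real (Suc N)"
      using that by (auto intro!: divide_left_mono)
    then have "4 * (J (\<phi> a) - j) + 4 * (J (\<phi> b) - j) \<le> 4 * (1 / real (Suc N)) + 4 * (1 / real (Suc N))"
      using J\<phi>[of a] J\<phi>[of b] unfolding right_diff_distrib by linarith
    then show ?thesis using order_trans[OF close[OF \<phi>[of a] \<phi>[of b]]] by simp
  qed
  have arch: "\<exists>N. K / real (Suc N) \<le> e" if "e > 0" for e K :: real
  proof -
    obtain N where "K / e < real N" using reals_Archimedean2 by blast
    then show ?thesis using that by (intro exI[of _ N]) (simp add: field_simps)
  qed
  have "\<exists>N. \<forall>a\<ge>N. \<forall>b\<ge>N. sqn (\<lambda>x. grad (\<phi> a) x - grad (\<phi> b) x) \<le> e" if "e > 0" for e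
    using arch[OF that, of 8] cauchy order_trans by meson
  from L2_complete[OF L2_grad_test_fun[OF \<phi>] this]
  obtain G where G: "L2 G" "(\<lambda>k. sqn (\<lambda>x. grad (\<phi> k) x - G x)) \<longlonglongrightarrow> 0" by blast
  \<comment> \<open>Poincare's inequality transfers the Cauchy property from the gradients to the
    functions.\<close>
  have "\<exists>N. \<forall>a\<ge>N. \<forall>b\<ge>N. sqn (\<lambda>x. \<phi> a x - \<phi> b x) \<le> e" if e: "e > 0" for e
  proof -
    obtain N where N: "(C * 8) / real (Suc N) \<le> e" using arch[OF e] by blast
    have "sqn (\<lambda>x. \<phi> a x - \<phi> b x) \<le> e" if "a \<ge> N" "b \<ge> N" for a b
    proof -
      have "sqn (\<lambda>x. \<phi> a x - \<phi> b x) \<le> C * sqn (\<lambda>x. grad (\<phi> a) x - grad (\<phi> b) x)"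
        using C(2)[OF test_fun_diff[OF \<phi>[of a] \<phi>[of b]]] gd[OF \<phi>[of a] \<phi>[of b]] by simp
      also have "\<dots> \<le> C * (8 / real (Suc N))"
        using C(1) by (intro mult_left_mono cauchy that) auto
      finally show ?thesis using N by simp
    qed
    then show ?thesis by blast
  qed
  from L2_complete[OF L2_test_fun[OF \<phi>] this]
  obtain v where v: "L2 v" "(\<lambda>k. sqn (\<lambda>x. \<phi> k x - v x)) \<longlonglongrightarrow> 0" by blast
  have "H01 U v G" unfolding H01_iff using G v \<phi> by blast
  moreover have "(LBINT x. G x \<bullet> grad \<psi> x) = l \<psi>" if \<psi>: "test_fun U \<psi>" for \<psi>
  proof -
    \<comment> \<open>The defect in the weak equation. Perturbing the minimising sequence by
      \<open>t * \<psi>\<close> and passing to the limit gives a nonnegative quadratic in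
      \<open>t\<close> that vanishes at 0, so its linear coefficient \<open>b\<close> must be
      0.\<close>
    define b where "b = (LBINT x. G x \<bullet> grad \<psi> x) - l \<psi>"
    have q: "0 \<le> t * b + t\<^sup>2 * sqn (grad \<psi>) / 2" for t
    proof -
      have "j - J (\<phi> k) \<le> t * ((LBINT x. grad (\<phi> k) x \<bullet> grad \<psi> x) - l \<psi>) + t\<^sup>2 * sqn (grad \<psi>) / 2" for k
      proof -
        have t: "test_fun U (\<lambda>x. \<phi> k x + t * \<psi> x)" by (intro test_fun_add test_fun_cmult \<phi> \<psi>)
        have "grad (\<lambda>x. \<phi> k x + t * \<psi> x) = (\<lambda>x. grad (\<phi> k) x + t *\<^sub>R grad \<psi> x)"
          using grad_add[OF test_fun_smooth[OF \<phi>[of k]] test_fun_smooth[OF test_fun_cmult[OF \<psi>, of t]]]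
            grad_cmult[OF test_fun_smooth[OF \<psi>]] by (intro ext) simp
        then have "sqn (grad (\<lambda>x. \<phi> k x + t * \<psi> x)) =
            sqn (grad (\<phi> k)) + 2 * (t * (LBINT x. grad (\<phi> k) x \<bullet> grad \<psi> x)) + t\<^sup>2 * sqn (grad \<psi>)"
          using sqn_add[OF L2_grad_test_fun[OF \<phi>[of k]] L2_scaleR[OF L2_grad_test_fun[OF \<psi>], of t]]
          by (simp add: sqn_scaleR)
        moreover have "l (\<lambda>x. \<phi> k x + t * \<psi> x) = l (\<phi> k) + t * l \<psi>"
          using integrable_test_fun[OF \<phi>[of k]] integrable_test_fun[OF \<psi>] by (simp add: l_def)
        ultimately show ?thesis using jle[OF t] by (simp add: J_def algebra_simps)
      qed
      moreover have "(\<lambda>k. t * ((LBINT x. grad (\<phi> k) x \<bullet> grad \<psi> x) - l \<psi>) + t\<^sup>2 * sqn (grad \<psi>) / 2)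
          \<longlonglongrightarrow> t * b + t\<^sup>2 * sqn (grad \<psi>) / 2"
        unfolding b_def
        by (intro tendsto_intros tendsto_inner_L2 L2_grad_test_fun[OF \<phi>] L2_grad_test_fun[OF \<psi>] G)
      moreover have "(\<lambda>k. j - J (\<phi> k)) \<longlonglongrightarrow> 0"
      proof (rule Lim_null_comparison)
        show "\<forall>\<^sub>F k in sequentially. norm (j - J (\<phi> k)) \<le> 1 / real (Suc k)"
          using jle[OF \<phi>] J\<phi> by (intro always_eventually allI) (smt (verit) real_norm_def)
        show "(\<lambda>k. 1 / real (Suc k)) \<longlonglongrightarrow> 0" using LIMSEQ_inverse_real_of_nat by (simp add: inverse_eq_divide)
      qed
      ultimately show ?thesis by (intro LIMSEQ_le) auto
    qed
    have "b = 0"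
    proof (rule ccontr)
      assume b: "b \<noteq> 0"
      \<comment> \<open>The 1 keeps the divisor positive even if the gradient of
        \<open>\<psi>\<close> vanishes; \<open>t = - b / s\<close> then gives -b^2/(2s).\<close>
      define s where "s = sqn (grad \<psi>) + 1"
      have "s > 0" unfolding s_def using sqn_nonneg[of "grad \<psi>"] by linarith
      have "0 \<le> (- b / s) * b + (- b / s)\<^sup>2 * s / 2"
      proof -
        have "(- b / s)\<^sup>2 * sqn (grad \<psi>) / 2 \<le> (- b / s)\<^sup>2 * s / 2"
          by (intro divide_right_mono mult_left_mono) (auto simp: s_def)
        then show ?thesis using q[of "- b / s"] by linarith
      qed
      also have "\<dots> = - (b\<^sup>2 / (2 * s))" using \<open>s > 0\<close> by (simp add: power2_eq_square field_simps)
      finally show False using b \<open>s > 0\<close> by (simp add: field_simps)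
    qed
    then show ?thesis by (simp add: b_def)
  qed
  ultimately show ?thesis unfolding torsion_sol_def l_def by blast
qed

lemma torsion_solE:
  assumes "torsion_sol U v"
  obtains G where "H01 U v G"
    "\<And>f. test_fun U f \<Longrightarrow> (LBINT x. G x \<bullet> grad f x) = (LBINT x. f x)"
  using assms by (auto simp: torsion_sol_def)

lemma sqn_eq_0_AE: "L2 f \<Longrightarrow> sqn f = 0 \<Longrightarrow> AE x in lborel. f x = 0"
  using integral_nonneg_eq_0_iff_AE[OF L2_integrable[of f]] by (simp add: sqn_def)

text \<open>The difference solves the equation with right-hand side 0. Testing it with itself makes
  its gradient vanish, and Poincare's inequality then makes the difference itself vanish.\<close>

lemma torsion_unique:
  assumes U: "U \<in> sets borel" "emeasure lborel U < \<infinity>" and "torsion_sol U v" "torsion_sol U w"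
  shows "AE x in lborel. v x = w x"
proof -
  obtain C where C: "C > 0" "\<And>f. test_fun U f \<Longrightarrow> sqn f \<le> C * sqn (grad f)"
    using poincare_finite_measure[OF U] by blast
  obtain G where G: "H01 U v G"
    "\<And>f. test_fun U f \<Longrightarrow> (LBINT x. G x \<bullet> grad f x) = (LBINT x. f x)"
    using assms(3) torsion_solE by blast
  obtain H where H: "H01 U w H"
    "\<And>f. test_fun U f \<Longrightarrow> (LBINT x. H x \<bullet> grad f x) = (LBINT x. f x)"
    using assms(4) torsion_solE by blast
  note D = H01_diff[OF G(1) H(1)]
  have "(LBINT x. (G x - H x) \<bullet> grad f x) = 0 * (LBINT x. f x)" if f: "test_fun U f" for f
    using integrable_inner_L2[OF H01_L2(2)[OF G(1)] L2_grad_test_fun[OF f]]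
      integrable_inner_L2[OF H01_L2(2)[OF H(1)] L2_grad_test_fun[OF f]] G(2)[OF f] H(2)[OF f]
    by (simp add: inner_diff_left)
  from H01_weak_equation[OF U D H01_L2(2)[OF D] this]
  have "sqn (\<lambda>x. G x - H x) = 0" by (simp add: sqn_def power2_norm_eq_inner)
  moreover have "1 / C * sqn (\<lambda>x. v x - w x) \<le> sqn (\<lambda>x. G x - H x)"
    using C by (intro H01_rayleigh[OF D]) (simp add: field_simps)
  ultimately have "sqn (\<lambda>x. v x - w x) = 0"
    using C(1) sqn_nonneg[of "\<lambda>x. v x - w x"] by (simp add: field_simps)
  from sqn_eq_0_AE[OF H01_L2(1)[OF D] this] show ?thesis by simp
qed

text \<open>Uniqueness almost everywhere justifies the definite description in
  \<open>torsion_Lp\<close>.\<close>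

lemma torsion_Lp_eq:
  assumes U: "U \<in> sets borel" "emeasure lborel U < \<infinity>" and v: "torsion_sol U v"
  shows "torsion_Lp p U = Lp_norm p v"
  unfolding torsion_Lp_def
proof (rule the_equality)
  show "\<exists>w. torsion_sol U w \<and> Lp_norm p v = Lp_norm p w" using v by blast
  fix r assume "\<exists>w. torsion_sol U w \<and> r = Lp_norm p w"
  then obtain w where w: "torsion_sol U w" "r = Lp_norm p w" by blast
  have "(\<integral>\<^sup>+x. ennreal (\<bar>w x\<bar> powr p) \<partial>lborel) = (\<integral>\<^sup>+x. ennreal (\<bar>v x\<bar> powr p) \<partial>lborel)"
    using torsion_unique[OF U w(1) v] by (intro nn_integral_cong_AE) (auto elim: eventually_mono)
  then show "r = Lp_norm p v" using w(2) by (simp add: Lp_norm_def)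
qed

lemma torsion_weak:
  assumes U: "U \<in> sets borel" "emeasure lborel U < \<infinity>" and G: "H01 U v G"
    "\<And>f. test_fun U f \<Longrightarrow> (LBINT x. G x \<bullet> grad f x) = (LBINT x. f x)"
    and w: "H01 U w W"
  shows "(LBINT x. G x \<bullet> W x) = (LBINT x. w x)"
  using H01_weak_equation[OF U w H01_L2(2)[OF G(1)], of 1] G(2) by simp

text \<open>A lower bound for the torsion from any trial function. Testing the equation with
  \<open>v\<close> identifies the integral of \<open>v\<close> with the squared norm of its
  gradient, and testing with \<open>f\<close> leaves a pairing for Cauchy-Schwarz.\<close>

lemma torsion_integral_ge:
  assumes U: "U \<in> sets borel" "emeasure lborel U < \<infinity>" and v: "torsion_sol U v" and f: "test_fun U f"
  shows "(LBINT x. f x)\<^sup>2 \<le> sqn (grad f) * (LBINT x. v x)"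
proof -
  obtain G where G: "H01 U v G"
    "\<And>f. test_fun U f \<Longrightarrow> (LBINT x. G x \<bullet> grad f x) = (LBINT x. f x)"
    using v torsion_solE by blast
  have "sqn G = (LBINT x. v x)"
    using torsion_weak[OF U G G(1)] by (simp add: sqn_def power2_norm_eq_inner)
  then show ?thesis
    using Cauchy_Schwarz_L2[OF H01_L2(2)[OF G(1)] L2_grad_test_fun[OF f]] G(2)[OF f]
    by (simp add: mult.commute)
qed

section \<open>Upper and lower bounds for the first eigenvalue\<close>

lemma lambda1_sqn: "lambda1 U = Inf {sqn G / sqn u | u G. H01 U u G \<and> sqn u \<noteq> 0}"
  by (simp add: lambda1_def sqn_def)

lemma lambda1_le:
  assumes "H01 U u G"
  shows "lambda1 U * sqn u \<le> sqn G"
proof (cases "sqn u = 0")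
  case False
  then have pos: "sqn u > 0" using sqn_nonneg[of u] by linarith
  have "lambda1 U \<le> sqn G / sqn u"
    unfolding lambda1_sqn using assms False
    by (intro cInf_lower bdd_belowI[of _ 0]) auto
  then show ?thesis using pos by (simp add: field_simps)
qed simp

text \<open>A bump inside \<open>U\<close> makes the set of Rayleigh quotients nonempty, as needed
  for its real infimum to be meaningful.\<close>

lemma lambda1_ge:
  assumes U: "open U" "a \<in> U" and c: "\<And>f. test_fun U f \<Longrightarrow> c * sqn f \<le> sqn (grad f)"
  shows "c \<le> lambda1 U"
  unfolding lambda1_sqn
proof (rule cInf_greatest)
  obtain r where r: "r > 0" "cball a r \<subseteq> U" using U open_contains_cball by blast
  have "sqn (bump a r) \<noteq> 0"
    using sqn_test_fun_pos[OF test_fun_bump[OF r], of a] bump_pos[OF r(1), of a a] r(1)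
    by (metis dist_self less_irrefl)
  then show "{sqn G / sqn u | u G. H01 U u G \<and> sqn u \<noteq> 0} \<noteq> {}"
    using H01_test_fun[OF test_fun_bump[OF r]] by blast
  fix y assume "y \<in> {sqn G / sqn u | u G. H01 U u G \<and> sqn u \<noteq> 0}"
  then obtain u G where u: "y = sqn G / sqn u" "H01 U u G" "sqn u \<noteq> 0" by blast
  have "sqn u > 0" using u(3) sqn_nonneg[of u] by linarith
  then show "c \<le> y" using H01_rayleigh[OF u(2) c] unfolding u(1) by (simp add: pos_le_divide_eq)
qed

lemma lambda1_pos:
  assumes "open U" "a \<in> U" "emeasure lborel U < \<infinity>"
  shows "lambda1 U > 0"
proof -
  obtain C where C: "C > 0" "\<And>f. test_fun U f \<Longrightarrow> sqn f \<le> C * sqn (grad f)"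
    using poincare_finite_measure[OF _ assms(3)] assms(1) by auto
  have "1 / C \<le> lambda1 U"
    using C by (intro lambda1_ge[OF assms(1,2)]) (simp add: field_simps)
  moreover have "1 / C > 0" using C(1) by simp
  ultimately show ?thesis by linarith
qed

section \<open>The upper bound\<close>

text \<open>Concavity of t -> t^(r/q): with t = a^q this is the tangent line at \<open>y\<close>,
  multiplied by y^(1 - r/q).\<close>

lemma powr_tangent:
  fixes a y r q :: real
  assumes "a \<ge> 0" "y > 0" "0 < r" "r \<le> q"
  shows "a powr r * y powr (1 - r / q) \<le> r / q * a powr q + (1 - r / q) * y"
proof (cases "a = 0")
  case False
  then have "(a powr q) powr (r / q) * y powr (1 - r / q) \<le> r / q * a powr q + (1 - r / q) * y"
    using assms by (intro Youngs_inequality_0) auto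
  then show ?thesis using assms by (simp add: powr_powr)
qed (use assms in simp)

text \<open>The tangent inequality is integrated for every \<open>y\<close> above the mean
  \<open>Y\<close> of the q-th power, and then \<open>y\<close> decreases to \<open>Y\<close>.
  Keeping \<open>y > Y\<close> also covers \<open>Y = 0\<close>, where there is no tangent. The
  tangent at 1 supplies integrability.\<close>

lemma power_mean:
  fixes f :: "'a::euclidean_space \<Rightarrow> real"
  assumes U[measurable]: "U \<in> sets borel" and fin: "emeasure lborel U < \<infinity>" and m: "measure lborel U > 0"
    and f[measurable]: "f \<in> borel_measurable borel" and nn: "\<And>x. f x \<ge> 0" and rq: "0 < r" "r \<le> q"
    and int: "integrable lborel (\<lambda>x. indicator U x * f x powr q)"
  shows "integrable lborel (\<lambda>x. indicator U x * f x powr r)"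
    "(LBINT x. indicator U x * f x powr r) / measure lborel U
      \<le> ((LBINT x. indicator U x * f x powr q) / measure lborel U) powr (r / q)"
proof -
  let ?m = "measure lborel U"
  define Y where "Y = (LBINT x. indicator U x * f x powr q) / ?m"
  have Y0: "Y \<ge> 0" unfolding Y_def by (intro divide_nonneg_nonneg integral_nonneg_AE) auto
  define \<beta> where "\<beta> = 1 - r / q"
  have \<beta>: "0 \<le> \<beta>" "\<beta> < 1" using rq by (auto simp: \<beta>_def field_simps)
  have iU: "integrable lborel (indicator U :: 'a \<Rightarrow> real)" using fin by simp
  have i2: "integrable lborel (\<lambda>x. (1 - \<beta>) * (indicator U x * f x powr q) + \<beta> * y * indicator U x)" for y
    using int iU by (intro Bochner_Integration.integrable_add integrable_mult_right) auto
  have tang: "indicator U x * f x powr r * y powr \<beta>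
      \<le> (1 - \<beta>) * (indicator U x * f x powr q) + \<beta> * y * indicator U x" if "y > 0" for x y
    using powr_tangent[OF nn that rq, of x] by (auto simp: indicator_def \<beta>_def)
  show i1: "integrable lborel (\<lambda>x. indicator U x * f x powr r)"
    by (rule Bochner_Integration.integrable_bound[OF i2[of 1]])
      (use tang[of 1] \<beta> in \<open>auto simp: abs_mult intro!: always_eventually abs_of_nonneg[THEN order_eq_refl, THEN order_trans]\<close>)
  have le: "(LBINT x. indicator U x * f x powr r) / ?m \<le> y powr (1 - \<beta>)" if "y > Y" for y
  proof -
    have y: "y > 0" using that Y0 by linarith
    have "(LBINT x. indicator U x * f x powr r * y powr \<beta>)
        \<le> (LBINT x. (1 - \<beta>) * (indicator U x * f x powr q) + \<beta> * y * indicator U x)"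
      using i1 by (intro integral_mono i2 tang y) auto
    also have "\<dots> = (1 - \<beta>) * (LBINT x. indicator U x * f x powr q) + \<beta> * y * ?m"
      using int iU by (simp add: Bochner_Integration.integral_add)
    also have "\<dots> = ((1 - \<beta>) * Y + \<beta> * y) * ?m" using m by (simp add: Y_def field_simps)
    also have "\<dots> \<le> ((1 - \<beta>) * y + \<beta> * y) * ?m"
      using that \<beta> by (intro mult_right_mono add_mono mult_left_mono) auto
    also have "(1 - \<beta>) * y + \<beta> * y = y" by (simp add: algebra_simps)
    also have "(LBINT x. indicator U x * f x powr r * y powr \<beta>)
        = (LBINT x. indicator U x * f x powr r) * y powr \<beta>"
      by (rule integral_mult_left_zero)
    finally have "(LBINT x. indicator U x * f x powr r) * y powr \<beta> \<le> y * ?m" .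
    also have "y * ?m = (y powr (1 - \<beta>) * y powr \<beta>) * ?m" using y by (simp flip: powr_add)
    also have "\<dots> = (y powr (1 - \<beta>) * ?m) * y powr \<beta>" by (simp only: mult_ac)
    finally have "(LBINT x. indicator U x * f x powr r) \<le> y powr (1 - \<beta>) * ?m"
      using y by (subst (asm) mult_le_cancel_right) (auto simp: not_less)
    then show ?thesis using m by (simp add: field_simps)
  qed
  have "(\<lambda>n. (Y + inverse (real (Suc n))) powr (1 - \<beta>)) \<longlonglongrightarrow> (Y + 0) powr (1 - \<beta>)"
    using \<beta> Y0 by (intro tendsto_powr' tendsto_intros LIMSEQ_inverse_real_of_nat)
      (auto intro!: always_eventually)
  then have "(\<lambda>n. (Y + inverse (real (Suc n))) powr (1 - \<beta>)) \<longlonglongrightarrow> Y powr (1 - \<beta>)" by simp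
  then have "(LBINT x. indicator U x * f x powr r) / ?m \<le> Y powr (1 - \<beta>)"
    by (rule LIMSEQ_le_const) (auto intro!: le exI[of _ 0])
  then show "(LBINT x. indicator U x * f x powr r) / ?m
      \<le> ((LBINT x. indicator U x * f x powr q) / ?m) powr (r / q)"
    by (simp add: Y_def \<beta>_def)
qed

text \<open>The truncation \<open>T\<close> and the shift \<open>\<epsilon>\<close> turn \<open>s powr (p - 1)\<close> and \<open>s powr (p / 2)\<close> into smooth functions
  \<open>h\<close> and \<open>k\<close> with bounded derivatives, while keeping \<open>(k')\<^sup>2 \<le> p\<^sup>2 / (4 (p - 1)) h'\<close> with the sharp constant.\<close>

lemma truncated_power_estimate:
  fixes U :: "'a::euclidean_space set"
  assumes U: "U \<in> sets borel" "emeasure lborel U < \<infinity>" and G: "H01 U v G"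
    "\<And>f. test_fun U f \<Longrightarrow> (LBINT x. G x \<bullet> grad f x) = (LBINT x. f x)"
    and T: "smooth_fun T" "T 0 = 0" "\<And>s. 0 \<le> deriv T s" "\<And>s. deriv T s \<le> 1" "\<And>s. \<bar>T s\<bar> \<le> M"
    and p: "p \<ge> 2" and e: "\<epsilon> > 0"
  shows "lambda1 U * sqn (\<lambda>x. ((T (v x))\<^sup>2 + \<epsilon>\<^sup>2) powr (p / 4) - (\<epsilon>\<^sup>2) powr (p / 4))
    \<le> p\<^sup>2 / (4 * (p - 1)) * (LBINT x. T (v x) * ((T (v x))\<^sup>2 + \<epsilon>\<^sup>2) powr (p / 2 - 1))"
proof -
  \<comment> \<open>For the pure powers s^(p-1) and s^(p/2) this constant is exactly the square of
    the second derivative function divided by the first.\<close>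
  define c where "c = p\<^sup>2 / (4 * (p - 1))"
  have c0: "c \<ge> 0" using p by (simp add: c_def)
  define S where "S s = (T s)\<^sup>2 + \<epsilon>\<^sup>2" for s
  have S0: "S s > 0" for s using e by (simp add: S_def add_nonneg_pos)
  define h where "h s = T s * S s powr (p / 2 - 1)" for s
  define k where "k s = S s powr (p / 4) - (\<epsilon>\<^sup>2) powr (p / 4)" for s
  have smS: "smooth_fun S" unfolding S_def by (intro smooth_add smooth_power smooth_const T)
  have smh: "smooth_fun h" unfolding h_def by (intro smooth_mult T smooth_powr smS S0)
  have smk: "smooth_fun k" unfolding k_def by (intro smooth_diff smooth_const smooth_powr smS S0)
  have dT: "(T has_real_derivative deriv T s) (at s)" for s by (rule smooth_real_deriv[OF T(1)])
  have dS: "(S has_real_derivative 2 * T s * deriv T s) (at s)" for s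
    unfolding S_def by (auto intro!: derivative_eq_intros dT)
  have dSp: "((\<lambda>s. S s powr a) has_real_derivative a * S s powr (a - 1) * (2 * T s * deriv T s)) (at s)" for a s
    by (rule DERIV_chain2[OF has_real_derivative_powr[OF S0] dS])
  have dh: "deriv h s = deriv T s * S s powr (p / 2 - 2) * (S s + (p - 2) * (T s)\<^sup>2)" for s
  proof -
    have e1: "S s powr (p / 2 - 1) = S s * S s powr (p / 2 - 2)"
      using S0[of s] powr_add[of "S s" 1 "p / 2 - 2"] by (simp add: powr_one)
    have "(h has_real_derivative deriv T s * S s powr (p / 2 - 1)
        + ((p / 2 - 1) * S s powr (p / 2 - 1 - 1) * (2 * T s * deriv T s)) * T s) (at s)"
      unfolding h_def by (rule DERIV_mult[OF dT dSp])
    then have "deriv h s = deriv T s * S s powr (p / 2 - 1)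
        + ((p / 2 - 1) * S s powr (p / 2 - 2) * (2 * T s * deriv T s)) * T s"
      by (intro DERIV_imp_deriv) simp
    then show ?thesis unfolding e1 by (simp add: power2_eq_square field_simps)
  qed
  have dk: "deriv k s = p / 2 * T s * deriv T s * S s powr (p / 4 - 1)" for s
  proof -
    have "(k has_real_derivative p / 4 * S s powr (p / 4 - 1) * (2 * T s * deriv T s) - 0) (at s)"
      unfolding k_def by (intro DERIV_diff dSp DERIV_const)
    then have "deriv k s = p / 4 * S s powr (p / 4 - 1) * (2 * T s * deriv T s)"
      by (intro DERIV_imp_deriv) simp
    then show ?thesis by simp
  qed
  have TS: "(T s)\<^sup>2 \<le> S s" for s by (simp add: S_def)
  have kh: "(deriv k s)\<^sup>2 \<le> c * deriv h s" for s
  proof -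
    have e2: "(S s powr (p / 4 - 1))\<^sup>2 = S s powr (p / 2 - 2)"
      by (simp add: power2_eq_square flip: powr_add)
    have "(deriv k s)\<^sup>2 = p\<^sup>2 / 4 * S s powr (p / 2 - 2) * ((T s)\<^sup>2 * (deriv T s)\<^sup>2)"
      unfolding dk power_mult_distrib e2 by (simp add: power2_eq_square)
    \<comment> \<open>Neither regularisation worsens the constant: the shift only makes
      \<open>S s\<close> larger than \<open>(T s)\<^sup>2\<close>, and a derivative of
      \<open>T\<close> between 0 and 1 dominates its own square.\<close>
    also have "\<dots> \<le> p\<^sup>2 / 4 * S s powr (p / 2 - 2) * ((S s + (p - 2) * (T s)\<^sup>2) / (p - 1) * deriv T s)"
    proof (intro mult_left_mono mult_mono)
      have "(p - 1) * (T s)\<^sup>2 \<le> S s + (p - 2) * (T s)\<^sup>2"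
        using TS[of s] by (simp add: algebra_simps)
      then show "(T s)\<^sup>2 \<le> (S s + (p - 2) * (T s)\<^sup>2) / (p - 1)"
        using p by (simp add: field_simps)
      show "(deriv T s)\<^sup>2 \<le> deriv T s"
        using T(3,4)[of s] by (simp add: power2_eq_square mult_left_le)
      show "0 \<le> (S s + (p - 2) * (T s)\<^sup>2) / (p - 1)"
        using p S0[of s] by (intro divide_nonneg_nonneg add_nonneg_nonneg mult_nonneg_nonneg) auto
    qed (use p in auto)
    also have "\<dots> = c * deriv h s"
      using p unfolding dh c_def by (simp add: field_simps)
    finally show ?thesis .
  qed
  have h0: "0 \<le> deriv h s" for s
    unfolding dh using T(3) p S0[of s] by (intro mult_nonneg_nonneg add_nonneg_nonneg) auto
  have M: "S s \<le> M\<^sup>2 + \<epsilon>\<^sup>2" for s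
    using T(5)[of s] power_mono[OF T(5)[of s], of 2] by (simp add: S_def)
  define K where "K = (p - 1) * (M\<^sup>2 + \<epsilon>\<^sup>2) powr (p / 2 - 1)"
  have hK: "deriv h s \<le> K" for s
  proof -
    have "deriv h s = deriv T s * (S s powr (p / 2 - 2) * (S s + (p - 2) * (T s)\<^sup>2))"
      unfolding dh by (simp add: mult_ac)
    also have "\<dots> \<le> 1 * (S s powr (p / 2 - 2) * (S s + (p - 2) * (T s)\<^sup>2))"
      using T(4) p S0[of s] by (intro mult_right_mono mult_nonneg_nonneg add_nonneg_nonneg) auto
    also have "\<dots> \<le> 1 * (S s powr (p / 2 - 2) * (S s + (p - 2) * S s))"
      using p TS by (intro mult_left_mono add_mono) auto
    also have "\<dots> = (p - 1) * (S s * S s powr (p / 2 - 2))" by (simp add: algebra_simps)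
    also have "S s * S s powr (p / 2 - 2) = S s powr (p / 2 - 1)"
      using S0[of s] powr_add[of "S s" 1 "p / 2 - 2"] by (simp add: powr_one)
    also have "(p - 1) * \<dots> \<le> K"
      unfolding K_def using p M S0[of s] by (intro mult_left_mono powr_mono2) (auto simp: less_imp_le)
    finally show ?thesis .
  qed
  have Hh: "H01 U (\<lambda>x. h (v x)) (\<lambda>x. deriv h (v x) *\<^sub>R G x)"
    using h0 hK by (intro H01_compose[OF G(1) smh, of K]) (auto simp: h_def T(2))
  have Hk: "H01 U (\<lambda>x. k (v x)) (\<lambda>x. deriv k (v x) *\<^sub>R G x)"
  proof (rule H01_compose[OF G(1) smk, of "sqrt (c * K)"])
    show "k 0 = 0" by (simp add: k_def S_def T(2))
    fix s
    have "(deriv k s)\<^sup>2 \<le> c * K" using kh[of s] mult_left_mono[OF hK c0, of s] by linarith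
    then show "\<bar>deriv k s\<bar> \<le> sqrt (c * K)" by (metis real_sqrt_abs real_sqrt_le_mono)
  qed
  \<comment> \<open>\<open>k (v x)\<close> enters the Rayleigh quotient and \<open>h (v x)\<close>
    the torsion equation; \<open>kh\<close> compares the two gradient terms pointwise.\<close>
  have "lambda1 U * sqn (\<lambda>x. k (v x)) \<le> sqn (\<lambda>x. deriv k (v x) *\<^sub>R G x)"
    by (rule lambda1_le[OF Hk])
  also have "\<dots> \<le> (LBINT x. c * (G x \<bullet> (deriv h (v x) *\<^sub>R G x)))"
    unfolding sqn_def
  proof (rule integral_mono)
    show "integrable lborel (\<lambda>x. (norm (deriv k (v x) *\<^sub>R G x))\<^sup>2)"
      by (rule L2_integrable[OF H01_L2(2)[OF Hk]])
    show "integrable lborel (\<lambda>x. c * (G x \<bullet> (deriv h (v x) *\<^sub>R G x)))"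
      by (intro integrable_mult_right integrable_inner_L2 H01_L2(2)[OF Hh] H01_L2(2)[OF G(1)])
    show "(norm (deriv k (v x) *\<^sub>R G x))\<^sup>2 \<le> c * (G x \<bullet> (deriv h (v x) *\<^sub>R G x))" for x
      using mult_right_mono[OF kh[of "v x"], of "(norm (G x))\<^sup>2"]
      by (simp add: power_mult_distrib power2_norm_eq_inner mult_ac)
  qed
  also have "\<dots> = c * (LBINT x. h (v x))"
    using torsion_weak[OF U G Hh] by simp
  finally show ?thesis by (simp add: k_def h_def S_def c_def)
qed

text \<open>The shift is sent to 0 with the truncation fixed: the bound \<open>M\<close> and the
  finite measure of \<open>U\<close> provide the dominating functions.\<close>

lemma truncated_moment_estimate:
  fixes U :: "'a::euclidean_space set"
  assumes U[measurable]: "U \<in> sets borel" and fin: "emeasure lborel U < \<infinity>" and G: "H01 U v G"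
    "\<And>f. test_fun U f \<Longrightarrow> (LBINT x. G x \<bullet> grad f x) = (LBINT x. f x)"
    and T: "smooth_fun T" "T 0 = 0" "\<And>s. 0 \<le> deriv T s" "\<And>s. deriv T s \<le> 1" "\<And>s. \<bar>T s\<bar> \<le> M"
    and p: "p \<ge> 2" and l0: "lambda1 U \<ge> 0"
  shows "lambda1 U * (LBINT x. indicator U x * \<bar>T (v x)\<bar> powr p)
    \<le> p\<^sup>2 / (4 * (p - 1)) * (LBINT x. indicator U x * \<bar>T (v x)\<bar> powr (p - 1))"
proof -
  note [measurable] = L2_measurable[OF H01_L2(1)[OF G(1)]]
  have [measurable]: "T \<in> borel_measurable borel"
    by (auto intro!: borel_measurable_continuous_onI smooth_continuous T)
  define c where "c = p\<^sup>2 / (4 * (p - 1))"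
  have c0: "c \<ge> 0" using p by (simp add: c_def)
  have M0: "M \<ge> 0" using T(5)[of 0] by linarith
  define \<epsilon> where "\<epsilon> n = inverse (real (Suc n))" for n
  have e0: "\<epsilon> n > 0" and e1: "\<epsilon> n \<le> 1" for n by (auto simp: \<epsilon>_def field_simps)
  have elim: "\<epsilon> \<longlonglongrightarrow> 0" unfolding \<epsilon>_def by (rule LIMSEQ_inverse_real_of_nat)
  define S where "S n x = (T (v x))\<^sup>2 + (\<epsilon> n)\<^sup>2" for n x
  have S0: "S n x > 0" for n x using e0[of n] by (simp add: S_def add_nonneg_pos)
  have [measurable]: "S n \<in> borel_measurable borel" for n unfolding S_def by simp
  have SM: "S n x \<le> M\<^sup>2 + 1" for n x
    using power_mono[OF T(5)[of "v x"], of 2] power_mono[OF e1[of n], of 2] e0[of n] by (simp add: S_def)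
  have Slim: "(\<lambda>n. S n x powr a) \<longlonglongrightarrow> \<bar>T (v x)\<bar> powr (2 * a)" if "a > 0" for x a
  proof -
    have "(\<lambda>n. S n x powr a) \<longlonglongrightarrow> ((T (v x))\<^sup>2 + 0\<^sup>2) powr a"
      unfolding S_def using that
      by (intro tendsto_powr' tendsto_intros elim) (auto intro!: always_eventually)
    also have "((T (v x))\<^sup>2 + 0\<^sup>2) powr a = \<bar>T (v x)\<bar> powr (2 * a)"
      using powr_powr[of "\<bar>T (v x)\<bar>" 2 a] by simp
    finally show ?thesis .
  qed
  have elim2: "(\<lambda>n. ((\<epsilon> n)\<^sup>2) powr (p / 4)) \<longlonglongrightarrow> 0"
  proof -
    have "(\<lambda>n. ((\<epsilon> n)\<^sup>2) powr (p / 4)) \<longlonglongrightarrow> (0\<^sup>2) powr (p / 4)"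
      using p by (intro tendsto_powr' tendsto_intros elim) (auto intro!: always_eventually)
    then show ?thesis by simp
  qed
  define k where "k n x = S n x powr (p / 4) - ((\<epsilon> n)\<^sup>2) powr (p / 4)" for n x
  have [measurable]: "k n \<in> borel_measurable borel" for n unfolding k_def by simp
  have k0: "0 \<le> k n x" for n x
    unfolding k_def using p by (auto intro!: powr_mono2 simp: S_def)
  have kB: "k n x \<le> (M\<^sup>2 + 1) powr (p / 4)" for n x
  proof -
    have "k n x \<le> S n x powr (p / 4)" by (simp add: k_def)
    also have "\<dots> \<le> (M\<^sup>2 + 1) powr (p / 4)" using p SM S0[of n x] by (intro powr_mono2) (auto simp: less_imp_le)
    finally show ?thesis .
  qed
  have iU: "integrable lborel (\<lambda>x. B * indicator U x :: real)" for B using fin by simp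
  have lim1: "(\<lambda>n. LBINT x. indicator U x * (k n x)\<^sup>2) \<longlonglongrightarrow> (LBINT x. indicator U x * \<bar>T (v x)\<bar> powr p)"
  proof (rule integral_dominated_convergence[OF _ _ iU[of "((M\<^sup>2 + 1) powr (p / 4))\<^sup>2"]])
    show "AE x in lborel. (\<lambda>n. indicator U x * (k n x)\<^sup>2) \<longlonglongrightarrow> indicator U x * \<bar>T (v x)\<bar> powr p"
    proof (intro always_eventually allI)
      fix x
      have "(\<lambda>n. k n x) \<longlonglongrightarrow> \<bar>T (v x)\<bar> powr (2 * (p / 4)) - 0"
        unfolding k_def using p by (intro tendsto_diff Slim elim2) auto
      then have "(\<lambda>n. indicator U x * (k n x)\<^sup>2) \<longlonglongrightarrow> indicator U x * (\<bar>T (v x)\<bar> powr (2 * (p / 4)) - 0)\<^sup>2"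
        by (intro tendsto_intros)
      then show "(\<lambda>n. indicator U x * (k n x)\<^sup>2) \<longlonglongrightarrow> indicator U x * \<bar>T (v x)\<bar> powr p"
        by (simp add: power2_eq_square flip: powr_add)
    qed
    show "AE x in lborel. norm (indicator U x * (k n x)\<^sup>2) \<le> ((M\<^sup>2 + 1) powr (p / 4))\<^sup>2 * indicator U x" for n
      using power_mono[OF kB k0, of n _ 2] by (intro always_eventually allI) (auto simp: indicator_def)
  qed auto
  have lim2: "(\<lambda>n. LBINT x. indicator U x * S n x powr ((p - 1) / 2))
      \<longlonglongrightarrow> (LBINT x. indicator U x * \<bar>T (v x)\<bar> powr (p - 1))"
  proof (rule integral_dominated_convergence[OF _ _ iU[of "(M\<^sup>2 + 1) powr ((p - 1) / 2)"]])
    show "AE x in lborel. (\<lambda>n. indicator U x * S n x powr ((p - 1) / 2)) \<longlonglongrightarrow> indicator U x * \<bar>T (v x)\<bar> powr (p - 1)"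
    proof (intro always_eventually allI tendsto_mult_left)
      show "(\<lambda>n. S n x powr ((p - 1) / 2)) \<longlonglongrightarrow> \<bar>T (v x)\<bar> powr (p - 1)" for x
        using Slim[of "(p - 1) / 2" x] p unfolding times_divide_eq_right by (simp only: nonzero_mult_div_cancel_left) simp
    qed
    show "AE x in lborel. norm (indicator U x * S n x powr ((p - 1) / 2))
        \<le> (M\<^sup>2 + 1) powr ((p - 1) / 2) * indicator U x" for n
      using p SM S0[of n] by (intro always_eventually allI) (auto simp: indicator_def less_imp_le intro!: powr_mono2)
  qed auto
  have step: "lambda1 U * (LBINT x. indicator U x * (k n x)\<^sup>2)
      \<le> c * (LBINT x. indicator U x * S n x powr ((p - 1) / 2))" for n
  proof -
    define H where "H x = T (v x) * S n x powr (p / 2 - 1)" for x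
    have [measurable]: "H \<in> borel_measurable borel" unfolding H_def by simp
    have vz: "AE x in lborel. x \<notin> U \<longrightarrow> v x = 0" by (rule H01_AE_zero[OF G(1)])
    \<comment> \<open>Outside \<open>U\<close> one has v = 0, and the constant subtracted in
      \<open>k\<close> cancels the remaining shift.\<close>
    have "AE x in lborel. indicator U x * (k n x)\<^sup>2 = (k n x)\<^sup>2"
      using vz by eventually_elim (auto simp: indicator_def k_def S_def T(2))
    then have "(LBINT x. indicator U x * (k n x)\<^sup>2) = sqn (k n)"
      unfolding sqn_def by (intro integral_cong_AE) auto
    moreover have "AE x in lborel. H x = indicator U x * H x"
      using vz by eventually_elim (auto simp: indicator_def H_def T(2))
    then have "(LBINT x. H x) = (LBINT x. indicator U x * H x)"
      by (intro integral_cong_AE) auto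
    moreover have "(LBINT x. indicator U x * H x) \<le> (LBINT x. indicator U x * S n x powr ((p - 1) / 2))"
    proof -
      \<comment> \<open>The factor \<open>T (v x)\<close> is absorbed as half a power of
        \<open>S n x\<close>, so that a single power is left for the limit.\<close>
      have HS: "\<bar>H x\<bar> \<le> S n x powr ((p - 1) / 2)" for x
      proof -
        have "\<bar>T (v x)\<bar> \<le> S n x powr (1 / 2)"
          using S0[of n x] by (simp add: powr_half_sqrt S_def real_le_rsqrt)
        then have "\<bar>H x\<bar> \<le> S n x powr (1 / 2) * S n x powr (p / 2 - 1)"
          unfolding H_def abs_mult by (intro mult_mono) auto
        also have "\<dots> = S n x powr ((p - 1) / 2)"
          by (simp add: diff_divide_distrib flip: powr_add)
        finally show ?thesis .
      qed
      have SB: "S n x powr ((p - 1) / 2) \<le> (M\<^sup>2 + 1) powr ((p - 1) / 2)" for x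
        using p SM S0[of n x] by (intro powr_mono2) (auto simp: less_imp_le)
      have i: "integrable lborel (\<lambda>x. indicator U x * S n x powr ((p - 1) / 2))"
        by (rule Bochner_Integration.integrable_bound[OF iU[of "(M\<^sup>2 + 1) powr ((p - 1) / 2)"]])
          (use SB in \<open>auto simp: indicator_def\<close>)
      moreover have "integrable lborel (\<lambda>x. indicator U x * H x)"
        by (rule Bochner_Integration.integrable_bound[OF i]) (use HS in \<open>auto simp: indicator_def\<close>)
      ultimately show ?thesis
        using HS by (intro integral_mono) (auto simp: indicator_def dest: abs_le_D1)
    qed
    moreover have "lambda1 U * sqn (k n) \<le> c * (LBINT x. H x)"
      using truncated_power_estimate[OF U fin G T p e0[of n]]
      by (simp add: k_def[abs_def] H_def S_def c_def)
    ultimately show ?thesis using mult_left_mono[OF _ c0] by fastforce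
  qed
  show ?thesis
    using LIMSEQ_le[OF tendsto_mult_left[OF lim1] tendsto_mult_left[OF lim2]] step
    unfolding c_def[symmetric] by blast
qed

text \<open>The witness is s / sqrt(1 + (s/(n+1))^2). Its derivative is the power -3/2 of the same
  radicand, hence between 0 and 1, and its modulus stays below n + 1.\<close>

lemma truncations_exist:
  obtains T :: "nat \<Rightarrow> real \<Rightarrow> real" where "\<And>n. smooth_fun (T n)" "\<And>n. T n 0 = 0" "\<And>n s. 0 \<le> deriv (T n) s"
    "\<And>n s. deriv (T n) s \<le> 1" "\<And>n s. \<bar>T n s\<bar> \<le> real (Suc n)" "\<And>s. (\<lambda>n. T n s) \<longlonglongrightarrow> s"
proof
  define A where "A n s = 1 + (s / real (Suc n))\<^sup>2" for n and s :: real
  have A1: "A n s \<ge> 1" for n s by (simp add: A_def)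
  then have A0: "A n s > 0" for n s by (meson less_le_trans zero_less_one)
  define T where "T n s = s * A n s powr (-1/2)" for n s
  have smA: "smooth_fun (A n)" for n
  proof -
    have "smooth_fun (\<lambda>s. 1 + (1 / real (Suc n) * s)\<^sup>2)"
      by (intro smooth_add smooth_power smooth_mult smooth_const smooth_ident)
    then show ?thesis by (simp add: A_def[abs_def])
  qed
  show "smooth_fun (T n)" for n
    unfolding T_def by (intro smooth_mult smooth_ident smooth_powr smA A0)
  show "T n 0 = 0" for n by (simp add: T_def)
  have d: "deriv (T n) s = A n s powr (-3/2)" for n s
  proof -
    have dA: "(A n has_real_derivative 2 * s / (real (Suc n))\<^sup>2) (at s)"
      unfolding A_def by (auto intro!: derivative_eq_intros simp: power2_eq_square)
    have "((\<lambda>s. A n s powr (-1/2)) has_real_derivative -1/2 * A n s powr (-1/2 - 1) * (2 * s / (real (Suc n))\<^sup>2)) (at s)"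
      by (rule DERIV_chain2[OF has_real_derivative_powr[OF A0] dA])
    from DERIV_mult[OF DERIV_ident this]
    have "deriv (T n) s = A n s powr (-1/2) + -1/2 * A n s powr (-1/2 - 1) * (2 * s / (real (Suc n))\<^sup>2) * s"
      unfolding T_def by (intro DERIV_imp_deriv) simp
    also have "A n s powr (-1/2) = A n s * A n s powr (-3/2)"
      using A0[of n s] powr_add[of "A n s" 1 "-3/2"] by (simp add: powr_one)
    finally have *: "deriv (T n) s = A n s * A n s powr (-3/2)
        + -1/2 * A n s powr (-3/2) * (2 * s / (real (Suc n))\<^sup>2) * s" by simp
    have "a * P + -1/2 * P * (2 * s / N\<^sup>2) * s = P" if "a = 1 + (s / N)\<^sup>2" for a P N :: real
      unfolding that by (simp add: power2_eq_square algebra_simps)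
    from this[OF A_def] show ?thesis unfolding * .
  qed
  show "0 \<le> deriv (T n) s" for n s by (simp add: d)
  show "deriv (T n) s \<le> 1" for n s
    unfolding d using powr_mono[of "-3/2" 0 "A n s"] A1[of n s] by simp
  show "\<bar>T n s\<bar> \<le> real (Suc n)" for n s
  proof (rule power2_le_imp_le)
    have "(A n s powr (-1/2))\<^sup>2 = A n s powr (-1/2 + -1/2)"
      unfolding power2_eq_square by (rule powr_add[symmetric])
    also have "\<dots> = inverse (A n s)" using A0[of n s] by (simp add: powr_minus)
    finally have "(A n s powr (-1/2))\<^sup>2 = inverse (A n s)" .
    then have "\<bar>T n s\<bar>\<^sup>2 = s\<^sup>2 / A n s"
      unfolding T_def power2_abs power_mult_distrib by (simp only: divide_inverse)
    also have "\<dots> \<le> (real (Suc n))\<^sup>2"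
    proof -
      have "(real (Suc n))\<^sup>2 * A n s = (real (Suc n))\<^sup>2 + s\<^sup>2"
        by (simp add: A_def power_divide distrib_left del: of_nat_Suc)
      then show ?thesis using A0[of n s] by (simp add: pos_divide_le_eq del: of_nat_Suc)
    qed
    finally show "\<bar>T n s\<bar>\<^sup>2 \<le> (real (Suc n))\<^sup>2" .
  qed simp
  show "(\<lambda>n. T n s) \<longlonglongrightarrow> s" for s
  proof -
    have "(\<lambda>n. s * inverse (real (Suc n))) \<longlonglongrightarrow> s * 0"
      by (intro tendsto_mult_left LIMSEQ_inverse_real_of_nat)
    then have "(\<lambda>n. s / real (Suc n)) \<longlonglongrightarrow> 0" unfolding divide_inverse mult_zero_right .
    then have "(\<lambda>n. T n s) \<longlonglongrightarrow> s * (1 + 0\<^sup>2) powr (-1/2)"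
      unfolding T_def A_def by (intro tendsto_intros) simp_all
    then show ?thesis by simp
  qed
qed

text \<open>For the mean \<open>Y\<close> of the truncated p-th power, the moment estimate and the
  power mean inequality give lambda Y <= c Y^(1-1/p). Truncation makes \<open>Y\<close> finite, so a
  positive \<open>Y\<close> may be divided out. Fatou's lemma then removes the truncation.\<close>

lemma torsion_moment_le:
  fixes U :: "'a::euclidean_space set"
  assumes U: "open U" "0 < emeasure lborel U" and fin: "emeasure lborel U < \<infinity>"
    and v: "torsion_sol U v" and p: "p \<ge> 2"
  shows "(\<integral>\<^sup>+x. ennreal (\<bar>v x\<bar> powr p) \<partial>lborel)
    \<le> ennreal (measure lborel U * (p\<^sup>2 / (4 * (p - 1)) / lambda1 U) powr p)"
proof -
  have Us[measurable]: "U \<in> sets borel" using U(1) by simp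
  obtain a where "a \<in> U" using U(2) by fastforce
  then have l0: "lambda1 U > 0" by (rule lambda1_pos[OF U(1) _ fin])
  have m0: "measure lborel U > 0"
    using U(2) fin by (simp add: measure_def enn2real_positive_iff)
  define m where "m = measure lborel U"
  define c where "c = p\<^sup>2 / (4 * (p - 1))"
  have c0: "c > 0" using p by (simp add: c_def)
  obtain G where G: "H01 U v G"
    "\<And>f. test_fun U f \<Longrightarrow> (LBINT x. G x \<bullet> grad f x) = (LBINT x. f x)"
    using v torsion_solE by blast
  note [measurable] = L2_measurable[OF H01_L2(1)[OF G(1)]]
  obtain T :: "nat \<Rightarrow> real \<Rightarrow> real" where T: "\<And>n. smooth_fun (T n)" "\<And>n. T n 0 = 0" "\<And>n s. 0 \<le> deriv (T n) s"
    "\<And>n s. deriv (T n) s \<le> 1" "\<And>n s. \<bar>T n s\<bar> \<le> real (Suc n)" "\<And>s. (\<lambda>n. T n s) \<longlonglongrightarrow> s"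
    using truncations_exist by blast
  have [measurable]: "T n \<in> borel_measurable borel" for n
    by (auto intro!: borel_measurable_continuous_onI smooth_continuous T)
  have bnd: "(\<integral>\<^sup>+x. ennreal (indicator U x * \<bar>T n (v x)\<bar> powr p) \<partial>lborel) \<le> ennreal (m * (c / lambda1 U) powr p)" for n
  proof -
    have int: "integrable lborel (\<lambda>x. indicator U x * \<bar>T n (v x)\<bar> powr p)"
    proof (rule Bochner_Integration.integrable_bound)
      show "integrable lborel (\<lambda>x. real (Suc n) powr p * indicator U x)" using fin by simp
      show "AE x in lborel. norm (indicator U x * \<bar>T n (v x)\<bar> powr p) \<le> norm (real (Suc n) powr p * indicator U x)"
        using T(5)[of n] p by (intro always_eventually allI) (auto simp: indicator_def intro!: powr_mono2)
    qed simp
    define Y where "Y = (LBINT x. indicator U x * \<bar>T n (v x)\<bar> powr p) / m"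
    have Y0: "Y \<ge> 0" unfolding Y_def m_def by (intro divide_nonneg_nonneg integral_nonneg_AE) auto
    have "lambda1 U * Y \<le> c * ((LBINT x. indicator U x * \<bar>T n (v x)\<bar> powr (p - 1)) / m)"
      using divide_right_mono[OF truncated_moment_estimate[OF Us fin G T(1-5) p less_imp_le[OF l0]], of m] m0
      by (simp add: Y_def c_def m_def)
    also have "\<dots> \<le> c * Y powr ((p - 1) / p)"
      unfolding Y_def m_def using c0 p
      by (intro mult_left_mono power_mean(2)[OF Us fin m0 _ _ _ _ int]) auto
    finally have *: "lambda1 U * Y \<le> c * Y powr ((p - 1) / p)" .
    have "Y \<le> (c / lambda1 U) powr p"
    proof (cases "Y = 0")
      case False
      then have Y: "Y > 0" using Y0 by simp
      have "Y = Y powr (1 / p) * Y powr ((p - 1) / p)"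
        using Y p by (simp add: add_divide_distrib[symmetric] flip: powr_add)
      then have "(lambda1 U * Y powr (1 / p)) * Y powr ((p - 1) / p) \<le> c * Y powr ((p - 1) / p)"
        using * by (metis mult.assoc)
      then have "lambda1 U * Y powr (1 / p) \<le> c"
        using Y by (subst (asm) mult_le_cancel_right) auto
      then have "Y powr (1 / p) \<le> c / lambda1 U" using l0 by (simp add: field_simps)
      then have "(Y powr (1 / p)) powr p \<le> (c / lambda1 U) powr p" using p by (intro powr_mono2) auto
      then show ?thesis using Y p by (simp add: powr_powr)
    qed simp
    then have "(LBINT x. indicator U x * \<bar>T n (v x)\<bar> powr p) \<le> m * (c / lambda1 U) powr p"
      using m0 by (simp add: Y_def m_def field_simps)
    then show ?thesis
      by (subst nn_integral_eq_integral[OF int]) (auto intro!: ennreal_leI)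
  qed
  have "(\<integral>\<^sup>+x. ennreal (\<bar>v x\<bar> powr p) \<partial>lborel)
      = (\<integral>\<^sup>+x. liminf (\<lambda>n. ennreal (indicator U x * \<bar>T n (v x)\<bar> powr p)) \<partial>lborel)"
  proof (rule nn_integral_cong_AE)
    show "AE x in lborel. ennreal (\<bar>v x\<bar> powr p) = liminf (\<lambda>n. ennreal (indicator U x * \<bar>T n (v x)\<bar> powr p))"
      using H01_AE_zero[OF G(1)]
    proof eventually_elim
      case (elim x)
      have "(\<lambda>n. indicator U x * \<bar>T n (v x)\<bar> powr p) \<longlonglongrightarrow> indicator U x * \<bar>v x\<bar> powr p"
        using p by (intro tendsto_mult_left tendsto_powr' tendsto_rabs T(6) tendsto_const)
          (auto intro!: always_eventually)
      then have "(\<lambda>n. ennreal (indicator U x * \<bar>T n (v x)\<bar> powr p)) \<longlonglongrightarrow> ennreal (indicator U x * \<bar>v x\<bar> powr p)"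
        by (rule tendsto_ennrealI)
      also have "indicator U x * \<bar>v x\<bar> powr p = \<bar>v x\<bar> powr p" using elim by (auto simp: indicator_def)
      finally show ?case using lim_imp_Liminf[OF sequentially_bot] by metis
    qed
  qed
  also have "\<dots> \<le> liminf (\<lambda>n. \<integral>\<^sup>+x. ennreal (indicator U x * \<bar>T n (v x)\<bar> powr p) \<partial>lborel)"
    by (intro nn_integral_liminf) auto
  also have "\<dots> \<le> ennreal (m * (c / lambda1 U) powr p)"
    by (rule Liminf_le) (auto intro!: always_eventually bnd)
  finally show ?thesis by (simp add: m_def c_def)
qed

text \<open>Exponents of at least 2 are covered by the moment bound; smaller ones follow from
  exponent 2 on a set of finite measure, hence the exponent \<open>max 2 p\<close>.\<close>

lemma torsion_integrable_powr:
  fixes U :: "'a::euclidean_space set"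
  assumes U: "open U" "0 < emeasure lborel U" "emeasure lborel U < \<infinity>" and v: "torsion_sol U v" and p: "p \<ge> 1"
  shows "integrable lborel (\<lambda>x. indicator U x * \<bar>v x\<bar> powr p)"
    "(\<integral>\<^sup>+x. ennreal (\<bar>v x\<bar> powr p) \<partial>lborel) = ennreal (LBINT x. indicator U x * \<bar>v x\<bar> powr p)"
proof -
  have Us[measurable]: "U \<in> sets borel" using U(1) by simp
  obtain G where G: "H01 U v G" using v torsion_solE by blast
  note [measurable] = L2_measurable[OF H01_L2(1)[OF G(1)]]
  have e: "(\<integral>\<^sup>+x. ennreal (indicator U x * \<bar>v x\<bar> powr q) \<partial>lborel) = (\<integral>\<^sup>+x. ennreal (\<bar>v x\<bar> powr q) \<partial>lborel)" for q
    using H01_AE_zero[OF G(1)] by (intro nn_integral_cong_AE) (auto elim!: eventually_mono simp: indicator_def)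
  have i2: "integrable lborel (\<lambda>x. indicator U x * \<bar>v x\<bar> powr q)" if "q \<ge> 2" for q
    using torsion_moment_le[OF U v that] unfolding e[symmetric]
    by (intro integrableI_nonneg) (auto simp: order_le_less_trans)
  have "measure lborel U > 0" using U by (simp add: measure_def enn2real_positive_iff)
  from power_mean(1)[OF Us U(3) this _ _ _ _ i2[of "max 2 p"], of p]
  show i: "integrable lborel (\<lambda>x. indicator U x * \<bar>v x\<bar> powr p)" using p by simp
  show "(\<integral>\<^sup>+x. ennreal (\<bar>v x\<bar> powr p) \<partial>lborel) = ennreal (LBINT x. indicator U x * \<bar>v x\<bar> powr p)"
    unfolding e[symmetric] by (intro nn_integral_eq_integral i) auto
qed

section \<open>The functional F_p: formula, monotonicity in p and bounds\<close>

lemma F_fun_eq: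
  fixes U :: "'a::euclidean_space set"
  assumes U: "open U" "0 < emeasure lborel U" "emeasure lborel U < \<infinity>" and v: "torsion_sol U v" and p: "p \<ge> 1"
  shows "F_fun p U = lambda1 U * ((LBINT x. indicator U x * \<bar>v x\<bar> powr p) / measure lborel U) powr (1 / p)"
proof -
  have "(LBINT x. indicator U x * \<bar>v x\<bar> powr p) \<ge> 0" by (intro integral_nonneg_AE) auto
  then show ?thesis
    unfolding F_fun_def using torsion_Lp_eq[OF _ U(3) v, of p] U(1) torsion_integrable_powr(2)[OF U v p]
    by (simp add: Lp_norm_def powr_divide)
qed

lemma F_fun_mono:
  fixes U :: "'a::euclidean_space set"
  assumes U: "open U" "0 < emeasure lborel U" "emeasure lborel U < \<infinity>" and p: "1 \<le> p" "p \<le> q"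
  shows "F_fun p U \<le> F_fun q U"
proof -
  have Us[measurable]: "U \<in> sets borel" using U(1) by simp
  obtain v where v: "torsion_sol U v" using torsion_exists[OF Us U(3)] by blast
  obtain G where G: "H01 U v G" using v torsion_solE by blast
  note [measurable] = L2_measurable[OF H01_L2(1)[OF G(1)]]
  obtain a where a: "a \<in> U" using U(2) by fastforce
  have m0: "measure lborel U > 0" using U by (simp add: measure_def enn2real_positive_iff)
  let ?Y = "\<lambda>p. (LBINT x. indicator U x * \<bar>v x\<bar> powr p) / measure lborel U"
  have Y0: "?Y p \<ge> 0" "?Y q \<ge> 0" by (intro divide_nonneg_nonneg integral_nonneg_AE; simp)+
  have "?Y p \<le> ?Y q powr (p / q)"
    using p by (intro power_mean(2)[OF Us U(3) m0 _ _ _ _ torsion_integrable_powr(1)[OF U v]]) auto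
  then have "?Y p powr (1 / p) \<le> (?Y q powr (p / q)) powr (1 / p)"
    using p Y0 by (intro powr_mono2) auto
  then have "?Y p powr (1 / p) \<le> ?Y q powr (1 / q)" using p by (simp add: powr_powr)
  then show ?thesis
    using lambda1_pos[OF U(1) a U(3)] p F_fun_eq[OF U v] by (simp add: mult_left_mono)
qed

lemma F_fun_le:
  fixes U :: "'a::euclidean_space set"
  assumes U: "open U" "0 < emeasure lborel U" "emeasure lborel U < \<infinity>" and p: "p \<ge> 2"
  shows "F_fun p U \<le> p\<^sup>2 / (4 * (p - 1))"
proof -
  have Us[measurable]: "U \<in> sets borel" using U(1) by simp
  obtain v where v: "torsion_sol U v" using torsion_exists[OF Us U(3)] by blast
  obtain a where a: "a \<in> U" using U(2) by fastforce
  have l0: "lambda1 U > 0" by (rule lambda1_pos[OF U(1) a U(3)])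
  have m0: "measure lborel U > 0" using U by (simp add: measure_def enn2real_positive_iff)
  let ?I = "LBINT x. indicator U x * \<bar>v x\<bar> powr p"
  let ?c = "p\<^sup>2 / (4 * (p - 1))"
  have c0: "?c > 0" using p by simp
  have I0: "?I \<ge> 0" by (intro integral_nonneg_AE) auto
  have "ennreal ?I \<le> ennreal (measure lborel U * (?c / lambda1 U) powr p)"
    using torsion_moment_le[OF U v p] torsion_integrable_powr(2)[OF U v, of p] p by simp
  then have "?I \<le> measure lborel U * (?c / lambda1 U) powr p"
    by (subst (asm) ennreal_le_iff) (auto simp: m0 less_imp_le)
  then have "?I / measure lborel U \<le> (?c / lambda1 U) powr p" using m0 by (simp add: field_simps)
  then have "(?I / measure lborel U) powr (1 / p) \<le> ((?c / lambda1 U) powr p) powr (1 / p)"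
    using p I0 by (intro powr_mono2) auto
  also have "\<dots> = ?c / lambda1 U" using p c0 l0 by (simp add: powr_powr)
  finally show ?thesis
    using F_fun_eq[OF U v, of p] p l0 by (simp add: field_simps)
qed

text \<open>Combines a trial function for the torsion with a spectral lower bound; \<open>D\<close>
  may be any upper bound for the energy of the trial function.\<close>

lemma F_fun_1_ge:
  fixes U :: "'a::euclidean_space set"
  assumes U: "open U" "0 < emeasure lborel U" "emeasure lborel U < \<infinity>" and f: "test_fun U f"
    and l: "\<And>g. test_fun U g \<Longrightarrow> \<mu> * sqn g \<le> sqn (grad g)" "\<mu> \<ge> 0"
    and D: "sqn (grad f) \<le> D" "D > 0"
  shows "\<mu> * (LBINT x. f x)\<^sup>2 / (D * measure lborel U) \<le> F_fun 1 U"
proof -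
  have Us[measurable]: "U \<in> sets borel" using U(1) by simp
  obtain v where v: "torsion_sol U v" using torsion_exists[OF Us U(3)] by blast
  obtain G where G: "H01 U v G" using v torsion_solE by blast
  note [measurable] = L2_measurable[OF H01_L2(1)[OF G(1)]]
  obtain a where a: "a \<in> U" using U(2) by fastforce
  have l0: "lambda1 U > 0" by (rule lambda1_pos[OF U(1) a U(3)])
  have m0: "measure lborel U > 0" using U by (simp add: measure_def enn2real_positive_iff)
  let ?I = "LBINT x. indicator U x * \<bar>v x\<bar> powr 1"
  have I0: "?I \<ge> 0" by (intro integral_nonneg_AE) auto
  \<comment> \<open>\<open>F_fun\<close> involves the absolute value of \<open>v\<close>; the
    comparison with the plain integral goes in the direction needed, whatever the sign of
    \<open>v\<close>.\<close>
  have vI: "(LBINT x. v x) \<le> ?I"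
    unfolding H01_integral(2)[OF G Us U(3)]
    using torsion_integrable_powr(1)[OF U v, of 1] integrable_inner_L2[OF H01_L2(1)[OF G] L2_indicator(1)[OF Us U(3)]]
    by (intro integral_mono) (auto simp: indicator_def)
  have "(LBINT x. f x)\<^sup>2 \<le> sqn (grad f) * (LBINT x. v x)"
    by (rule torsion_integral_ge[OF Us U(3) v f])
  also have "\<dots> \<le> sqn (grad f) * ?I" by (intro mult_left_mono vI) simp
  also have "\<dots> \<le> D * ?I" by (intro mult_right_mono D I0)
  finally have "\<mu> * (LBINT x. f x)\<^sup>2 \<le> \<mu> * (D * ?I)" using l(2) by (intro mult_left_mono)
  also have "\<dots> \<le> lambda1 U * (D * ?I)"
    using D(2) I0 by (intro mult_right_mono lambda1_ge[OF U(1) a l(1)]) auto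
  finally have "\<mu> * (LBINT x. f x)\<^sup>2 / (D * measure lborel U) \<le> lambda1 U * (D * ?I) / (D * measure lborel U)"
    using D(2) m0 by (intro divide_right_mono) auto
  also have "\<dots> = lambda1 U * (?I / measure lborel U)" using D(2) by simp
  also have "\<dots> = F_fun 1 U" using F_fun_eq[OF U v, of 1] I0 m0 by simp
  finally show ?thesis .
qed

section \<open>Points have zero capacity\<close>

text \<open>Shrinking by \<open>s\<close> multiplies the Dirichlet energy by s^(m-2), which is at
  most 1 exactly because m >= 2. This is how the dimension makes points have zero capacity.\<close>

lemma sqn_grad_shrink:
  fixes g :: "'a::euclidean_space \<Rightarrow> real"
  assumes dim: "DIM('a) \<ge> 2" and g: "smooth_fun g" "L2 (grad g)" and s: "0 < s" "s \<le> 1"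
  shows "L2 (grad (\<lambda>x. g (t + (1 / s) *\<^sub>R x)))" "sqn (grad (\<lambda>x. g (t + (1 / s) *\<^sub>R x))) \<le> sqn (grad g)"
proof -
  have e: "grad (\<lambda>x. g (t + (1 / s) *\<^sub>R x)) = (\<lambda>x. (1 / s) *\<^sub>R grad g (t + (1 / s) *\<^sub>R x))"
    using grad_affine[OF g(1)] by (intro ext)
  show "L2 (grad (\<lambda>x. g (t + (1 / s) *\<^sub>R x)))"
    unfolding e using s by (intro L2_scaleR sqn_affine g) auto
  have "sqn (grad (\<lambda>x. g (t + (1 / s) *\<^sub>R x))) = (1 / s)\<^sup>2 * (sqn (grad g) / \<bar>1 / s\<bar> ^ DIM('a))"
    unfolding e using s by (subst sqn_scaleR, subst sqn_affine(2)[OF g(2)]) auto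
  also have "\<dots> \<le> sqn (grad g)"
  proof -
    have "(1 / s)\<^sup>2 \<le> \<bar>1 / s\<bar> ^ DIM('a)"
      using power_increasing[OF dim, of "1 / s"] s by simp
    then have "sqn (grad g) * (1 / s)\<^sup>2 \<le> sqn (grad g) * \<bar>1 / s\<bar> ^ DIM('a)"
      by (intro mult_left_mono) auto
    moreover have "\<bar>1 / s\<bar> ^ DIM('a) > 0" using s by simp
    ultimately show ?thesis by (simp add: pos_divide_le_eq mult.commute del: power_abs abs_divide)
  qed
  finally show "sqn (grad (\<lambda>x. g (t + (1 / s) *\<^sub>R x))) \<le> sqn (grad g)" .
qed

text \<open>The energy is halved by averaging \<open>g\<close> with a copy of itself shrunk into its own hole, since the two
  gradients have disjoint supports.\<close>

lemma capacity_halving: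
  fixes g :: "'a::euclidean_space \<Rightarrow> real"
  assumes dim: "DIM('a) \<ge> 2" and g: "smooth_fun g" "\<And>x. 0 \<le> g x" "\<And>x. g x \<le> 1"
    and \<rho>: "\<rho> > 0" "\<rho> \<le> 1" "\<And>x. norm x < \<rho> \<Longrightarrow> g x = 0" and one: "\<And>x. norm x \<ge> 1 \<Longrightarrow> g x = 1"
  shows "\<exists>(g' :: 'a \<Rightarrow> real) \<rho>'. smooth_fun g' \<and> (\<forall>x. 0 \<le> g' x \<and> g' x \<le> 1) \<and> 0 < \<rho>' \<and> \<rho>' \<le> 1 \<and>
    (\<forall>x. norm x < \<rho>' \<longrightarrow> g' x = 0) \<and> (\<forall>x. norm x \<ge> 1 \<longrightarrow> g' x = 1) \<and> sqn (grad g') \<le> sqn (grad g) / 2"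
proof -
  \<comment> \<open>Being smaller than \<open>\<rho>\<close>, this factor puts the gradient of the
    copy inside the ball where \<open>g\<close> vanishes.\<close>
  define s where "s = \<rho> / 2"
  have s: "0 < s" "s < \<rho>" "s < 1" using \<rho> by (auto simp: s_def)
  define gs where "gs x = g (0 + (1 / s) *\<^sub>R x)" for x
  have smgs: "smooth_fun gs" unfolding gs_def by (rule smooth_affine[OF g(1)])
  define g' where "g' x = 1/2 * (g x + gs x)" for x
  have gz: "grad g x = 0" if "norm x < \<rho>" for x
    using that \<rho>(3) by (intro grad_eq_0_on_open[of "ball 0 \<rho>" x g 0]) auto
  have g1: "grad g x = 0" if "norm x > 1" for x
    using that one by (intro grad_eq_0_on_open[of "- cball 0 1" x g 1]) auto
  have ggs: "grad gs x = (1 / s) *\<^sub>R grad g (0 + (1 / s) *\<^sub>R x)" for x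
    unfolding gs_def by (rule grad_affine[OF g(1)])
  have L: "L2 (grad g)"
    using g1 by (intro L2_compact_support[of _ "cball 0 1"] continuous_on_grad g(1)) auto
  have Lgs: "L2 (grad gs)" and Ds: "sqn (grad gs) \<le> sqn (grad g)"
    unfolding gs_def using sqn_grad_shrink[OF dim g(1) L s(1), of 0] s(3) by simp_all
  have disj: "grad g x \<bullet> grad gs x = 0" for x
  proof (cases "norm x < \<rho>")
    case False
    then have "norm ((1 / s) *\<^sub>R x) > 1" using s by (simp add: field_simps)
    then show ?thesis using g1 by (simp add: ggs)
  qed (simp add: gz)
  have "grad g' = (\<lambda>x. (1/2) *\<^sub>R (grad g x + grad gs x))"
    unfolding g'_def using grad_cmult[OF smooth_add[OF g(1) smgs]] grad_add[OF g(1) smgs] by (intro ext) (simp only:)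
  then have "sqn (grad g') = (1/2)\<^sup>2 * (sqn (grad g) + sqn (grad gs))"
    by (simp only: sqn_scaleR sqn_add[OF L Lgs] disj) simp
  then have D: "sqn (grad g') \<le> sqn (grad g) / 2"
    using Ds by (simp add: power2_eq_square)
  show ?thesis
  \<comment> \<open>The copy vanishes only in the ball of radius \<open>s * \<rho>\<close>, so each
    halving shrinks the hole.\<close>
  proof (intro exI[of _ g'] exI[of _ "s * \<rho>"] conjI allI impI)
    show "smooth_fun g'" unfolding g'_def by (intro smooth_mult smooth_add smooth_const g smgs)
    show "0 \<le> g' x" "g' x \<le> 1" for x
      using g(2)[of x] g(3)[of x] g(2)[of "0 + (1 / s) *\<^sub>R x"] g(3)[of "0 + (1 / s) *\<^sub>R x"] by (auto simp: g'_def gs_def)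
    show "0 < s * \<rho>" "s * \<rho> \<le> 1" using s \<rho> by (auto intro: mult_le_one)
    show "g' x = 0" if "norm x < s * \<rho>" for x
    proof -
      have "s * \<rho> \<le> \<rho>" using s(1,3) \<rho>(1) by (simp add: mult_left_le_one_le)
      then have "norm x < \<rho>" using that by linarith
      moreover have "norm (0 + (1 / s) *\<^sub>R x) < \<rho>" using that s by (simp add: field_simps)
      ultimately show ?thesis using \<rho>(3) by (simp add: g'_def gs_def)
    qed
    show "g' x = 1" if "norm x \<ge> 1" for x
    proof -
      have "norm (0 + (1 / s) *\<^sub>R x) \<ge> 1" using that s by (simp add: field_simps)
      then show ?thesis using one[OF that] one[of "0 + (1 / s) *\<^sub>R x"] by (simp add: g'_def gs_def)
    qed
    show "sqn (grad g') \<le> sqn (grad g) / 2" by (rule D)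
  qed
qed

text \<open>Iterating the halving from one fixed cut-off divides its energy by 2^n while the unit
  ball stays fixed.\<close>

lemma capacity_zero_unit:
  assumes dim: "DIM('a::euclidean_space) \<ge> 2" and e: "e > 0"
  shows "\<exists>(g :: 'a \<Rightarrow> real) \<rho>. smooth_fun g \<and> (\<forall>x. 0 \<le> g x \<and> g x \<le> 1) \<and> 0 < \<rho> \<and> \<rho> \<le> 1 \<and>
    (\<forall>x. norm x < \<rho> \<longrightarrow> g x = 0) \<and> (\<forall>x. norm x \<ge> 1 \<longrightarrow> g x = 1) \<and> sqn (grad g) \<le> e"
proof -
  obtain \<sigma> :: "real \<Rightarrow> real" where \<sigma>: "smooth_fun \<sigma>" "\<And>t. 0 \<le> \<sigma> t" "\<And>t. \<sigma> t \<le> 1"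
    "\<And>t. t \<le> 0 \<Longrightarrow> \<sigma> t = 0" "\<And>t. t \<ge> 1 \<Longrightarrow> \<sigma> t = 1" using smooth_step_exists by blast
  \<comment> \<open>The argument of the step is negative for |x| < 1/2 and at least 1 for |x| >= 1;
    the squared norm keeps it smooth at the origin.\<close>
  define \<zeta> :: "'a \<Rightarrow> real" where "\<zeta> x = \<sigma> (2 * (norm x)\<^sup>2 - 1)" for x
  define C where "C = sqn (grad \<zeta>)"
  have base: "smooth_fun \<zeta>"
    unfolding \<zeta>_def by (intro smooth_compose[OF \<sigma>(1)] smooth_diff smooth_mult smooth_const smooth_norm_sq)
  have z: "\<zeta> x = 0" if "norm x < 1/2" for x
  proof -
    have "(norm x)\<^sup>2 \<le> (1/2)\<^sup>2" using that by (intro power_mono) auto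
    then show ?thesis unfolding \<zeta>_def by (intro \<sigma>(4)) (simp add: power2_eq_square)
  qed
  have o: "\<zeta> x = 1" if "norm x \<ge> 1" for x
  proof -
    have "1\<^sup>2 \<le> (norm x)\<^sup>2" using that by (intro power_mono) auto
    then show ?thesis unfolding \<zeta>_def by (intro \<sigma>(5)) simp
  qed
  have "\<exists>(g :: 'a \<Rightarrow> real) \<rho>. smooth_fun g \<and> (\<forall>x. 0 \<le> g x \<and> g x \<le> 1) \<and> 0 < \<rho> \<and> \<rho> \<le> 1 \<and>
    (\<forall>x. norm x < \<rho> \<longrightarrow> g x = 0) \<and> (\<forall>x. norm x \<ge> 1 \<longrightarrow> g x = 1) \<and> sqn (grad g) \<le> C * (1/2) ^ n" for n
  proof (induction n)
    case 0
    have "0 \<le> \<zeta> x" "\<zeta> x \<le> 1" for x by (simp_all add: \<zeta>_def \<sigma>(2,3))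
    then show ?case using base z o
      by (intro exI[of _ \<zeta>] exI[of _ "1/2"]) (auto simp: C_def)
  next
    case (Suc n)
    then obtain g :: "'a \<Rightarrow> real" and \<rho> where g: "smooth_fun g" "\<And>x. 0 \<le> g x" "\<And>x. g x \<le> 1" "\<rho> > 0" "\<rho> \<le> 1"
      "\<And>x. norm x < \<rho> \<Longrightarrow> g x = 0" "\<And>x. norm x \<ge> 1 \<Longrightarrow> g x = 1" and D: "sqn (grad g) \<le> C * (1/2) ^ n" by blast
    have "sqn (grad g) / 2 \<le> C * (1/2) ^ Suc n" using D by simp
    then show ?case using capacity_halving[OF dim g] by (meson order_trans)
  qed
  note ex = this
  obtain n where n: "C * (1/2) ^ n \<le> e"
  proof -
    have "(\<lambda>n. C * (1/2) ^ n) \<longlonglongrightarrow> C * 0" by (intro tendsto_mult_left LIMSEQ_power_zero) simp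
    then have "\<forall>\<^sub>F n in sequentially. C * (1/2) ^ n < e" using e by (intro order_tendstoD(2)) auto
    then show ?thesis using that by (meson eventually_happens' less_imp_le sequentially_bot)
  qed
  show ?thesis using ex[of n] order_trans[OF _ n] by blast
qed

lemma capacity_zero:
  assumes dim: "DIM('a::euclidean_space) \<ge> 2" and e: "e > 0" and r: "r > 0"
  obtains g :: "'a::euclidean_space \<Rightarrow> real" and \<rho> where "smooth_fun g" "\<And>x. 0 \<le> g x" "\<And>x. g x \<le> 1" "\<rho> > 0"
    "\<And>x. norm (x - a) < \<rho> \<Longrightarrow> g x = 0" "\<And>x. norm (x - a) \<ge> r \<Longrightarrow> g x = 1" "L2 (grad g)" "sqn (grad g) \<le> e"
proof -
  obtain g :: "'a \<Rightarrow> real" and \<rho> where g: "smooth_fun g" "\<And>x. 0 \<le> g x" "\<And>x. g x \<le> 1" "\<rho> > 0" "\<rho> \<le> 1"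
      "\<And>x. norm x < \<rho> \<Longrightarrow> g x = 0" "\<And>x. norm x \<ge> 1 \<Longrightarrow> g x = 1" and D: "sqn (grad g) \<le> e"
    using capacity_zero_unit[OF dim e] by blast
  \<comment> \<open>The cap at 1 ensures a contraction, for which the energy does not
    increase.\<close>
  define s where "s = min r 1"
  have s: "0 < s" "s \<le> 1" "s \<le> r" using r by (auto simp: s_def)
  define t where "t = - (1 / s) *\<^sub>R a"
  have te: "t + (1 / s) *\<^sub>R x = (1 / s) *\<^sub>R (x - a)" for x by (simp add: t_def algebra_simps)
  define h where "h x = g (t + (1 / s) *\<^sub>R x)" for x
  have ns: "norm ((1 / s) *\<^sub>R y) = norm y / s" for y :: 'a using s by simp
  have g1: "grad g x = 0" if "norm x > 1" for x
    using that g(7) by (intro grad_eq_0_on_open[of "- cball 0 1" x g 1]) auto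
  have L: "L2 (grad g)"
    using g1 by (intro L2_compact_support[of _ "cball 0 1"] continuous_on_grad g(1)) auto
  show ?thesis
  proof (rule that[of h "s * \<rho>"])
    show "smooth_fun h" unfolding h_def by (rule smooth_affine[OF g(1)])
    show "0 \<le> h x" "h x \<le> 1" for x by (auto simp: h_def g)
    show "0 < s * \<rho>" using s g by simp
    show "h x = 0" if "norm (x - a) < s * \<rho>" for x
      unfolding h_def te
      by (rule g(6)) (unfold ns, use that s in \<open>simp add: pos_divide_less_eq mult.commute\<close>)
    show "h x = 1" if "norm (x - a) \<ge> r" for x
      unfolding h_def te
      by (rule g(7)) (unfold ns, use that s in \<open>simp add: pos_le_divide_eq\<close>)
    show "L2 (grad h)" "sqn (grad h) \<le> e"
      unfolding h_def using sqn_grad_shrink[OF dim g(1) L s(1,2), of t] D by simp_all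
  qed
qed

text \<open>The cross term costs at most 2 (e/4) by Cauchy-Schwarz, and the square of
  \<open>g\<close> costs e/2.\<close>

lemma sqn_add_small:
  assumes "L2 f" "L2 g" and e: "e > 0" and g: "sqn g \<le> e / 2" "sqn f * sqn g \<le> e\<^sup>2 / 16"
  shows "sqn (\<lambda>x. f x + g x) \<le> sqn f + e"
proof -
  have "\<bar>LBINT x. f x \<bullet> g x\<bar>\<^sup>2 \<le> (e / 4)\<^sup>2"
    using Cauchy_Schwarz_L2[OF assms(1,2)] g(2) by (simp add: power_divide)
  then have "\<bar>LBINT x. f x \<bullet> g x\<bar> \<le> e / 4" by (rule power2_le_imp_le) (use e in simp)
  then show ?thesis using sqn_add[OF assms(1,2)] g(1) by linarith
qed

text \<open>Multiply by a cut-off of small energy that vanishes near \<open>a\<close>. Mass is lost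
  only in a small ball, and the new gradient term is bounded by sup |f| times the gradient of the
  cut-off.\<close>

lemma remove_point:
  fixes f :: "'a::euclidean_space \<Rightarrow> real"
  assumes dim: "DIM('a) \<ge> 2" and f: "test_fun U f" and e: "e > 0"
  shows "\<exists>f'. test_fun (U - {a}) f' \<and> sqn f - e \<le> sqn f' \<and> sqn (grad f') \<le> sqn (grad f) + e"
proof -
  obtain K where K: "compact K" "K \<subseteq> U" "\<And>x. x \<notin> K \<Longrightarrow> f x = 0" using f test_funE by metis
  have "bounded (range f)"
  proof -
    have "bounded (f ` K)" by (intro compact_imp_bounded compact_continuous_image test_fun_continuous[OF f] K)
    moreover have "range f \<subseteq> insert 0 (f ` K)" using K(3) by auto
    ultimately show ?thesis by (meson bounded_insert bounded_subset)
  qed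
  then obtain B where B: "B > 0" "\<And>x. \<bar>f x\<bar> \<le> B" by (force simp: bounded_pos)
  define D where "D = sqn (grad f)"
  \<comment> \<open>The two entries are the two hypotheses of \<open>sqn_add_small\<close>;
    \<open>D + 1\<close> avoids division by 0.\<close>
  define \<beta> where "\<beta> = min (e / 2) (e\<^sup>2 / (16 * (D + 1)))"
  have D0: "D \<ge> 0" by (simp add: D_def)
  have \<beta>: "\<beta> > 0" "\<beta> \<le> e / 2" "D * \<beta> \<le> e\<^sup>2 / 16"
  proof -
    show "\<beta> > 0" using e D0 by (simp add: \<beta>_def)
    show "\<beta> \<le> e / 2" unfolding \<beta>_def by (rule min.cobounded1)
    have "D * \<beta> \<le> D * (e\<^sup>2 / (16 * (D + 1)))" using D0 by (intro mult_left_mono) (auto simp: \<beta>_def)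
    also have "\<dots> = e\<^sup>2 / 16 * (D / (D + 1))" by simp
    also have "\<dots> \<le> e\<^sup>2 / 16 * 1" using D0 by (intro mult_left_mono) auto
    finally show "D * \<beta> \<le> e\<^sup>2 / 16" by simp
  qed
  define w where "w = unit_ball_vol (real DIM('a))"
  have b: "w > 0" by (simp add: w_def unit_ball_vol_pos)
  \<comment> \<open>As \<open>r\<close> is at most 1, the volume of the ball is at most
    \<open>w * r\<close>, which makes the lost mass at most \<open>e\<close>.\<close>
  define r where "r = min 1 (e / (B\<^sup>2 * w))"
  have r: "r > 0" "r \<le> 1" using e B b by (auto simp: r_def)
  have vol: "B\<^sup>2 * measure lborel (cball a r) \<le> e"
  proof -
    have "measure lborel (cball a r) = w * r ^ DIM('a)" using r by (simp add: content_cball w_def)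
    also have "\<dots> \<le> w * r ^ 1"
      using r b by (intro mult_left_mono power_decreasing) (auto simp: Suc_leI)
    finally have "measure lborel (cball a r) \<le> w * r" by simp
    then have "B\<^sup>2 * measure lborel (cball a r) \<le> B\<^sup>2 * (w * r)" by (intro mult_left_mono) auto
    also have "\<dots> = (B\<^sup>2 * w) * r" by simp
    also have "\<dots> \<le> (B\<^sup>2 * w) * (e / (B\<^sup>2 * w))" using b B by (intro mult_left_mono) (auto simp: r_def)
    also have "\<dots> = e" using b B by simp
    finally show ?thesis .
  qed
  obtain g :: "'a \<Rightarrow> real" and \<rho> where g: "smooth_fun g" "\<And>x. 0 \<le> g x" "\<And>x. g x \<le> 1" "\<rho> > 0"
    "\<And>x. norm (x - a) < \<rho> \<Longrightarrow> g x = 0" "\<And>x. norm (x - a) \<ge> r \<Longrightarrow> g x = 1"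
    and Lg: "L2 (grad g)" "sqn (grad g) \<le> \<beta> / B\<^sup>2"
    using capacity_zero[OF dim _ r(1), of "\<beta> / B\<^sup>2" a] \<beta> B by auto
  define f' where "f' x = g x * f x" for x
  have f': "test_fun U f'" unfolding f'_def by (rule test_fun_mult[OF f g(1)])
  have "test_fun (U - {a}) f'"
  proof (rule test_funI[of _ "K - ball a \<rho>"])
    show "smooth_fun f'" by (rule test_fun_smooth[OF f'])
    show "compact (K - ball a \<rho>)" by (intro compact_diff K) auto
    show "K - ball a \<rho> \<subseteq> U - {a}" using K(2) g(4) by auto
    show "f' x = 0" if "x \<notin> K - ball a \<rho>" for x
      using that K(3)[of x] g(5)[of x] by (auto simp: f'_def dist_norm norm_minus_commute)
  qed
  moreover have "sqn f - e \<le> sqn f'"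
  proof -
    have "sqn f - sqn f' = (LBINT x. (norm (f x))\<^sup>2 - (norm (f' x))\<^sup>2)"
      unfolding sqn_def
      by (rule Bochner_Integration.integral_diff[symmetric]; rule L2_integrable[OF L2_test_fun]; rule f f')
    also have "\<dots> \<le> (LBINT x. B\<^sup>2 * indicator (cball a r) x)"
    proof (rule integral_mono)
      show "integrable lborel (\<lambda>x. (norm (f x))\<^sup>2 - (norm (f' x))\<^sup>2)"
        by (intro Bochner_Integration.integrable_diff; rule L2_integrable[OF L2_test_fun]; rule f f')
      show "integrable lborel (\<lambda>x. B\<^sup>2 * indicator (cball a r) x :: real)"
        using emeasure_lborel_cball_finite[of a r] by simp
      fix x
      show "(norm (f x))\<^sup>2 - (norm (f' x))\<^sup>2 \<le> B\<^sup>2 * indicator (cball a r) x"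
      proof (cases "norm (x - a) \<ge> r")
        case True
        then show ?thesis using g(6)[OF True] by (simp add: f'_def)
      next
        case False
        have "(norm (f x))\<^sup>2 \<le> B\<^sup>2" using B(2)[of x] by (intro power_mono) auto
        then have "(norm (f x))\<^sup>2 - (norm (f' x))\<^sup>2 \<le> B\<^sup>2"
          using zero_le_power2[of "norm (f' x)"] by linarith
        then show ?thesis using False by (simp add: dist_norm norm_minus_commute)
      qed
    qed
    also have "\<dots> = B\<^sup>2 * measure lborel (cball a r)" by simp
    finally show ?thesis using vol by linarith
  qed
  moreover have "sqn (grad f') \<le> sqn (grad f) + e"
  proof -
    have gr: "grad f' = (\<lambda>x. g x *\<^sub>R grad f x + f x *\<^sub>R grad g x)"
      unfolding f'_def using grad_mult[OF g(1) test_fun_smooth[OF f]] by (intro ext)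
    have [measurable]: "g \<in> borel_measurable borel" "f \<in> borel_measurable borel"
      by (auto intro!: borel_measurable_continuous_onI smooth_continuous g(1) test_fun_smooth[OF f])
    note [measurable] = L2_measurable[OF Lg(1)] L2_measurable[OF L2_grad_test_fun[OF f]]
    have n1: "norm (g x *\<^sub>R grad f x) \<le> norm (grad f x)" for x
      using mult_right_mono[OF g(3)[of x], of "norm (grad f x)"] g(2)[of x] by simp
    have n2: "norm (f x *\<^sub>R grad g x) \<le> norm (B *\<^sub>R grad g x)" for x
      using mult_right_mono[OF B(2)[of x], of "norm (grad g x)"] B(1) by simp
    have L1: "L2 (\<lambda>x. g x *\<^sub>R grad f x)" by (rule L2_bound[OF L2_grad_test_fun[OF f] _ n1]) simp
    have L2': "L2 (\<lambda>x. f x *\<^sub>R grad g x)" by (rule L2_bound[OF L2_scaleR[OF Lg(1)] _ n2]) simp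
    have s1: "sqn (\<lambda>x. g x *\<^sub>R grad f x) \<le> D"
      unfolding D_def sqn_def
      by (intro integral_mono L2_integrable L1 L2_grad_test_fun[OF f] power_mono n1) auto
    have "sqn (\<lambda>x. f x *\<^sub>R grad g x) \<le> sqn (\<lambda>x. B *\<^sub>R grad g x)"
      unfolding sqn_def by (intro integral_mono L2_integrable L2' L2_scaleR Lg(1) power_mono n2) auto
    also have "\<dots> = B\<^sup>2 * sqn (grad g)" by (rule sqn_scaleR)
    also have "\<dots> \<le> \<beta>" using Lg(2) B(1) by (simp add: field_simps)
    finally have s2: "sqn (\<lambda>x. f x *\<^sub>R grad g x) \<le> \<beta>" .
    have "sqn (\<lambda>x. g x *\<^sub>R grad f x) * sqn (\<lambda>x. f x *\<^sub>R grad g x) \<le> D * \<beta>"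
      using s1 s2 D0 by (intro mult_mono) auto
    then have "sqn (grad f') \<le> sqn (\<lambda>x. g x *\<^sub>R grad f x) + e"
      unfolding gr using \<beta> s2 by (intro sqn_add_small[OF L1 L2' e]) auto
    then show ?thesis using s1 by (simp add: D_def)
  qed
  ultimately show ?thesis by blast
qed

text \<open>Half of the tolerance goes to the new point and half to the others, so \<open>e\<close>
  varies in the induction.\<close>

lemma remove_finite:
  fixes f :: "'a::euclidean_space \<Rightarrow> real"
  assumes dim: "DIM('a) \<ge> 2" and "finite P" and f: "test_fun U f" and e: "e > 0"
  shows "\<exists>f'. test_fun (U - P) f' \<and> sqn f - e \<le> sqn f' \<and> sqn (grad f') \<le> sqn (grad f) + e"
  using assms(2) e
proof (induction P arbitrary: e)
  case empty
  then show ?case using f by (intro exI[of _ f]) auto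
next
  case (insert a P)
  obtain f1 where f1: "test_fun (U - P) f1" "sqn f - e / 2 \<le> sqn f1" "sqn (grad f1) \<le> sqn (grad f) + e / 2"
    using insert.IH[of "e / 2"] insert.prems by auto
  obtain f2 where f2: "test_fun (U - P - {a}) f2" "sqn f1 - e / 2 \<le> sqn f2" "sqn (grad f2) \<le> sqn (grad f1) + e / 2"
    using remove_point[OF dim f1(1), of "e / 2" a] insert.prems by auto
  have "U - P - {a} = U - insert a P" by auto
  then show ?case using f1 f2 by (intro exI[of _ f2]) auto
qed

section \<open>Lattices of holes\<close>

text \<open>The zeros of \<open>lattice_fun\<close> are the integer lattice points, so its superlevel sets are periodically
  perforated.\<close>

definition lattice_fun :: "'a::euclidean_space \<Rightarrow> real" where
  "lattice_fun x = (\<Sum>b\<in>Basis. (sin ((x \<bullet> b) * pi))\<^sup>2)"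

definition perforated :: "real \<Rightarrow> 'a::euclidean_space set" where
  "perforated \<delta> = {x. \<delta> < lattice_fun x}"

lemma continuous_lattice_fun: "continuous_on S lattice_fun"
  unfolding lattice_fun_def by (intro continuous_intros)

lemma lattice_fun_nonneg: "0 \<le> lattice_fun x"
  unfolding lattice_fun_def by (intro sum_nonneg) simp

lemma lattice_fun_eq_0_iff: "lattice_fun x = 0 \<longleftrightarrow> (\<forall>b\<in>Basis. x \<bullet> b \<in> \<int>)"
  unfolding lattice_fun_def by (subst sum_nonneg_eq_0_iff) (auto simp: sin_times_pi_eq_0)

lemma lattice_fun_periodic:
  assumes "\<And>b. b \<in> Basis \<Longrightarrow> l \<bullet> b \<in> \<int>"
  shows "lattice_fun (x + l) = lattice_fun x"
  unfolding lattice_fun_def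
proof (rule sum.cong)
  fix b :: 'a assume "b \<in> Basis"
  then have s: "sin ((l \<bullet> b) * pi) = 0" using assms by (simp add: sin_times_pi_eq_0)
  then have "(cos ((l \<bullet> b) * pi))\<^sup>2 = 1" using sin_cos_squared_add[of "(l \<bullet> b) * pi"] by simp
  then show "(sin (((x + l) \<bullet> b) * pi))\<^sup>2 = (sin ((x \<bullet> b) * pi))\<^sup>2"
    by (simp add: inner_add_left distrib_right sin_add s power_mult_distrib)
qed simp

lemma open_perforated: "open (perforated \<delta>)"
  unfolding perforated_def by (intro open_Collect_less continuous_lattice_fun continuous_on_const)

lemma finite_lattice_points:
  "finite {x::'a::euclidean_space. norm x \<le> R \<and> (\<forall>b\<in>Basis. x \<bullet> b \<in> \<int>)}"
proof (rule finite_subset)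
  let ?n = "\<lceil>R\<rceil>"
  show "finite ((\<lambda>f. \<Sum>b\<in>Basis. real_of_int (f b) *\<^sub>R b) ` (PiE (Basis::'a set) (\<lambda>_. {-?n..?n})))"
    by (intro finite_imageI finite_PiE) auto
  show "{x::'a. norm x \<le> R \<and> (\<forall>b\<in>Basis. x \<bullet> b \<in> \<int>)}
      \<subseteq> (\<lambda>f. \<Sum>b\<in>Basis. real_of_int (f b) *\<^sub>R b) ` (PiE (Basis::'a set) (\<lambda>_. {-?n..?n}))"
  proof
    fix x :: 'a assume "x \<in> {x. norm x \<le> R \<and> (\<forall>b\<in>Basis. x \<bullet> b \<in> \<int>)}"
    then have x: "norm x \<le> R" "\<And>b. b \<in> Basis \<Longrightarrow> x \<bullet> b \<in> \<int>" by auto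
    let ?f = "restrict (\<lambda>b. \<lfloor>x \<bullet> b\<rfloor>) Basis"
    have fl: "real_of_int \<lfloor>x \<bullet> b\<rfloor> = x \<bullet> b" if "b \<in> Basis" for b using x(2)[OF that] by (auto elim: Ints_cases)
    have "?f b \<in> {-?n..?n}" if b: "b \<in> Basis" for b
    proof -
      have "\<bar>x \<bullet> b\<bar> \<le> R" using Basis_le_norm[OF b, of x] x(1) by linarith
      then have "\<bar>real_of_int \<lfloor>x \<bullet> b\<rfloor>\<bar> \<le> real_of_int ?n" unfolding fl[OF b] by linarith
      then show ?thesis using b by simp linarith
    qed
    then have "?f \<in> PiE Basis (\<lambda>_. {-?n..?n})" by auto
    moreover have "(\<Sum>b\<in>Basis. (x \<bullet> b) *\<^sub>R b) = (\<Sum>b\<in>Basis. real_of_int (?f b) *\<^sub>R b)"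
      by (intro sum.cong) (simp_all add: fl)
    then have "x = (\<Sum>b\<in>Basis. real_of_int (?f b) *\<^sub>R b)" by (simp only: euclidean_representation)
    ultimately show "x \<in> (\<lambda>f. \<Sum>b\<in>Basis. real_of_int (f b) *\<^sub>R b) ` (PiE Basis (\<lambda>_. {-?n..?n}))" by blast
  qed
qed

text \<open>A bump stretched to radius R has Rayleigh quotient of order 1/R^2. Removing the finitely
  many lattice points in its ball changes little. The new support is compact and free of lattice
  points, so \<open>lattice_fun\<close> has a positive minimum on it; that minimum determines the
  size of the holes.\<close>

lemma perforated_small_rayleigh:
  assumes dim: "DIM('a::euclidean_space) \<ge> 2" and e: "e > 0"
  obtains \<delta> and f :: "'a::euclidean_space \<Rightarrow> real" where "\<delta> > 0" "test_fun (perforated \<delta>) f" "sqn f > 0" "sqn (grad f) \<le> e * sqn f"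
proof -
  let ?g = "bump (0::'a) 1"
  have tg: "test_fun (cball 0 1) ?g" by (rule test_fun_bump) auto
  define s0 where "s0 = sqn ?g"
  define D0 where "D0 = sqn (grad ?g)"
  have s0: "s0 > 0"
    unfolding s0_def using sqn_test_fun_pos[OF tg, of 0] bump_pos[of 1 0 "0::'a"] by simp
  have D0: "D0 \<ge> 0" by (simp add: D0_def)
  \<comment> \<open>Chosen so that D0 / (s0 R^2) is at most e/4; the 1 makes \<open>R\<close>
    positive.\<close>
  define R where "R = sqrt (4 * (D0 + 1) / (e * s0))"
  have R: "R > 0" "R\<^sup>2 = 4 * (D0 + 1) / (e * s0)" using e s0 D0 by (auto simp: R_def)
  define f where "f x = ?g (0 + (1 / R) *\<^sub>R x)" for x
  have tf: "test_fun (cball 0 R) f"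
  proof (rule test_funI[of _ "cball 0 R"])
    show "smooth_fun f" unfolding f_def by (rule smooth_affine[OF smooth_bump])
    show "f x = 0" if "x \<notin> cball 0 R" for x
      unfolding f_def using that R by (intro bump_eq_0) (auto simp: field_simps)
  qed auto
  have gf: "grad f x = (1 / R) *\<^sub>R grad ?g (0 + (1 / R) *\<^sub>R x)" for x
    unfolding f_def by (rule grad_affine[OF smooth_bump])
  define V where "V = sqn f"
  have V: "V = s0 / \<bar>1 / R\<bar> ^ DIM('a)"
    unfolding V_def f_def s0_def using R by (subst sqn_affine(2)[OF L2_test_fun[OF tg]]) auto
  have V0: "V > 0" unfolding V using s0 R by simp
  have "sqn (grad f) = (1 / R)\<^sup>2 * (D0 / \<bar>1 / R\<bar> ^ DIM('a))"
    unfolding gf[abs_def] D0_def using R by (subst sqn_scaleR, subst sqn_affine(2)[OF L2_grad_test_fun[OF tg]]) auto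
  also have "\<dots> = D0 / (s0 * R\<^sup>2) * V" unfolding V using s0 by (simp add: power_divide)
  also have "\<dots> \<le> e / 4 * V"
  proof (rule mult_right_mono)
    have "s0 * R\<^sup>2 = 4 * (D0 + 1) / e" using s0 by (simp add: R(2))
    then have "D0 / (s0 * R\<^sup>2) = e / 4 * (D0 / (D0 + 1))" by simp
    also have "\<dots> \<le> e / 4 * 1" using e D0 by (intro mult_left_mono) auto
    finally show "D0 / (s0 * R\<^sup>2) \<le> e / 4" by simp
  qed (use V0 in simp)
  finally have Df: "sqn (grad f) \<le> e / 4 * V" .
  define P where "P = {x::'a. norm x \<le> R \<and> (\<forall>b\<in>Basis. x \<bullet> b \<in> \<int>)}"
  \<comment> \<open>At most half of the mass is lost and the energy grows to at most (e/2) V, so the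
    final quotient is at most \<open>e\<close>.\<close>
  define e' where "e' = min (V / 2) (e / 4 * V)"
  have e': "e' > 0" using V0 e by (simp add: e'_def)
  have "finite P" unfolding P_def by (rule finite_lattice_points)
  from remove_finite[OF dim this tf e'] obtain f' where f': "test_fun (cball 0 R - P) f'"
    "sqn f - e' \<le> sqn f'" "sqn (grad f') \<le> sqn (grad f) + e'" by blast
  have V': "sqn f' \<ge> V / 2" using f'(2) by (simp add: e'_def V_def[symmetric] min_def split: if_splits)
  have "sqn (grad f') \<le> e / 2 * V"
    using f'(3) Df by (simp add: e'_def min_def split: if_splits)
  also have "\<dots> \<le> e * sqn f'" using V' e by simp
  finally have D': "sqn (grad f') \<le> e * sqn f'" .
  obtain K where K: "compact K" "K \<subseteq> cball 0 R - P" "\<And>x. x \<notin> K \<Longrightarrow> f' x = 0" using f'(1) test_funE by metis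
  have "K \<noteq> {}"
  proof
    assume "K = {}"
    then have "f' = (\<lambda>_. 0)" using K(3) by auto
    then show False using V' V0 by (simp add: sqn_def)
  qed
  then obtain x0 where x0: "x0 \<in> K" "\<And>x. x \<in> K \<Longrightarrow> lattice_fun x0 \<le> lattice_fun x"
    using continuous_attains_inf[OF K(1) _ continuous_lattice_fun] by blast
  have "x0 \<notin> P" "norm x0 \<le> R" using x0(1) K(2) by auto
  then have "lattice_fun x0 \<noteq> 0" unfolding lattice_fun_eq_0_iff P_def by auto
  then have q0: "lattice_fun x0 > 0" using lattice_fun_nonneg[of x0] by linarith
  \<comment> \<open>Half of the minimum gives the strict inequality in
    \<open>perforated\<close>.\<close>
  have "test_fun (perforated (lattice_fun x0 / 2)) f'"
    using q0 x0(2) K by (intro test_funI[OF test_fun_smooth[OF f'(1)], of K]) (force simp: perforated_def)+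
  then show ?thesis using that[of "lattice_fun x0 / 2" f'] q0 D' V' V0 by auto
qed

text \<open>Periodicity puts a hole of fixed radius within bounded distance of every point, so the
  zero set is seen with uniformly positive measure from everywhere.\<close>

lemma perforated_poincare:
  assumes \<delta>: "\<delta> > 0"
  obtains c where "c > 0" "\<And>f::'a::euclidean_space \<Rightarrow> real. test_fun (perforated \<delta>) f \<Longrightarrow> c * sqn f \<le> sqn (grad f)"
proof -
  let ?Z = "- perforated \<delta> :: 'a set"
  have "open {x::'a. lattice_fun x < \<delta>}" by (intro open_Collect_less continuous_lattice_fun continuous_on_const)
  moreover have "(0::'a) \<in> {x. lattice_fun x < \<delta>}" using \<delta> by (simp add: lattice_fun_def)
  ultimately obtain \<rho> where \<rho>: "\<rho> > 0" "ball 0 \<rho> \<subseteq> {x::'a. lattice_fun x < \<delta>}"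
    by (rule openE)
  define R where "R = real DIM('a) + \<rho>"
  define v where "v = measure lborel (ball (0::'a) \<rho>)"
  have v: "v > 0" using \<rho> by (simp add: v_def content_ball unit_ball_vol_pos)
  have ev: "emeasure lborel (ball y \<rho>) = ennreal v" for y :: 'a
    using \<rho> by (simp add: v_def emeasure_ball content_ball)
  have big: "ennreal v \<le> emeasure lborel {h \<in> cball 0 R. x + h \<in> ?Z}" for x
  proof -
    \<comment> \<open>Rounding down the coordinates gives a lattice point at distance at most
      \<open>DIM('a)\<close>, whence the radius \<open>R\<close>.\<close>
    define l :: 'a where "l = (\<Sum>b\<in>Basis. real_of_int \<lfloor>x \<bullet> b\<rfloor> *\<^sub>R b)"
    have lb: "l \<bullet> b = real_of_int \<lfloor>x \<bullet> b\<rfloor>" if "b \<in> Basis" for b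
      using that by (simp add: l_def)
    have "norm (l - x) \<le> (\<Sum>b\<in>Basis. \<bar>(l - x) \<bullet> b\<bar>)" by (rule norm_le_l1)
    also have "\<dots> \<le> (\<Sum>b\<in>(Basis::'a set). 1)"
      by (intro sum_mono) (simp add: inner_diff_left lb, linarith)
    finally have n: "norm (l - x) \<le> real DIM('a)" by simp
    have "ball (l - x) \<rho> \<subseteq> {h \<in> cball 0 R. x + h \<in> ?Z}"
    proof
      fix h assume h: "h \<in> ball (l - x) \<rho>"
      then have "norm (h - (l - x)) < \<rho>" by (simp add: dist_norm norm_minus_commute)
      then have "norm h \<le> R" using norm_triangle_ineq[of "h - (l - x)" "l - x"] n by (simp add: R_def)
      moreover have "x + h - l \<in> ball 0 \<rho>" using h by (simp add: dist_norm algebra_simps norm_minus_commute)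
      then have "lattice_fun (x + h - l) < \<delta>" using \<rho> by blast
      then have "lattice_fun (x + h) < \<delta>"
        using lattice_fun_periodic[of l "x + h - l"] lb by simp
      ultimately show "h \<in> {h \<in> cball 0 R. x + h \<in> ?Z}" by (simp add: perforated_def)
    qed
    moreover have "{h \<in> cball 0 R. x + h \<in> ?Z} \<in> sets lborel"
    proof -
      have *: "{h \<in> cball 0 R. x + h \<in> Z} \<in> sets lborel" if [measurable]: "Z \<in> sets borel" for Z
        by simp
      show ?thesis by (rule *[OF borel_comp[OF borel_open[OF open_perforated]]])
    qed
    ultimately show ?thesis unfolding ev[of "l - x", symmetric] by (rule emeasure_mono)
  qed
  let ?C = "measure lborel (cball (0::'a) R) * R\<^sup>2"
  have R0: "R > 0" using \<rho> by (simp add: R_def add_nonneg_pos)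
  have C: "?C > 0" using R0 by (simp add: content_cball unit_ball_vol_pos)
  show ?thesis
  proof (rule that[of "v / ?C"])
    show "v / ?C > 0" using v C by simp
    fix f :: "'a \<Rightarrow> real" assume f: "test_fun (perforated \<delta>) f"
    have "v * sqn f \<le> ?C * sqn (grad f)"
      by (rule poincare_zero_set[OF f borel_comp[OF borel_open[OF open_perforated]] _ _ _ big])
        (use v R0 in \<open>auto intro!: test_fun_outside[OF f]\<close>)
    then show "v / ?C * sqn f \<le> sqn (grad f)" using C by (simp add: field_simps)
  qed
qed

section \<open>The lower bound\<close>

lemma emeasure_unit_box: "emeasure lborel (box 0 One :: 'a::euclidean_space set) = 1"
  by (subst emeasure_lborel_box) auto

lemma norm_unit_box: "h \<in> box 0 One \<Longrightarrow> (norm h)\<^sup>2 \<le> real DIM('a)" for h :: "'a::euclidean_space"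
proof -
  assume h: "h \<in> box 0 One"
  have "(norm h)\<^sup>2 = (\<Sum>b\<in>Basis. (h \<bullet> b)\<^sup>2)"
    unfolding power2_norm_eq_inner by (subst euclidean_inner) (simp add: power2_eq_square)
  also have "\<dots> \<le> (\<Sum>b\<in>(Basis::'a set). 1)"
  proof (rule sum_mono)
    fix b :: 'a assume "b \<in> Basis"
    then have "0 < h \<bullet> b" "h \<bullet> b < 1" using h by (auto simp: mem_box)
    then show "(h \<bullet> b)\<^sup>2 \<le> 1" by (simp add: power_le_one)
  qed
  finally show ?thesis by simp
qed

text \<open>Expanding the squared increment bounds the correlation of \<open>f\<close> with its
  translate by \<open>h\<close> from below, uniformly over the unit cube. After integration over
  \<open>h\<close> and exchange of the integrals, the mean of \<open>f\<close> over the cube at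
  \<open>x\<close> is at most 1 and only the integral of \<open>f\<close> remains.\<close>

lemma cube_average:
  fixes f :: "'a::euclidean_space \<Rightarrow> real"
  assumes f: "test_fun U f" and nn: "\<And>x. f x \<ge> 0"
    and cell: "\<And>x. (\<integral>\<^sup>+h. indicator (box 0 One) h * ennreal ((f (x + h))\<^sup>2) \<partial>lborel) \<le> 1"
  shows "sqn f - real DIM('a) / 2 * sqn (grad f) \<le> (LBINT x. f x)"
proof -
  let ?Q = "box 0 One :: 'a set"
  have L: "L2 f" by (rule L2_test_fun[OF f])
  note [measurable] = L2_measurable[OF L]
  have [measurable]: "?Q \<in> sets borel" by simp
  define B where "B = sqn f - real DIM('a) / 2 * sqn (grad f)"
  have shift: "B \<le> (LBINT x. f (x + h) * f x)" if h: "h \<in> ?Q" for h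
  proof -
    have "sqn (\<lambda>x. f (x + h) - f x) \<le> (norm h)\<^sup>2 * sqn (grad f)" by (rule sqn_translate_diff_le[OF f])
    also have "\<dots> \<le> real DIM('a) * sqn (grad f)" by (intro mult_right_mono norm_unit_box h) simp
    finally show ?thesis
      using sqn_diff[OF sqn_translate(1)[OF L] L, of h] sqn_translate(2)[OF L, of h] by (simp add: B_def)
  qed
  have inner: "(\<integral>\<^sup>+h. indicator ?Q h * ennreal (f (x + h)) \<partial>lborel) \<le> 1" for x
  proof -
    have "(\<integral>\<^sup>+h. indicator ?Q h * ennreal (f (x + h)) \<partial>lborel)
        \<le> (\<integral>\<^sup>+h. ennreal (1/2) * indicator ?Q h + ennreal (1/2) * (indicator ?Q h * ennreal ((f (x + h))\<^sup>2)) \<partial>lborel)"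
    proof (rule nn_integral_mono)
      fix h :: 'a
      \<comment> \<open>t <= (1 + t^2)/2 turns the bound on the mean square over a cube into a bound
        on the mean.\<close>
      have "f (x + h) \<le> 1/2 + 1/2 * (f (x + h))\<^sup>2"
        using zero_le_power2[of "f (x + h) - 1"] by (simp add: power2_eq_square algebra_simps)
      then have "ennreal (f (x + h)) \<le> ennreal (1/2 + 1/2 * (f (x + h))\<^sup>2)" by (rule ennreal_leI)
      also have "\<dots> = ennreal (1/2) + ennreal (1/2 * (f (x + h))\<^sup>2)" by (rule ennreal_plus) auto
      also have "ennreal (1/2 * (f (x + h))\<^sup>2) = ennreal (1/2) * ennreal ((f (x + h))\<^sup>2)"
        by (rule ennreal_mult) auto
      finally have "ennreal (f (x + h)) \<le> ennreal (1/2) + ennreal (1/2) * ennreal ((f (x + h))\<^sup>2)" .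
      then show "indicator ?Q h * ennreal (f (x + h))
          \<le> ennreal (1/2) * indicator ?Q h + ennreal (1/2) * (indicator ?Q h * ennreal ((f (x + h))\<^sup>2))"
        by (auto simp: indicator_def)
    qed
    also have "\<dots> = ennreal (1/2) * emeasure lborel ?Q
        + ennreal (1/2) * (\<integral>\<^sup>+h. indicator ?Q h * ennreal ((f (x + h))\<^sup>2) \<partial>lborel)"
      by (subst nn_integral_add; simp add: nn_integral_cmult)
    also have "\<dots> \<le> ennreal (1/2) * 1 + ennreal (1/2) * 1"
      unfolding emeasure_unit_box by (intro add_mono mult_left_mono cell) auto
    also have "\<dots> = ennreal (1/2 + 1/2)" by (subst ennreal_plus) (auto simp only: mult_1_right)
    also have "\<dots> = 1" by simp
    finally show ?thesis .
  qed
  \<comment> \<open>A negative \<open>B\<close> is clipped to 0 here, which is harmless as the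
    integral of \<open>f\<close> is nonnegative.\<close>
  have "ennreal B = (\<integral>\<^sup>+h. ennreal B * indicator ?Q h \<partial>lborel)"
    by (subst nn_integral_cmult_indicator) (auto simp: emeasure_unit_box)
  also have "\<dots> \<le> (\<integral>\<^sup>+h. (\<integral>\<^sup>+x. indicator ?Q h * ennreal (f (x + h) * f x) \<partial>lborel) \<partial>lborel)"
  proof (rule nn_integral_mono)
    fix h :: 'a
    have i: "integrable lborel (\<lambda>x. f (x + h) * f x)"
      using integrable_inner_L2[OF sqn_translate(1)[OF L] L, of h] by simp
    show "ennreal B * indicator ?Q h \<le> (\<integral>\<^sup>+x. indicator ?Q h * ennreal (f (x + h) * f x) \<partial>lborel)"
    proof (cases "h \<in> ?Q")
      case True
      then show ?thesis
        using shift[OF True] nn by (simp add: nn_integral_eq_integral[OF i] ennreal_leI)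
    qed simp
  qed
  also have "\<dots> = (\<integral>\<^sup>+x. (\<integral>\<^sup>+h. indicator ?Q h * ennreal (f (x + h) * f x) \<partial>lborel) \<partial>lborel)"
    by (intro lborel_pair.Fubini') simp
  also have "\<dots> \<le> (\<integral>\<^sup>+x. ennreal (f x) \<partial>lborel)"
  proof (rule nn_integral_mono)
    fix x :: 'a
    have "(\<integral>\<^sup>+h. indicator ?Q h * ennreal (f (x + h) * f x) \<partial>lborel)
        = (\<integral>\<^sup>+h. ennreal (f x) * (indicator ?Q h * ennreal (f (x + h))) \<partial>lborel)"
      using nn by (intro nn_integral_cong) (simp add: ennreal_mult mult_ac)
    also have "\<dots> = ennreal (f x) * (\<integral>\<^sup>+h. indicator ?Q h * ennreal (f (x + h)) \<partial>lborel)"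
      by (rule nn_integral_cmult) simp
    also have "\<dots> \<le> ennreal (f x) * 1" by (intro mult_left_mono inner) simp
    finally show "(\<integral>\<^sup>+h. indicator ?Q h * ennreal (f (x + h) * f x) \<partial>lborel) \<le> ennreal (f x)" by simp
  qed
  also have "\<dots> = ennreal (LBINT x. f x)"
    using nn integrable_test_fun[OF f] by (intro nn_integral_eq_integral) auto
  finally have "ennreal B \<le> ennreal (LBINT x. f x)" .
  moreover have "(LBINT x. f x) \<ge> 0" using nn by (intro integral_nonneg_AE) auto
  ultimately show ?thesis by (simp add: B_def)
qed

text \<open>Multi-indices are functions on the basis, so that boxes of lattice points are
  \<open>PiE\<close> sets with a known cardinality.\<close>

definition lattice_vec :: "('a \<Rightarrow> nat) \<Rightarrow> 'a::euclidean_space" where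
  "lattice_vec i = (\<Sum>b\<in>Basis. real (i b) *\<^sub>R b)"

lemma lattice_vec_inner: "b \<in> Basis \<Longrightarrow> lattice_vec i \<bullet> b = real (i b)"
  by (simp add: lattice_vec_def)

text \<open>Moving each translate back to the origin moves the unit cube instead. Open unit cubes at
  distinct lattice points are disjoint, so their integrals add up to at most the whole.\<close>

lemma cell_sum_le:
  fixes \<phi> :: "'a::euclidean_space \<Rightarrow> real"
  assumes [measurable]: "\<phi> \<in> borel_measurable borel" and I: "finite I" "I \<subseteq> PiE Basis T"
  shows "(\<integral>\<^sup>+h. indicator (box 0 One) h * ennreal (\<Sum>i\<in>I. (\<phi> (x + h - lattice_vec i))\<^sup>2) \<partial>lborel)
    \<le> (\<integral>\<^sup>+y. ennreal ((\<phi> y)\<^sup>2) \<partial>lborel)"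
proof -
  let ?Q = "box 0 One :: 'a set"
  have [measurable]: "?Q \<in> sets borel" by simp
  have "(\<integral>\<^sup>+h. indicator ?Q h * ennreal (\<Sum>i\<in>I. (\<phi> (x + h - lattice_vec i))\<^sup>2) \<partial>lborel)
      = (\<integral>\<^sup>+h. (\<Sum>i\<in>I. indicator ?Q h * ennreal ((\<phi> (x + h - lattice_vec i))\<^sup>2)) \<partial>lborel)"
    by (simp add: sum_distrib_left flip: sum_ennreal)
  also have "\<dots> = (\<Sum>i\<in>I. \<integral>\<^sup>+h. indicator ?Q h * ennreal ((\<phi> (x + h - lattice_vec i))\<^sup>2) \<partial>lborel)"
    by (intro nn_integral_sum) simp
  also have "\<dots> = (\<Sum>i\<in>I. \<integral>\<^sup>+y. indicator ?Q (y - (x - lattice_vec i)) * ennreal ((\<phi> y)\<^sup>2) \<partial>lborel)"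
  proof (rule sum.cong)
    fix i
    show "(\<integral>\<^sup>+h. indicator ?Q h * ennreal ((\<phi> (x + h - lattice_vec i))\<^sup>2) \<partial>lborel)
        = (\<integral>\<^sup>+y. indicator ?Q (y - (x - lattice_vec i)) * ennreal ((\<phi> y)\<^sup>2) \<partial>lborel)"
      by (subst nn_integral_lborel_translate[of _ "x - lattice_vec i", symmetric])
        (auto intro!: nn_integral_cong simp: algebra_simps)
  qed simp
  also have "\<dots> = (\<integral>\<^sup>+y. (\<Sum>i\<in>I. indicator ?Q (y - (x - lattice_vec i)) * ennreal ((\<phi> y)\<^sup>2)) \<partial>lborel)"
    by (intro nn_integral_sum[symmetric]) simp
  also have "\<dots> \<le> (\<integral>\<^sup>+y. ennreal ((\<phi> y)\<^sup>2) \<partial>lborel)"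
  proof (rule nn_integral_mono)
    fix y :: 'a
    show "(\<Sum>i\<in>I. indicator ?Q (y - (x - lattice_vec i)) * ennreal ((\<phi> y)\<^sup>2)) \<le> ennreal ((\<phi> y)\<^sup>2)"
    proof (cases "\<exists>j\<in>I. y - (x - lattice_vec j) \<in> ?Q")
      case False
      then have "(\<Sum>i\<in>I. indicator ?Q (y - (x - lattice_vec i)) * ennreal ((\<phi> y)\<^sup>2)) = 0"
        by (intro sum.neutral) auto
      then show ?thesis by simp
    next
      case True
      then obtain j where j: "j \<in> I" "y - (x - lattice_vec j) \<in> ?Q" by blast
      \<comment> \<open>Two integers that move the same real number into the open unit interval are
        equal; extensionality of \<open>PiE\<close> then identifies the indices.\<close>
      have uniq: "i = j" if i: "i \<in> I" "y - (x - lattice_vec i) \<in> ?Q" for i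
      proof (rule PiE_ext)
        show "i \<in> PiE Basis T" "j \<in> PiE Basis T" using i(1) j(1) I(2) by auto
        fix b :: 'a assume b: "b \<in> Basis"
        have "0 < (y - x) \<bullet> b + real (i b)" "(y - x) \<bullet> b + real (i b) < 1"
          "0 < (y - x) \<bullet> b + real (j b)" "(y - x) \<bullet> b + real (j b) < 1"
          using i(2) j(2) b lattice_vec_inner[OF b] by (auto simp: mem_box algebra_simps inner_diff_left inner_add_left)
        then show "i b = j b" by linarith
      qed
      have "(\<Sum>i\<in>I. indicator ?Q (y - (x - lattice_vec i)) * ennreal ((\<phi> y)\<^sup>2))
          = (\<Sum>i\<in>I. if i = j then ennreal ((\<phi> y)\<^sup>2) else 0)"
      proof (rule sum.cong)
        fix i assume i: "i \<in> I"
        show "indicator ?Q (y - (x - lattice_vec i)) * ennreal ((\<phi> y)\<^sup>2) = (if i = j then ennreal ((\<phi> y)\<^sup>2) else 0)"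
        proof (cases "i = j")
          case True
          show ?thesis unfolding True indicator_simps(1)[OF j(2)] by simp
        next
          case False
          then have "y - (x - lattice_vec i) \<notin> ?Q" using uniq[OF i] by blast
          then show ?thesis unfolding indicator_simps(2)[OF \<open>y - (x - lattice_vec i) \<notin> ?Q\<close>]
            using False by simp
        qed
      qed simp
      then show ?thesis using I(1) j(1) by simp
    qed
  qed
  finally show ?thesis .
qed

text \<open>A substitute for the square root that is smooth at 0 and vanishes there. With q = sqrt(s
  + e^2), its square is s + 2e^2 - 2eq, and e <= q <= sqrt s + e gives both bounds.\<close>

lemma sqrt_shift_bounds:
  fixes s e :: real
  assumes "s \<ge> 0" "e > 0"
  defines "\<psi> \<equiv> (s + e\<^sup>2) powr (1/2) - e"
  shows "\<psi> \<ge> 0" "\<psi>\<^sup>2 \<le> s" "s - 2 * e * sqrt s \<le> \<psi>\<^sup>2" "s = 0 \<Longrightarrow> \<psi> = 0"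
proof -
  define q where "q = sqrt (s + e\<^sup>2)"
  have q: "\<psi> = q - e" unfolding \<psi>_def q_def using assms by (subst powr_half_sqrt) auto
  have q2: "q\<^sup>2 = s + e\<^sup>2" unfolding q_def using assms by simp
  have qe: "q \<ge> e" unfolding q_def using assms by (intro real_le_rsqrt) simp
  have "q \<le> sqrt s + e" unfolding q_def using sqrt_add_le_add_sqrt[of s "e\<^sup>2"] assms by simp
  then have qu: "e * q \<le> e * (sqrt s + e)" using assms by (intro mult_left_mono) auto
  have ql: "e * e \<le> e * q" using assms qe by (intro mult_left_mono) auto
  have sq: "\<psi>\<^sup>2 = s + 2 * (e * e) - 2 * (e * q)"
    unfolding q using q2 by (simp add: power2_eq_square algebra_simps)
  show "\<psi> \<ge> 0" using q qe by simp
  show "\<psi>\<^sup>2 \<le> s" using sq ql by linarith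
  show "s - 2 * e * sqrt s \<le> \<psi>\<^sup>2" using sq qu by (simp add: algebra_simps)
  show "s = 0 \<Longrightarrow> \<psi> = 0" unfolding q using q_def assms by simp
qed

text \<open>The gradient is the sum of f_i D f_i divided by the regularised root, so Cauchy-Schwarz
  over the index set absorbs the divisor.\<close>

lemma norm_grad_sqrt_sum_le:
  fixes f :: "'i \<Rightarrow> 'a::euclidean_space \<Rightarrow> real"
  assumes sm: "\<And>i. i \<in> I \<Longrightarrow> smooth_fun (f i)" and e: "e > 0"
  shows "(norm (grad (\<lambda>x. ((\<Sum>i\<in>I. (f i x)\<^sup>2) + e\<^sup>2) powr (1/2) - e) x))\<^sup>2 \<le> (\<Sum>i\<in>I. (norm (grad (f i) x))\<^sup>2)"
proof -
  define S where "S y = (\<Sum>i\<in>I. (f i y)\<^sup>2)" for y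
  have S0: "S y \<ge> 0" for y by (simp add: S_def sum_nonneg)
  have smS: "smooth_fun S" unfolding S_def by (intro smooth_sum smooth_power sm)
  define p where "p = S x + e\<^sup>2"
  have p: "p > 0" using S0[of x] e by (simp add: p_def add_nonneg_pos)
  define v where "v = (\<Sum>i\<in>I. f i x *\<^sub>R grad (f i) x)"
  have "grad S x = (\<Sum>i\<in>I. grad (\<lambda>y. (f i y)\<^sup>2) x)"
    unfolding S_def by (intro grad_sum smooth_power sm)
  also have "\<dots> = (\<Sum>i\<in>I. 2 *\<^sub>R (f i x *\<^sub>R grad (f i) x))"
    using grad_mult[OF sm sm] by (intro sum.cong) (simp_all add: power2_eq_square flip: scaleR_add_left)
  finally have gS: "grad S x = 2 *\<^sub>R v" unfolding v_def by (simp only: scaleR_sum_right)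
  have "((\<lambda>s. (s + e\<^sup>2) powr (1/2) - e) has_real_derivative 1/2 * p powr (1/2 - 1) * 1 - 0) (at (S x))"
    using p unfolding p_def
    by (intro DERIV_diff DERIV_const DERIV_chain2[OF has_real_derivative_powr])
      (auto intro!: derivative_eq_intros)
  from grad_compose[OF this smS]
  have g: "grad (\<lambda>x. (S x + e\<^sup>2) powr (1/2) - e) x = p powr (1/2 - 1) *\<^sub>R v" by (simp add: gS)
  have "(norm v)\<^sup>2 \<le> (\<Sum>i\<in>I. \<bar>f i x\<bar> * norm (grad (f i) x))\<^sup>2"
    unfolding v_def by (intro power_mono order_trans[OF norm_sum]) auto
  also have "\<dots> \<le> (\<Sum>i\<in>I. \<bar>f i x\<bar>\<^sup>2) * (\<Sum>i\<in>I. (norm (grad (f i) x))\<^sup>2)"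
    by (rule Cauchy_Schwarz_ineq_sum)
  also have "\<dots> \<le> p * (\<Sum>i\<in>I. (norm (grad (f i) x))\<^sup>2)"
    by (intro mult_right_mono sum_nonneg) (auto simp: p_def S_def)
  finally have nv: "(norm v)\<^sup>2 \<le> p * (\<Sum>i\<in>I. (norm (grad (f i) x))\<^sup>2)" .
  have "(p powr (1/2 - 1))\<^sup>2 = p powr (- 1)"
    by (simp add: power2_eq_square flip: powr_add)
  also have "\<dots> = 1 / p" using p by (simp add: powr_minus inverse_eq_divide)
  finally have "(norm (p powr (1/2 - 1) *\<^sub>R v))\<^sup>2 = 1 / p * (norm v)\<^sup>2"
    by (simp only: norm_scaleR power_mult_distrib power2_abs)
  also have "\<dots> \<le> (\<Sum>i\<in>I. (norm (grad (f i) x))\<^sup>2)"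
    using nv p by (simp add: field_simps)
  finally show ?thesis using g unfolding S_def by (simp only:)
qed

lemma open_emeasure_pos:
  fixes U :: "'a::euclidean_space set"
  assumes "open U" "a \<in> U"
  shows "0 < emeasure lborel U"
proof -
  obtain r where r: "r > 0" "ball a r \<subseteq> U" using assms openE by blast
  have "0 < emeasure lborel (ball a r)" using r(1) by (simp add: emeasure_ball unit_ball_vol_pos)
  also have "\<dots> \<le> emeasure lborel U" using r(2) assms(1) by (intro emeasure_mono) auto
  finally show ?thesis .
qed

text \<open>The three factors measure near-optimality of \<open>\<phi>\<close>, closeness of the
  periodised trial function to a constant, and the volume lost to the margin of the box.\<close>

lemma perforated_box_F1:
  fixes \<phi> :: "'a::euclidean_space \<Rightarrow> real"
  assumes \<phi>: "test_fun (perforated \<delta>) \<phi>" "sqn \<phi> = 1" and R: "\<And>x. \<phi> x \<noteq> 0 \<Longrightarrow> norm x \<le> r" "r \<ge> 0" "r < R"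
    and \<mu>: "\<And>f::'a \<Rightarrow> real. test_fun (perforated \<delta>) f \<Longrightarrow> \<mu> * sqn f \<le> sqn (grad f)" "\<mu> \<ge> 0"
    and D: "D = sqn (grad \<phi>)" "D > 0" and \<eta>: "\<eta> > 0" "0 \<le> 1 - \<eta> - real DIM('a) / 2 * D" and N: "N > 0"
  shows "\<exists>U::'a set. open U \<and> 0 < emeasure lborel U \<and> emeasure lborel U < \<infinity> \<and>
    \<mu> / D * (1 - \<eta> - real DIM('a) / 2 * D)\<^sup>2 * (real N / (real N + 2 * R)) ^ DIM('a) \<le> F_fun 1 U"
proof -
  define I where "I = PiE (Basis::'a set) (\<lambda>_. {0..<N})"
  define n where "n = real N ^ DIM('a)"
  have I: "finite I" unfolding I_def by (intro finite_PiE) auto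
  have cI: "real (card I) = n" unfolding I_def n_def by (subst card_PiE) auto
  have n1: "n \<ge> 1" unfolding n_def using N by simp
  \<comment> \<open>The factor 1 puts the translate into the form of the affine lemmas.\<close>
  define \<psi> where "\<psi> i x = \<phi> (- lattice_vec i + 1 *\<^sub>R x)" for i x
  have sm\<psi>: "smooth_fun (\<psi> i)" for i unfolding \<psi>_def by (rule smooth_affine[OF test_fun_smooth[OF \<phi>(1)]])
  have L\<psi>: "L2 (\<psi> i)" and s\<psi>: "sqn (\<psi> i) = 1" for i
    unfolding \<psi>_def using sqn_affine[OF L2_test_fun[OF \<phi>(1)], of 1 "- lattice_vec i"] \<phi>(2) by auto
  have g\<psi>: "grad (\<psi> i) = (\<lambda>x. grad \<phi> (- lattice_vec i + 1 *\<^sub>R x))" for i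
    unfolding \<psi>_def using grad_affine[OF test_fun_smooth[OF \<phi>(1)], of "- lattice_vec i" 1] by (intro ext) simp
  have Lg\<psi>: "L2 (grad (\<psi> i))" and sg\<psi>: "sqn (grad (\<psi> i)) = D" for i
    unfolding g\<psi> using sqn_affine[OF L2_grad_test_fun[OF \<phi>(1)], of 1 "- lattice_vec i"] D(1) by auto
  obtain K0 where K0: "compact K0" "K0 \<subseteq> perforated \<delta>" "\<And>x. x \<notin> K0 \<Longrightarrow> \<phi> x = 0" using \<phi>(1) test_funE by metis
  define K where "K = K0 \<inter> cball 0 r"
  have K: "compact K" "K \<subseteq> perforated \<delta>" "\<And>x. x \<notin> K \<Longrightarrow> \<phi> x = 0"
    using K0 R(1) by (auto simp: K_def intro: compact_Int)
  \<comment> \<open>The margin \<open>R\<close>, larger than the support radius \<open>r\<close>,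
    leaves room for all translates.\<close>
  define U where "U = perforated \<delta> \<inter> box ((- R) *\<^sub>R One) ((real N + R) *\<^sub>R One :: 'a)"
  have openU: "open U" unfolding U_def by (intro open_Int open_perforated open_box)
  define K' where "K' = (\<Union>i\<in>I. (+) (lattice_vec i) ` K)"
  have cK': "compact K'" unfolding K'_def by (intro compact_UN I compact_translation K)
  have K'U: "K' \<subseteq> U"
  proof
    fix x assume "x \<in> K'"
    then obtain i k where i: "i \<in> I" and k: "k \<in> K" and x: "x = lattice_vec i + k" by (auto simp: K'_def)
    have "lattice_fun x = lattice_fun k"
      unfolding x add.commute[of "lattice_vec i"] by (intro lattice_fun_periodic) (simp add: lattice_vec_inner)
    then have "x \<in> perforated \<delta>" using k K(2) by (auto simp: perforated_def)
    moreover have "- R < x \<bullet> b \<and> x \<bullet> b < real N + R" if b: "b \<in> Basis" for b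
    proof -
      have "\<bar>k \<bullet> b\<bar> \<le> r" using Basis_le_norm[OF b, of k] k by (auto simp: K_def)
      moreover have "0 \<le> real (i b)" "real (i b) < real N" using i b by (auto simp: I_def)
      ultimately show ?thesis using R(2,3)
        unfolding x inner_add_left lattice_vec_inner[OF b] by linarith
    qed
    ultimately show "x \<in> U" by (auto simp: U_def mem_box)
  qed
  have \<psi>0: "\<psi> i x = 0" if "i \<in> I" "x \<notin> K'" for i x
  proof -
    have "- lattice_vec i + 1 *\<^sub>R x \<notin> K" using that by (force simp: K'_def)
    then show ?thesis unfolding \<psi>_def by (rule K(3))
  qed
  define S where "S x = (\<Sum>i\<in>I. (\<psi> i x)\<^sup>2)" for x
  have S0: "S x \<ge> 0" for x by (simp add: S_def sum_nonneg)
  have smS: "smooth_fun S" unfolding S_def by (intro smooth_sum smooth_power sm\<psi>)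
  have SK: "S x = 0" if "x \<notin> K'" for x unfolding S_def using \<psi>0[OF _ that] by simp
  have intS: "integrable lborel S"
    by (rule integrable_compact_support[OF smooth_continuous[OF smS] cK' SK])
  have i\<psi>: "integrable lborel (\<lambda>x. (\<psi> i x)\<^sup>2)" "(LBINT x. (\<psi> i x)\<^sup>2) = 1" for i
    using L2_integrable[OF L\<psi>[of i]] s\<psi>[of i] by (simp_all add: sqn_def)
  have iS: "(LBINT x. S x) = n"
    unfolding S_def using i\<psi> cI by (subst Bochner_Integration.integral_sum) auto
  have intsq: "integrable lborel (\<lambda>x. sqrt (S x))"
    by (rule integrable_compact_support[OF _ cK'])
      (auto intro!: continuous_intros smooth_continuous[OF smS] simp: SK)
  define c where "c = (LBINT x. sqrt (S x))"
  have c0: "c \<ge> 0" unfolding c_def using S0 by (intro integral_nonneg_AE) auto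
  \<comment> \<open>Replacing the root by its smooth substitute costs at most
    \<open>2 * e * c\<close> of mass, which is thus at most \<open>\<eta>\<close>; the added 2
    covers \<open>c = 0\<close>.\<close>
  define e where "e = \<eta> / (2 * c + 2)"
  have e0: "e > 0" using \<eta> c0 by (simp add: e_def)
  have ec: "2 * e * c \<le> \<eta>"
  proof -
    have "2 * e * c = \<eta> * (2 * c / (2 * c + 2))" by (simp add: e_def)
    also have "\<dots> \<le> \<eta> * 1" using \<eta> c0 by (intro mult_left_mono) auto
    finally show ?thesis by simp
  qed
  define \<Psi> where "\<Psi> x = (S x + e\<^sup>2) powr (1/2) - e" for x
  have \<Psi>b: "\<Psi> x \<ge> 0" "(\<Psi> x)\<^sup>2 \<le> S x" "S x - 2 * e * sqrt (S x) \<le> (\<Psi> x)\<^sup>2" "S x = 0 \<Longrightarrow> \<Psi> x = 0" for x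
    unfolding \<Psi>_def using sqrt_shift_bounds[OF S0[of x] e0] by auto
  have t\<Psi>: "test_fun U \<Psi>"
  proof (rule test_funI[OF _ cK' K'U])
    have "S x + e\<^sup>2 > 0" for x using S0[of x] e0 by (simp add: add_nonneg_pos)
    then show "smooth_fun \<Psi>"
      unfolding \<Psi>_def by (intro smooth_diff smooth_powr smooth_add smS smooth_const)
    show "\<Psi> x = 0" if "x \<notin> K'" for x using \<Psi>b(4) SK[OF that] by simp
  qed
  have DD: "sqn (grad \<Psi>) \<le> n * D"
  proof -
    have "sqn (grad \<Psi>) \<le> (LBINT x. (\<Sum>i\<in>I. (norm (grad (\<psi> i) x))\<^sup>2))"
      unfolding sqn_def
    proof (rule integral_mono)
      show "integrable lborel (\<lambda>x. (norm (grad \<Psi> x))\<^sup>2)" by (rule L2_integrable[OF L2_grad_test_fun[OF t\<Psi>]])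
      show "integrable lborel (\<lambda>x. \<Sum>i\<in>I. (norm (grad (\<psi> i) x))\<^sup>2)"
        by (intro Bochner_Integration.integrable_sum L2_integrable Lg\<psi>)
      show "(norm (grad \<Psi> x))\<^sup>2 \<le> (\<Sum>i\<in>I. (norm (grad (\<psi> i) x))\<^sup>2)" for x
        unfolding \<Psi>_def S_def by (rule norm_grad_sqrt_sum_le[OF sm\<psi> e0])
    qed
    also have "\<dots> = (\<Sum>i\<in>I. sqn (grad (\<psi> i)))"
      unfolding sqn_def by (intro Bochner_Integration.integral_sum L2_integrable Lg\<psi>)
    also have "\<dots> = n * D" using cI by (simp add: sg\<psi>)
    finally show ?thesis .
  qed
  have "(LBINT x. S x - 2 * e * sqrt (S x)) \<le> sqn \<Psi>"
    unfolding sqn_def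
    using L2_integrable[OF L2_test_fun[OF t\<Psi>]] intS intsq \<Psi>b(3) by (intro integral_mono) auto
  moreover have "(LBINT x. S x - 2 * e * sqrt (S x)) = n - 2 * e * c"
    using intS intsq by (simp add: iS c_def)
  ultimately have s\<Psi>: "n - \<eta> \<le> sqn \<Psi>" using ec by linarith
  have cell: "(\<integral>\<^sup>+h. indicator (box 0 One) h * ennreal ((\<Psi> (x + h))\<^sup>2) \<partial>lborel) \<le> 1" for x
  proof -
    have [measurable]: "\<phi> \<in> borel_measurable borel" by (rule L2_measurable[OF L2_test_fun[OF \<phi>(1)]])
    have "(\<integral>\<^sup>+h. indicator (box 0 One) h * ennreal ((\<Psi> (x + h))\<^sup>2) \<partial>lborel)
        \<le> (\<integral>\<^sup>+h. indicator (box 0 One) h * ennreal (\<Sum>i\<in>I. (\<phi> (x + h - lattice_vec i))\<^sup>2) \<partial>lborel)"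
    proof (intro nn_integral_mono mult_left_mono ennreal_leI)
      show "(\<Psi> (x + h))\<^sup>2 \<le> (\<Sum>i\<in>I. (\<phi> (x + h - lattice_vec i))\<^sup>2)" for h
        using \<Psi>b(2)[of "x + h"] by (simp add: S_def \<psi>_def algebra_simps)
    qed simp
    also have "\<dots> \<le> (\<integral>\<^sup>+y. ennreal ((\<phi> y)\<^sup>2) \<partial>lborel)"
      by (rule cell_sum_le[OF _ I, of _ "\<lambda>_. {0..<N}"]) (auto simp: I_def)
    also have "\<dots> = 1" using nn_integral_sq[OF L2_test_fun[OF \<phi>(1)]] \<phi>(2) by simp
    finally show ?thesis .
  qed
  define q where "q = 1 - \<eta> - real DIM('a) / 2 * D"
  have int\<Psi>: "n * q \<le> (LBINT x. \<Psi> x)"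
  proof -
    have "real DIM('a) / 2 * sqn (grad \<Psi>) \<le> real DIM('a) / 2 * (n * D)" by (intro mult_left_mono DD) simp
    moreover have "\<eta> \<le> n * \<eta>" using n1 \<eta>(1) by simp
    moreover have "n * q = n - n * \<eta> - real DIM('a) / 2 * (n * D)" by (simp add: q_def algebra_simps)
    ultimately show ?thesis using cube_average[OF t\<Psi> \<Psi>b(1) cell] s\<Psi> by linarith
  qed
  have boxm: "emeasure lborel (box ((- R) *\<^sub>R One) ((real N + R) *\<^sub>R One :: 'a)) = ennreal ((real N + 2 * R) ^ DIM('a))"
    using R(2,3) by (subst emeasure_lborel_box) (auto simp: algebra_simps)
  have "emeasure lborel U \<le> emeasure lborel (box ((- R) *\<^sub>R One) ((real N + R) *\<^sub>R One :: 'a))"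
    unfolding U_def by (intro emeasure_mono) auto
  then have mU: "emeasure lborel U \<le> ennreal ((real N + 2 * R) ^ DIM('a))" by (simp only: boxm)
  then have finU: "emeasure lborel U < \<infinity>" by (simp add: order_le_less_trans)
  have mU': "measure lborel U \<le> (real N + 2 * R) ^ DIM('a)"
    unfolding measure_def using mU R(2,3) by (intro enn2real_leI) auto
  \<comment> \<open>In an empty \<open>U\<close> the sum \<open>S\<close> would vanish, but its
    integral is the number of translates.\<close>
  have "\<exists>a. a \<in> U"
  proof (rule ccontr)
    assume "\<not> ?thesis"
    then have "S x = 0" for x using SK K'U by blast
    then show False using iS n1 by simp
  qed
  then have posU: "0 < emeasure lborel U" using open_emeasure_pos[OF openU] by blast
  have mpos: "measure lborel U > 0" using posU finU by (simp add: measure_def enn2real_positive_iff)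
  have NR: "real N + 2 * R > 0" using R(2,3) by simp
  have "\<mu> / D * q\<^sup>2 * (real N / (real N + 2 * R)) ^ DIM('a) = \<mu> * (n * q)\<^sup>2 / (n * D * (real N + 2 * R) ^ DIM('a))"
    using n1 D(2) NR by (simp add: n_def power_divide power2_eq_square field_simps)
  also have "\<dots> \<le> \<mu> * (LBINT x. \<Psi> x)\<^sup>2 / (n * D * measure lborel U)"
  proof (intro frac_le mult_left_mono power_mono int\<Psi> mU')
    show "0 \<le> \<mu> * (LBINT x. \<Psi> x)\<^sup>2" using \<mu>(2) by simp
    show "0 \<le> n * q" using n1 \<eta>(2) by (simp add: q_def)
    show "0 < n * D * measure lborel U" using n1 D(2) mpos by simp
  qed (use \<mu>(2) n1 D(2) in auto)
  also have "\<dots> \<le> F_fun 1 U"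
  proof (rule F_fun_1_ge[OF openU posU finU t\<Psi> _ \<mu>(2) DD])
    show "\<mu> * sqn g \<le> sqn (grad g)" if "test_fun U g" for g
      by (rule \<mu>(1)[OF test_fun_mono[OF that]]) (auto simp: U_def)
    show "0 < n * D" using n1 D(2) by simp
  qed
  finally show ?thesis using openU posU finU unfolding q_def by blast
qed

text \<open>An arbitrary upper bound \<open>X\<close> lets the result serve \<open>F_sup\<close> at
  every exponent through monotonicity. The order of limits matters: \<eta> fixes the holes and the
  near-minimiser, then N tends to infinity, and only then \<eta> tends to 0.\<close>

lemma F_fun_1_sup_ge:
  fixes X :: real
  assumes dim: "DIM('a::euclidean_space) \<ge> 2"
    and X: "\<And>U::'a set. open U \<Longrightarrow> 0 < emeasure lborel U \<Longrightarrow> emeasure lborel U < \<infinity> \<Longrightarrow> F_fun 1 U \<le> X"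
  shows "1 \<le> X"
proof -
  let ?m = "real DIM('a)"
  have m: "?m \<ge> 2" using dim by simp
  \<comment> \<open>The denominator comes from a minimiser that is optimal up to the factor 1 +
    \<eta>; one \<eta> in the numerator is the smoothing loss, the other bounds the increment
    term.\<close>
  have step: "(1 - 2 * \<eta>)\<^sup>2 / (1 + \<eta>) \<le> X" if \<eta>: "0 < \<eta>" "\<eta> \<le> 1/4" for \<eta>
  proof -
    obtain \<delta> and f :: "'a \<Rightarrow> real" where \<delta>: "\<delta> > 0" and f: "test_fun (perforated \<delta>) f" "sqn f > 0"
      "sqn (grad f) \<le> \<eta> / ?m * sqn f"
      using perforated_small_rayleigh[OF dim, of "\<eta> / ?m"] \<eta> m by auto
    obtain c where c: "c > 0" "\<And>f::'a \<Rightarrow> real. test_fun (perforated \<delta>) f \<Longrightarrow> c * sqn f \<le> sqn (grad f)"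
      using perforated_poincare[OF \<delta>] by blast
    define A where "A = {sqn (grad f) / sqn f | f::'a \<Rightarrow> real. test_fun (perforated \<delta>) f \<and> sqn f > 0}"
    have fA: "sqn (grad f) / sqn f \<in> A" using f by (auto simp: A_def)
    have lbA: "c \<le> y" if "y \<in> A" for y using that c(2) by (auto simp: A_def pos_le_divide_eq)
    define \<mu> where "\<mu> = Inf A"
    have bddA: "bdd_below A" using lbA by (rule bdd_belowI)
    have \<mu>c: "\<mu> \<ge> c" unfolding \<mu>_def using fA lbA by (intro cInf_greatest) auto
    then have \<mu>0: "\<mu> > 0" using c(1) by linarith
    have \<mu>e: "\<mu> \<le> \<eta> / ?m"
    proof -
      have "\<mu> \<le> sqn (grad f) / sqn f" unfolding \<mu>_def by (rule cInf_lower[OF fA bddA])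
      also have "\<dots> \<le> \<eta> / ?m" using f by (simp add: pos_divide_le_eq)
      finally show ?thesis .
    qed
    have \<mu>l: "\<mu> * sqn g \<le> sqn (grad g)" if "test_fun (perforated \<delta>) g" for g :: "'a \<Rightarrow> real"
    proof (cases "sqn g = 0")
      case False
      then have pos: "sqn g > 0" using sqn_nonneg[of g] by linarith
      have "\<mu> \<le> sqn (grad g) / sqn g"
        unfolding \<mu>_def using that pos by (intro cInf_lower bddA) (auto simp: A_def)
      then show ?thesis using pos by (simp add: pos_le_divide_eq)
    qed simp
    \<comment> \<open>Positivity of \<mu>, from the Poincare inequality for the holes, makes a
      relative error meaningful.\<close>
    have "Inf A < (1 + \<eta>) * \<mu>" using \<mu>0 \<eta> by (simp add: \<mu>_def[symmetric] algebra_simps)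
    then obtain y where "y \<in> A" "y < (1 + \<eta>) * \<mu>" using cInf_lessD[of A] fA by blast
    then obtain f1 :: "'a \<Rightarrow> real" where f1: "test_fun (perforated \<delta>) f1" "sqn f1 > 0"
      "sqn (grad f1) / sqn f1 < (1 + \<eta>) * \<mu>" by (auto simp: A_def)
    define \<phi> where "\<phi> x = 1 / sqrt (sqn f1) * f1 x" for x
    have \<phi>: "test_fun (perforated \<delta>) \<phi>" unfolding \<phi>_def by (rule test_fun_cmult[OF f1(1)])
    have s\<phi>: "sqn \<phi> = 1" unfolding \<phi>_def sqn_cmult using f1(2) by (simp add: power_divide)
    define D where "D = sqn (grad \<phi>)"
    have "grad \<phi> = (\<lambda>x. (1 / sqrt (sqn f1)) *\<^sub>R grad f1 x)"
      unfolding \<phi>_def by (intro ext grad_cmult test_fun_smooth[OF f1(1)])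
    then have De: "D = sqn (grad f1) / sqn f1"
      unfolding D_def using f1(2) by (simp only: sqn_scaleR) (simp add: power_divide)
    have D1: "\<mu> \<le> D" using \<mu>l[OF \<phi>] s\<phi> by (simp add: D_def)
    have D2: "D < (1 + \<eta>) * \<mu>" using f1(3) De by simp
    have D0: "D > 0" using D1 \<mu>0 by linarith
    have "D \<le> 2 * (\<eta> / ?m)"
    proof -
      have "(1 + \<eta>) * \<mu> \<le> 2 * (\<eta> / ?m)" using \<eta> \<mu>e \<mu>0 by (intro mult_mono) auto
      then show ?thesis using D2 by linarith
    qed
    \<comment> \<open>This is why the Rayleigh quotient was required to be below \<eta> divided by
      the dimension.\<close>
    then have mD: "?m / 2 * D \<le> \<eta>" using m by (simp add: field_simps)
    obtain K where K: "compact K" "\<And>x. x \<notin> K \<Longrightarrow> \<phi> x = 0" using \<phi> test_funE by metis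
    obtain r where r: "r > 0" "\<And>x. x \<in> K \<Longrightarrow> norm x \<le> r"
      using compact_imp_bounded[OF K(1)] by (auto simp: bounded_pos)
    have each: "(1 - 2 * \<eta>)\<^sup>2 / (1 + \<eta>) * (real (Suc N) / (real (Suc N) + 2 * (r + 1))) ^ DIM('a) \<le> X" for N
    proof -
      let ?t = "(real (Suc N) / (real (Suc N) + 2 * (r + 1))) ^ DIM('a)"
      have t0: "?t \<ge> 0" using r(1) by simp
      obtain U :: "'a set" where U: "open U" "0 < emeasure lborel U" "emeasure lborel U < \<infinity>"
        and F: "\<mu> / D * (1 - \<eta> - ?m / 2 * D)\<^sup>2 * ?t \<le> F_fun 1 U"
      proof -
        have "\<exists>U::'a set. open U \<and> 0 < emeasure lborel U \<and> emeasure lborel U < \<infinity> \<and>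
            \<mu> / D * (1 - \<eta> - ?m / 2 * D)\<^sup>2 * ?t \<le> F_fun 1 U"
        proof (rule perforated_box_F1[OF \<phi> s\<phi> _ _ _ \<mu>l _ D_def D0 \<eta>(1), of r])
          show "norm x \<le> r" if "\<phi> x \<noteq> 0" for x using that K(2) r(2) by blast
          show "0 \<le> 1 - \<eta> - ?m / 2 * D" using mD \<eta> by linarith
        qed (use r(1) \<mu>0 in auto)
        then show ?thesis using that by blast
      qed
      have "1 / (1 + \<eta>) \<le> \<mu> / D" using D2 D0 \<eta> by (simp add: field_simps)
      moreover have "(1 - 2 * \<eta>)\<^sup>2 \<le> (1 - \<eta> - ?m / 2 * D)\<^sup>2" using mD \<eta> by (intro power_mono) auto
      ultimately have "1 / (1 + \<eta>) * (1 - 2 * \<eta>)\<^sup>2 * ?t \<le> \<mu> / D * (1 - \<eta> - ?m / 2 * D)\<^sup>2 * ?t"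
        using \<eta> t0 \<mu>0 D0 by (intro mult_right_mono mult_mono) auto
      then show ?thesis using F X[OF U] by simp
    qed
    have "(\<lambda>N. real (Suc N) / (real (Suc N) + 2 * (r + 1))) \<longlonglongrightarrow> 1"
    proof -
      have "(\<lambda>N. 1 / (1 + 2 * (r + 1) * inverse (real (Suc N)))) \<longlonglongrightarrow> 1 / (1 + 2 * (r + 1) * 0)"
        by (intro tendsto_intros LIMSEQ_inverse_real_of_nat) simp
      moreover have "1 / (1 + 2 * (r + 1) * inverse (real (Suc N))) = real (Suc N) / (real (Suc N) + 2 * (r + 1))" for N
        using r(1) by (simp add: field_simps del: of_nat_Suc)
      ultimately show ?thesis by simp
    qed
    then have "(\<lambda>N. (1 - 2 * \<eta>)\<^sup>2 / (1 + \<eta>) * (real (Suc N) / (real (Suc N) + 2 * (r + 1))) ^ DIM('a))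
        \<longlonglongrightarrow> (1 - 2 * \<eta>)\<^sup>2 / (1 + \<eta>) * 1 ^ DIM('a)"
      by (intro tendsto_intros)
    then show ?thesis using each by (intro LIMSEQ_le_const2) auto
  qed
  define \<eta> where "\<eta> k = inverse (real (Suc k)) / 4" for k
  have "(\<lambda>k. inverse (real (Suc k)) / 4) \<longlonglongrightarrow> 0 / 4"
    by (intro tendsto_divide LIMSEQ_inverse_real_of_nat tendsto_const) simp
  then have lim: "\<eta> \<longlonglongrightarrow> 0" unfolding \<eta>_def[abs_def] by (simp only: div_0)
  have "(\<lambda>k. (1 - 2 * \<eta> k)\<^sup>2 / (1 + \<eta> k)) \<longlonglongrightarrow> (1 - 2 * 0)\<^sup>2 / (1 + 0)"
    by (intro tendsto_intros lim) simp
  moreover have "(1 - 2 * \<eta> k)\<^sup>2 / (1 + \<eta> k) \<le> X" for k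
    by (rule step) (auto simp: \<eta>_def field_simps)
  ultimately show ?thesis using LIMSEQ_le_const2 by fastforce
qed

section \<open>Differentiability at 2\<close>

text \<open>\<open>max 2 p\<close> treats both sides of 2 at once: for p <= 2 monotonicity compares
  with exponent 2, where the constant is 1.\<close>

lemma F_sup_bounds:
  assumes dim: "DIM('a::euclidean_space) \<ge> 2" and p: "p \<ge> 1"
  shows "1 \<le> F_sup TYPE('a) p" "F_sup TYPE('a) p \<le> (max 2 p)\<^sup>2 / (4 * (max 2 p - 1))"
proof -
  let ?A = "{F_fun p U | U::'a set. open U \<and> 0 < emeasure lborel U \<and> emeasure lborel U < \<infinity>}"
  have le: "F_fun p U \<le> (max 2 p)\<^sup>2 / (4 * (max 2 p - 1))"
    if "open U" "0 < emeasure lborel U" "emeasure lborel U < \<infinity>" for U :: "'a set"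
    using F_fun_mono[OF that p, of "max 2 p"] F_fun_le[OF that, of "max 2 p"] by simp
  have "open (ball (0::'a) 1)" "0 < emeasure lborel (ball (0::'a) 1)" "emeasure lborel (ball (0::'a) 1) < \<infinity>"
    using open_emeasure_pos[of "ball (0::'a) 1" 0] emeasure_lborel_ball_finite[of "0::'a" 1] by auto
  then have ne: "?A \<noteq> {}" by blast
  have bdd: "bdd_above ?A" using le by (intro bdd_aboveI) blast
  show "F_sup TYPE('a) p \<le> (max 2 p)\<^sup>2 / (4 * (max 2 p - 1))"
    unfolding F_sup_def using le by (intro cSup_least ne) blast
  show "1 \<le> F_sup TYPE('a) p"
  proof (rule F_fun_1_sup_ge[OF dim])
    fix U :: "'a set" assume U: "open U" "0 < emeasure lborel U" "emeasure lborel U < \<infinity>"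
    have "F_fun 1 U \<le> F_fun p U" by (rule F_fun_mono[OF U _ p]) simp
    also have "\<dots> \<le> F_sup TYPE('a) p" unfolding F_sup_def using U by (intro cSup_upper bdd) blast
    finally show "F_fun 1 U \<le> F_sup TYPE('a) p" .
  qed
qed

theorem theorem3:
  assumes "DIM('a::euclidean_space) \<ge> 2"
  shows "((\<lambda>p. F_sup TYPE('a) p) has_real_derivative 0) (at 2 within {1..})"
proof -
  let ?F = "F_sup TYPE('a)"
  have F2: "?F 2 = 1" using F_sup_bounds[OF assms, of 2] by simp
  \<comment> \<open>A quadratic bound at 2 makes the difference quotient there at most |p -
    2|.\<close>
  have bound: "\<bar>?F p - 1\<bar> \<le> (p - 2)\<^sup>2" if p: "p \<ge> 1" for p
  proof (cases "p \<le> 2")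
    case True
    then have "?F p = 1" using F_sup_bounds[OF assms p] by (simp add: max_absorb1)
    then show ?thesis by simp
  next
    case False
    then have "1 \<le> ?F p" "?F p \<le> p\<^sup>2 / (4 * (p - 1))"
      using F_sup_bounds[OF assms p] by (simp_all add: max_absorb2)
    \<comment> \<open>This is p^2 = 4(p-1) + (p-2)^2: the constant has its minimum 1 at p =
      2.\<close>
    moreover have "p\<^sup>2 / (4 * (p - 1)) = 1 + (p - 2)\<^sup>2 / (4 * (p - 1))"
      using False by (simp add: field_simps power2_eq_square)
    moreover have "(p - 2)\<^sup>2 / (4 * (p - 1)) \<le> (p - 2)\<^sup>2 / 1"
      using False by (intro divide_left_mono) auto
    ultimately show ?thesis by simp
  qed
  have "((\<lambda>p. (?F p - ?F 2) / (p - 2)) \<longlongrightarrow> 0) (at 2 within {1..})"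
  proof (rule Lim_null_comparison)
    have "((\<lambda>p. \<bar>p - 2\<bar>) \<longlongrightarrow> \<bar>2 - 2\<bar>) (at 2 within {1..} :: real filter)"
      by (intro tendsto_intros)
    then show "((\<lambda>p. \<bar>p - 2\<bar>) \<longlongrightarrow> 0) (at 2 within {1..} :: real filter)" by simp
    show "\<forall>\<^sub>F p in at 2 within {1..}. norm ((?F p - ?F 2) / (p - 2)) \<le> \<bar>p - 2\<bar>"
      unfolding eventually_at_filter
    proof (intro always_eventually allI impI)
      fix p :: real assume "p \<noteq> 2" "p \<in> {1..}"
      then have "\<bar>?F p - 1\<bar> \<le> \<bar>p - 2\<bar> * \<bar>p - 2\<bar>" "\<bar>p - 2\<bar> > 0"
        using bound[of p] by (auto simp: power2_eq_square)
      then show "norm ((?F p - ?F 2) / (p - 2)) \<le> \<bar>p - 2\<bar>"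
        by (simp add: F2 pos_divide_le_eq)
    qed
  qed
  then show ?thesis by (simp add: has_field_derivative_iff)
qed

end
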